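(* Let $\mathcal{C}$ be a proper model category, and let $I$ and $J$ be the classes of fibrations and acyclic fibrations in $\mathcal{C}$ respectively. Let $cI$ and $cJ$ be the images of $I$ and $J$ under the constant functor $c:\mathcal{C}\to\mathrm{pro}\text{-}\mathcal{C}$. Then a map in $\mathrm{pro}\text{-}\mathcal{C}$ is a strict cofibration if and only if it has the left lifting property with respect to every map in $cJ$, and a map in $\mathrm{pro}\text{-}\mathcal{C}$ is a strict acyclic cofibration if and only if it has the left lifting property with respect to every map in $cI$.
   Context: A category $I$ is cofiltering (cofiltered) if it is non-empty and small; for all objects $s,t$ there is an object $u$ with maps $u\to s$ and $u\to t$; and for all parallel morphisms $f,g$ there is a morphism $h$ with $fh=gh$. The category $\mathrm{pro}\text{-}\mathcal{C}$ has as objects all functors from cofiltering categories to $\mathcal{C}$ and morphisms $\mathrm{Hom}(X,Y)=\lim_s\operatorname{colim}_t \mathrm{Hom}_{\mathcal{C}}(X_t,Y_s)$, with the natural composition. The constant functor $c$ sends an object $X$ of $\mathcal{C}$ to the pro-object with value $X$ indexed by the category with one object and one map. A level representation of a map $f:X\to Y$ in $\mathrm{pro}\text{-}\mathcal{C}$ consists of a cofiltered category $K$, functors $\tilde X,\tilde Y:K\to\mathcal{C}$, isomorphisms $X\cong\tilde X$, $Y\cong\tilde Y$ in $\mathrm{pro}\text{-}\mathcal{C}$, and a natural transformation $\{f_s:\tilde X_s\to\tilde Y_s\}_{s\in K}$ whose induced map in $\mathrm{pro}\text{-}\mathcal{C}$ corresponds to $f$ under these isomorphisms. A map of $\mathrm{pro}\text{-}\mathcal{C}$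 has a property essentially levelwise if it has some level representation all of whose maps $f_s$ have the property. Strict weak equivalences are the essentially levelwise weak equivalences. Strict cofibrations are the essentially levelwise cofibrations. A strict acyclic cofibration is a map that is both a strict cofibration and a strict weak equivalence. Model categories have all small limits and colimits; proper means left and right proper. *)

theory Defs
  imports Main "HOL-Library.FuncSet" "HOL-Library.Equipollence"
begin

section \<open>Categories, functors, natural transformations\<close>

record ('o, 'a) cat =
  Obj :: "'o set"
  Arr :: "'a set"
  Dom :: "'a \<Rightarrow> 'o"
  Cod :: "'a \<Rightarrow> 'o"
  Ident :: "'o \<Rightarrow> 'a"
  Comp :: "'a \<Rightarrow> 'a \<Rightarrow> 'a"  (infixl \<open>\<cdot>\<index>\<close> 70)

definition hom_set :: "('o, 'a, 'z) cat_scheme \<Rightarrow> 'o \<Rightarrow> 'o \<Rightarrow> 'a set" where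
  "hom_set C x y = {f \<in> Arr C. Dom C f = x \<and> Cod C f = y}"

locale category =
  fixes C :: "('o, 'a, 'z) cat_scheme" (structure)
  assumes dom_obj: "f \<in> Arr C \<Longrightarrow> Dom C f \<in> Obj C"
    and cod_obj: "f \<in> Arr C \<Longrightarrow> Cod C f \<in> Obj C"
    and ident_hom: "x \<in> Obj C \<Longrightarrow> Ident C x \<in> hom_set C x x"
    and comp_hom: "\<lbrakk>f \<in> hom_set C x y; g \<in> hom_set C y z\<rbrakk> \<Longrightarrow> g \<cdot> f \<in> hom_set C x z"
    and comp_assoc: "\<lbrakk>f \<in> hom_set C w x; g \<in> hom_set C x y; h \<in> hom_set C y z\<rbrakk>
      \<Longrightarrow> h \<cdot> (g \<cdot> f) = (h \<cdot> g) \<cdot> f"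
    and comp_ident_right: "f \<in> hom_set C x y \<Longrightarrow> f \<cdot> Ident C x = f"
    and comp_ident_left: "f \<in> hom_set C x y \<Longrightarrow> Ident C y \<cdot> f = f"

record ('p, 'q, 'o, 'a) fctr =
  ObMap :: "'p \<Rightarrow> 'o"
  ArMap :: "'q \<Rightarrow> 'a"

definition is_functor ::
  "('p, 'q, 'y) cat_scheme \<Rightarrow> ('o, 'a, 'z) cat_scheme \<Rightarrow> ('p, 'q, 'o, 'a) fctr \<Rightarrow> bool" where
  "is_functor K C F \<longleftrightarrow>
     (\<forall>s\<in>Obj K. ObMap F s \<in> Obj C) \<and>
     (\<forall>u\<in>Arr K. ArMap F u \<in> hom_set C (ObMap F (Dom K u)) (ObMap F (Cod K u))) \<and>
     (\<forall>s\<in>Obj K. ArMap F (Ident K s) = Ident C (ObMap F s)) \<and>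
     (\<forall>u\<in>Arr K. \<forall>v\<in>Arr K. Cod K u = Dom K v \<longrightarrow>
        ArMap F (v \<cdot>\<^bsub>K\<^esub> u) = ArMap F v \<cdot>\<^bsub>C\<^esub> ArMap F u)"

definition nat_trans ::
  "('p, 'q, 'y) cat_scheme \<Rightarrow> ('o, 'a, 'z) cat_scheme \<Rightarrow> ('p, 'q, 'o, 'a) fctr
     \<Rightarrow> ('p, 'q, 'o, 'a) fctr \<Rightarrow> ('p \<Rightarrow> 'a) \<Rightarrow> bool" where
  "nat_trans K C F G \<tau> \<longleftrightarrow>
     (\<forall>s\<in>Obj K. \<tau> s \<in> hom_set C (ObMap F s) (ObMap G s)) \<and>
     (\<forall>u\<in>Arr K. \<tau> (Cod K u) \<cdot>\<^bsub>C\<^esub> ArMap F u = ArMap G u \<cdot>\<^bsub>C\<^esub> \<tau> (Dom K u))"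

definition is_iso :: "('o, 'a, 'z) cat_scheme \<Rightarrow> 'a \<Rightarrow> bool" where
  "is_iso C f \<longleftrightarrow> f \<in> Arr C \<and>
     (\<exists>g \<in> hom_set C (Cod C f) (Dom C f).
        g \<cdot>\<^bsub>C\<^esub> f = Ident C (Dom C f) \<and> f \<cdot>\<^bsub>C\<^esub> g = Ident C (Cod C f))"

definition has_llp :: "('o, 'a, 'z) cat_scheme \<Rightarrow> 'a \<Rightarrow> 'a \<Rightarrow> bool" where
  "has_llp C i p \<longleftrightarrow>
     (\<forall>u \<in> hom_set C (Dom C i) (Dom C p). \<forall>v \<in> hom_set C (Cod C i) (Cod C p).
        p \<cdot>\<^bsub>C\<^esub> u = v \<cdot>\<^bsub>C\<^esub> i \<longrightarrow>
        (\<exists>h \<in> hom_set C (Cod C i) (Dom C p). h \<cdot>\<^bsub>C\<^esub> i = u \<and> p \<cdot>\<^bsub>C\<^esub> h = v))"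

definition is_retract :: "('o, 'a, 'z) cat_scheme \<Rightarrow> 'a \<Rightarrow> 'a \<Rightarrow> bool" where
  "is_retract C f g \<longleftrightarrow>
     f \<in> Arr C \<and> g \<in> Arr C \<and>
     (\<exists>i \<in> hom_set C (Dom C f) (Dom C g). \<exists>r \<in> hom_set C (Dom C g) (Dom C f).
      \<exists>j \<in> hom_set C (Cod C f) (Cod C g). \<exists>q \<in> hom_set C (Cod C g) (Cod C f).
        r \<cdot>\<^bsub>C\<^esub> i = Ident C (Dom C f) \<and> q \<cdot>\<^bsub>C\<^esub> j = Ident C (Cod C f) \<and>
        g \<cdot>\<^bsub>C\<^esub> i = j \<cdot>\<^bsub>C\<^esub> f \<and> f \<cdot>\<^bsub>C\<^esub> r = q \<cdot>\<^bsub>C\<^esub> g)"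


section \<open>Smallness\<close>

text \<open>HOL has no sets-versus-classes distinction, so the collection \<open>U\<close> of small sets is a
  parameter: arbitrary subsets of the types \<open>'o\<close>, \<open>'a\<close> of objects and arrows play the role of
  classes, and small categories have their objects and arrows in a member of \<open>U\<close>. The sets whose
  cardinality is below an inaccessible cardinal satisfy the axioms below, so a universe of sets is an
  instance. Closure under power sets is not imposed; the sets below any uncountable regular
  cardinal, or all subsets of an infinite type, are instances too.\<close>

definition smallness :: "'i set set \<Rightarrow> bool" where
  "smallness U \<longleftrightarrow>
     (\<exists>A\<in>U. infinite A) \<and>
     (\<forall>A B. B \<in> U \<and> A \<lesssim> B \<longrightarrow> A \<in> U) \<and>
     (\<forall>A\<in>U. \<forall>F. (\<forall>a\<in>A. F a \<in> U) \<longrightarrow> (\<Union>a\<in>A. F a) \<in> U)"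

definition small_category :: "'i set set \<Rightarrow> ('i, 'i) cat \<Rightarrow> bool" where
  "small_category U K \<longleftrightarrow> category K \<and> Obj K \<in> U \<and> Arr K \<in> U"

definition is_cone ::
  "('p, 'q, 'y) cat_scheme \<Rightarrow> ('o, 'a, 'z) cat_scheme \<Rightarrow> ('p, 'q, 'o, 'a) fctr
     \<Rightarrow> 'o \<Rightarrow> ('p \<Rightarrow> 'a) \<Rightarrow> bool" where
  "is_cone K C F x \<pi> \<longleftrightarrow> x \<in> Obj C \<and>
     (\<forall>s\<in>Obj K. \<pi> s \<in> hom_set C x (ObMap F s)) \<and>
     (\<forall>u\<in>Arr K. ArMap F u \<cdot>\<^bsub>C\<^esub> \<pi> (Dom K u) = \<pi> (Cod K u))"

definition is_limit ::
  "('p, 'q, 'y) cat_scheme \<Rightarrow> ('o, 'a, 'z) cat_scheme \<Rightarrow> ('p, 'q, 'o, 'a) fctr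
     \<Rightarrow> 'o \<Rightarrow> ('p \<Rightarrow> 'a) \<Rightarrow> bool" where
  "is_limit K C F x \<pi> \<longleftrightarrow> is_cone K C F x \<pi> \<and>
     (\<forall>y \<rho>. is_cone K C F y \<rho> \<longrightarrow>
        (\<exists>!h. h \<in> hom_set C y x \<and> (\<forall>s\<in>Obj K. \<pi> s \<cdot>\<^bsub>C\<^esub> h = \<rho> s)))"

definition is_cocone ::
  "('p, 'q, 'y) cat_scheme \<Rightarrow> ('o, 'a, 'z) cat_scheme \<Rightarrow> ('p, 'q, 'o, 'a) fctr
     \<Rightarrow> 'o \<Rightarrow> ('p \<Rightarrow> 'a) \<Rightarrow> bool" where
  "is_cocone K C F x \<iota> \<longleftrightarrow> x \<in> Obj C \<and>
     (\<forall>s\<in>Obj K. \<iota> s \<in> hom_set C (ObMap F s) x) \<and>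
     (\<forall>u\<in>Arr K. \<iota> (Cod K u) \<cdot>\<^bsub>C\<^esub> ArMap F u = \<iota> (Dom K u))"

definition is_colimit ::
  "('p, 'q, 'y) cat_scheme \<Rightarrow> ('o, 'a, 'z) cat_scheme \<Rightarrow> ('p, 'q, 'o, 'a) fctr
     \<Rightarrow> 'o \<Rightarrow> ('p \<Rightarrow> 'a) \<Rightarrow> bool" where
  "is_colimit K C F x \<iota> \<longleftrightarrow> is_cocone K C F x \<iota> \<and>
     (\<forall>y \<rho>. is_cocone K C F y \<rho> \<longrightarrow>
        (\<exists>!h. h \<in> hom_set C x y \<and> (\<forall>s\<in>Obj K. h \<cdot>\<^bsub>C\<^esub> \<iota> s = \<rho> s)))"

definition has_small_limits :: "'i set set \<Rightarrow> ('o, 'a, 'z) cat_scheme \<Rightarrow> bool" where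
  "has_small_limits U C \<longleftrightarrow>
     (\<forall>K F. small_category U K \<and> is_functor K C F \<longrightarrow> (\<exists>x \<pi>. is_limit K C F x \<pi>))"

definition has_small_colimits :: "'i set set \<Rightarrow> ('o, 'a, 'z) cat_scheme \<Rightarrow> bool" where
  "has_small_colimits U C \<longleftrightarrow>
     (\<forall>K F. small_category U K \<and> is_functor K C F \<longrightarrow> (\<exists>x \<iota>. is_colimit K C F x \<iota>))"


section \<open>Proper model categories\<close>

text \<open>\<open>is_pullback C p q f g\<close>: the square \<open>f \<cdot> p = g \<cdot> q\<close> is a pullback square, so \<open>q\<close> is the
  base change of \<open>f\<close> along \<open>g\<close>. Dually for \<open>is_pushout C f g p q\<close>, with square \<open>p \<cdot> f = q \<cdot> g\<close> and
  \<open>q\<close> the cobase change of \<open>f\<close> along \<open>g\<close>.\<close>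

definition is_pullback :: "('o, 'a, 'z) cat_scheme \<Rightarrow> 'a \<Rightarrow> 'a \<Rightarrow> 'a \<Rightarrow> 'a \<Rightarrow> bool" where
  "is_pullback C p q f g \<longleftrightarrow>
     {p, q, f, g} \<subseteq> Arr C \<and> Dom C p = Dom C q \<and> Cod C p = Dom C f \<and> Cod C q = Dom C g \<and>
     Cod C f = Cod C g \<and> f \<cdot>\<^bsub>C\<^esub> p = g \<cdot>\<^bsub>C\<^esub> q \<and>
     (\<forall>w. \<forall>a \<in> hom_set C w (Dom C f). \<forall>b \<in> hom_set C w (Dom C g).
        f \<cdot>\<^bsub>C\<^esub> a = g \<cdot>\<^bsub>C\<^esub> b \<longrightarrow>
        (\<exists>!h. h \<in> hom_set C w (Dom C p) \<and> p \<cdot>\<^bsub>C\<^esub> h = a \<and> q \<cdot>\<^bsub>C\<^esub> h = b))"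

definition is_pushout :: "('o, 'a, 'z) cat_scheme \<Rightarrow> 'a \<Rightarrow> 'a \<Rightarrow> 'a \<Rightarrow> 'a \<Rightarrow> bool" where
  "is_pushout C f g p q \<longleftrightarrow>
     {f, g, p, q} \<subseteq> Arr C \<and> Cod C p = Cod C q \<and> Dom C p = Cod C f \<and> Dom C q = Cod C g \<and>
     Dom C f = Dom C g \<and> p \<cdot>\<^bsub>C\<^esub> f = q \<cdot>\<^bsub>C\<^esub> g \<and>
     (\<forall>w. \<forall>a \<in> hom_set C (Cod C f) w. \<forall>b \<in> hom_set C (Cod C g) w.
        a \<cdot>\<^bsub>C\<^esub> f = b \<cdot>\<^bsub>C\<^esub> g \<longrightarrow>
        (\<exists>!h. h \<in> hom_set C (Cod C p) w \<and> h \<cdot>\<^bsub>C\<^esub> p = a \<and> h \<cdot>\<^bsub>C\<^esub> q = b))"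

record ('o, 'a) model_cat = "('o, 'a) cat" +
  Weq :: "'a set"
  Cofib :: "'a set"
  Fib :: "'a set"

text \<open>Factorizations are not required to be functorial.\<close>

locale model_category = category M
  for U :: "'i set set" and M :: "('o, 'a) model_cat" (structure) +
  assumes small_limits: "has_small_limits U M"
    and small_colimits: "has_small_colimits U M"
    and weq_arr: "Weq M \<subseteq> Arr M"
    and cofib_arr: "Cofib M \<subseteq> Arr M"
    and fib_arr: "Fib M \<subseteq> Arr M"
    and two_of_three: "\<lbrakk>f \<in> hom_set M x y; g \<in> hom_set M y z;
        f \<in> Weq M \<and> g \<in> Weq M \<or> f \<in> Weq M \<and> g \<cdot> f \<in> Weq M \<or> g \<in> Weq M \<and> g \<cdot> f \<in> Weq M\<rbrakk>
      \<Longrightarrow> f \<in> Weq M \<and> g \<in> Weq M \<and> g \<cdot> f \<in> Weq M"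
    and weq_retract: "\<lbrakk>is_retract M f g; g \<in> Weq M\<rbrakk> \<Longrightarrow> f \<in> Weq M"
    and cofib_retract: "\<lbrakk>is_retract M f g; g \<in> Cofib M\<rbrakk> \<Longrightarrow> f \<in> Cofib M"
    and fib_retract: "\<lbrakk>is_retract M f g; g \<in> Fib M\<rbrakk> \<Longrightarrow> f \<in> Fib M"
    and lift_cofib: "\<lbrakk>i \<in> Cofib M; p \<in> Fib M \<inter> Weq M\<rbrakk> \<Longrightarrow> has_llp M i p"
    and lift_acyclic_cofib: "\<lbrakk>i \<in> Cofib M \<inter> Weq M; p \<in> Fib M\<rbrakk> \<Longrightarrow> has_llp M i p"
    and factor_cofib: "f \<in> Arr M \<Longrightarrow>
      \<exists>i \<in> Cofib M. \<exists>p \<in> Fib M \<inter> Weq M. Cod M i = Dom M p \<and> f = p \<cdot> i"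
    and factor_acyclic_cofib: "f \<in> Arr M \<Longrightarrow>
      \<exists>i \<in> Cofib M \<inter> Weq M. \<exists>p \<in> Fib M. Cod M i = Dom M p \<and> f = p \<cdot> i"

locale proper_model_category = model_category U M
  for U :: "'i set set" and M :: "('o, 'a) model_cat" (structure) +
  assumes left_proper: "\<lbrakk>is_pushout M f g p q; f \<in> Weq M; g \<in> Cofib M\<rbrakk> \<Longrightarrow> q \<in> Weq M"
    and right_proper: "\<lbrakk>is_pullback M p q f g; f \<in> Weq M; g \<in> Fib M\<rbrakk> \<Longrightarrow> q \<in> Weq M"


section \<open>The pro-category\<close>

definition cofiltering :: "'i set set \<Rightarrow> ('i, 'i) cat \<Rightarrow> bool" where
  "cofiltering U K \<longleftrightarrow> small_category U K \<and> Obj K \<noteq> {} \<and>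
     (\<forall>s\<in>Obj K. \<forall>t\<in>Obj K. \<exists>u\<in>Obj K. hom_set K u s \<noteq> {} \<and> hom_set K u t \<noteq> {}) \<and>
     (\<forall>s t. \<forall>f \<in> hom_set K s t. \<forall>g \<in> hom_set K s t.
        \<exists>h\<in>Arr K. Cod K h = s \<and> f \<cdot>\<^bsub>K\<^esub> h = g \<cdot>\<^bsub>K\<^esub> h)"

record ('i, 'o, 'a) pro_obj =
  Index :: "('i, 'i) cat"
  Diag :: "('i, 'i, 'o, 'a) fctr"

abbreviation at_index :: "('i, 'o, 'a) pro_obj \<Rightarrow> 'i \<Rightarrow> 'o" where
  "at_index X s \<equiv> ObMap (Diag X) s"

definition pro_objs :: "'i set set \<Rightarrow> ('o, 'a, 'z) cat_scheme \<Rightarrow> ('i, 'o, 'a) pro_obj set" where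
  "pro_objs U C = {X. cofiltering U (Index X) \<and> is_functor (Index X) C (Diag X)}"

text \<open>The set \<open>colim\<^sub>t Hom(X\<^sub>t, y)\<close> is the quotient of the disjoint union of the sets
  \<open>Hom(X\<^sub>t, y)\<close>, with elements the pairs \<open>(t, g)\<close>, by the equivalence relation generated by
  identifying \<open>(t, g)\<close> with \<open>(t', g \<circ> X\<^sub>u)\<close> for \<open>u : t' \<rightarrow> t\<close>.\<close>

definition colim_elems ::
  "('o, 'a, 'z) cat_scheme \<Rightarrow> ('i, 'o, 'a) pro_obj \<Rightarrow> 'o \<Rightarrow> ('i \<times> 'a) set" where
  "colim_elems C X y = (SIGMA t : Obj (Index X). hom_set C (at_index X t) y)"

definition colim_step ::
  "('o, 'a, 'z) cat_scheme \<Rightarrow> ('i, 'o, 'a) pro_obj \<Rightarrow> 'o \<Rightarrow> 'i \<times> 'a \<Rightarrow> 'i \<times> 'a \<Rightarrow> bool" where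
  "colim_step C X y a b \<longleftrightarrow>
     (\<exists>u \<in> Arr (Index X). \<exists>g \<in> hom_set C (at_index X (Cod (Index X) u)) y.
        a = (Cod (Index X) u, g) \<and> b = (Dom (Index X) u, g \<cdot>\<^bsub>C\<^esub> ArMap (Diag X) u))"

definition colim_class ::
  "('o, 'a, 'z) cat_scheme \<Rightarrow> ('i, 'o, 'a) pro_obj \<Rightarrow> 'o \<Rightarrow> 'i \<times> 'a \<Rightarrow> ('i \<times> 'a) set" where
  "colim_class C X y a = {b. equivclp (colim_step C X y) a b}"

definition colim_hom ::
  "('o, 'a, 'z) cat_scheme \<Rightarrow> ('i, 'o, 'a) pro_obj \<Rightarrow> 'o \<Rightarrow> ('i \<times> 'a) set set" where
  "colim_hom C X y = colim_class C X y ` colim_elems C X y"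

text \<open>The set \<open>lim\<^sub>s colim\<^sub>t Hom(X\<^sub>t, Y\<^sub>s)\<close> of compatible families. The map
  \<open>colim\<^sub>t Hom(X\<^sub>t, Y\<^sub>s) \<rightarrow> colim\<^sub>t Hom(X\<^sub>t, Y\<^sub>s\<^sub>')\<close> induced by \<open>v : s \<rightarrow> s'\<close> sends the class of
  \<open>(t, g)\<close> to the class of \<open>(t, Y\<^sub>v \<circ> g)\<close>.\<close>

definition pro_hom ::
  "('o, 'a, 'z) cat_scheme \<Rightarrow> ('i, 'o, 'a) pro_obj \<Rightarrow> ('i, 'o, 'a) pro_obj
     \<Rightarrow> ('i \<Rightarrow> ('i \<times> 'a) set) set" where
  "pro_hom C X Y =
     {\<phi> \<in> (\<Pi>\<^sub>E s \<in> Obj (Index Y). colim_hom C X (at_index Y s)).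
        \<forall>v \<in> Arr (Index Y). \<forall>(t, g) \<in> \<phi> (Dom (Index Y) v).
          \<phi> (Cod (Index Y) v)
            = colim_class C X (at_index Y (Cod (Index Y) v)) (t, ArMap (Diag Y) v \<cdot>\<^bsub>C\<^esub> g)}"

record ('i, 'o, 'a) pro_arr =
  Src :: "('i, 'o, 'a) pro_obj"
  Tgt :: "('i, 'o, 'a) pro_obj"
  Family :: "'i \<Rightarrow> ('i \<times> 'a) set"

definition pro_ident ::
  "('o, 'a, 'z) cat_scheme \<Rightarrow> ('i, 'o, 'a) pro_obj \<Rightarrow> ('i, 'o, 'a) pro_arr" where
  "pro_ident C X = \<lparr>Src = X, Tgt = X,
     Family = (\<lambda>s \<in> Obj (Index X). colim_class C X (at_index X s) (s, Ident C (at_index X s)))\<rparr>"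

text \<open>At index \<open>r\<close>, the composite of \<open>F : X \<rightarrow> Y\<close> and \<open>G : Y \<rightarrow> Z\<close> is the class of
  \<open>(t, h \<circ> g)\<close> for any \<open>(s, h)\<close> representing \<open>G\<close> at \<open>r\<close> and any \<open>(t, g)\<close> representing \<open>F\<close> at \<open>s\<close>; all
  these classes coincide, and the union merely selects the common value.\<close>

definition pro_comp ::
  "('o, 'a, 'z) cat_scheme \<Rightarrow> ('i, 'o, 'a) pro_arr \<Rightarrow> ('i, 'o, 'a) pro_arr
     \<Rightarrow> ('i, 'o, 'a) pro_arr" where
  "pro_comp C G F = \<lparr>Src = Src F, Tgt = Tgt G,
     Family = (\<lambda>r \<in> Obj (Index (Tgt G)).
       \<Union>(s, h) \<in> Family G r. \<Union>(t, g) \<in> Family F s.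
         colim_class C (Src F) (at_index (Tgt G) r) (t, h \<cdot>\<^bsub>C\<^esub> g))\<rparr>"

definition pro_cat ::
  "'i set set \<Rightarrow> ('o, 'a, 'z) cat_scheme
     \<Rightarrow> (('i, 'o, 'a) pro_obj, ('i, 'o, 'a) pro_arr) cat" where
  "pro_cat U C = \<lparr>
     Obj = pro_objs U C,
     Arr = {F. Src F \<in> pro_objs U C \<and> Tgt F \<in> pro_objs U C \<and> Family F \<in> pro_hom C (Src F) (Tgt F)},
     Dom = Src, Cod = Tgt, Ident = pro_ident C, Comp = pro_comp C\<rparr>"

text \<open>The map of pro-objects induced by a natural transformation \<open>\<tau>\<close> of diagrams on \<open>K\<close>.\<close>

definition level_map ::
  "('o, 'a, 'z) cat_scheme \<Rightarrow> ('i, 'i) cat \<Rightarrow> ('i, 'i, 'o, 'a) fctr \<Rightarrow> ('i, 'i, 'o, 'a) fctr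
     \<Rightarrow> ('i \<Rightarrow> 'a) \<Rightarrow> ('i, 'o, 'a) pro_arr" where
  "level_map C K F G \<tau> = (let X = \<lparr>Index = K, Diag = F\<rparr>; Y = \<lparr>Index = K, Diag = G\<rparr> in
     \<lparr>Src = X, Tgt = Y, Family = (\<lambda>s \<in> Obj K. colim_class C X (at_index Y s) (s, \<tau> s))\<rparr>)"

text \<open>The category with one object and one map; \<open>undefined\<close> is just some element of \<open>'i\<close>.\<close>

definition one_cat :: "('i, 'i) cat" where
  "one_cat = \<lparr>Obj = {undefined}, Arr = {undefined}, Dom = (\<lambda>_. undefined), Cod = (\<lambda>_. undefined),
     Ident = (\<lambda>_. undefined), Comp = (\<lambda>_ _. undefined)\<rparr>"

definition const_diag :: "('o, 'a, 'z) cat_scheme \<Rightarrow> 'o \<Rightarrow> ('i, 'i, 'o, 'a) fctr" where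
  "const_diag C x = \<lparr>ObMap = (\<lambda>_. x), ArMap = (\<lambda>_. Ident C x)\<rparr>"

definition const_functor ::
  "('o, 'a, 'z) cat_scheme \<Rightarrow> ('o, 'a, ('i, 'o, 'a) pro_obj, ('i, 'o, 'a) pro_arr) fctr" where
  "const_functor C = \<lparr>
     ObMap = (\<lambda>x. \<lparr>Index = one_cat, Diag = const_diag C x\<rparr>),
     ArMap = (\<lambda>f. level_map C one_cat (const_diag C (Dom C f)) (const_diag C (Cod C f)) (\<lambda>_. f))\<rparr>"


section \<open>Strict cofibrations and strict weak equivalences\<close>

text \<open>\<open>a\<close> and \<open>b\<close> are the isomorphisms from the source and the target of \<open>f\<close> to the diagrams \<open>F\<close>
  and \<open>G\<close> on \<open>K\<close>.\<close>

definition is_level_rep ::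
  "'i set set \<Rightarrow> ('o, 'a, 'z) cat_scheme \<Rightarrow> ('i, 'o, 'a) pro_arr \<Rightarrow> ('i, 'i) cat
     \<Rightarrow> ('i, 'i, 'o, 'a) fctr \<Rightarrow> ('i, 'i, 'o, 'a) fctr
     \<Rightarrow> ('i, 'o, 'a) pro_arr \<Rightarrow> ('i, 'o, 'a) pro_arr \<Rightarrow> ('i \<Rightarrow> 'a) \<Rightarrow> bool" where
  "is_level_rep U C f K F G a b \<tau> \<longleftrightarrow>
     f \<in> Arr (pro_cat U C) \<and> cofiltering U K \<and>
     is_functor K C F \<and> is_functor K C G \<and> nat_trans K C F G \<tau> \<and>
     a \<in> hom_set (pro_cat U C) (Src f) \<lparr>Index = K, Diag = F\<rparr> \<and> is_iso (pro_cat U C) a \<and>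
     b \<in> hom_set (pro_cat U C) (Tgt f) \<lparr>Index = K, Diag = G\<rparr> \<and> is_iso (pro_cat U C) b \<and>
     b \<cdot>\<^bsub>pro_cat U C\<^esub> f = level_map C K F G \<tau> \<cdot>\<^bsub>pro_cat U C\<^esub> a"

definition essentially_levelwise ::
  "'i set set \<Rightarrow> ('o, 'a, 'z) cat_scheme \<Rightarrow> 'a set \<Rightarrow> ('i, 'o, 'a) pro_arr \<Rightarrow> bool" where
  "essentially_levelwise U C P f \<longleftrightarrow>
     (\<exists>K F G a b \<tau>. is_level_rep U C f K F G a b \<tau> \<and> (\<forall>s \<in> Obj K. \<tau> s \<in> P))"

definition strict_weak_equivalence ::
  "'i set set \<Rightarrow> ('o, 'a) model_cat \<Rightarrow> ('i, 'o, 'a) pro_arr \<Rightarrow> bool" where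
  "strict_weak_equivalence U M = essentially_levelwise U M (Weq M)"

definition strict_cofibration ::
  "'i set set \<Rightarrow> ('o, 'a) model_cat \<Rightarrow> ('i, 'o, 'a) pro_arr \<Rightarrow> bool" where
  "strict_cofibration U M = essentially_levelwise U M (Cofib M)"

definition strict_acyclic_cofibration ::
  "'i set set \<Rightarrow> ('o, 'a) model_cat \<Rightarrow> ('i, 'o, 'a) pro_arr \<Rightarrow> bool" where
  "strict_acyclic_cofibration U M f \<longleftrightarrow> strict_cofibration U M f \<and> strict_weak_equivalence U M f"

end

theory Submission
  imports Defs
begin

text \<open>
  A square from a level map to a constant map already lives at one index. Hence essentially levelwise
  cofibrations lift against constant acyclic fibrations. For a strict weak equivalence and a
  fibration, the level map at that index is factored as an acyclic cofibration followed by an acyclic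
  fibration; the first factor lifts in the model category, the second in the pro-category.

  Conversely, let \<open>f : X \<rightarrow> Y\<close> lift against the constant acyclic fibrations. Factor a representative
  \<open>X\<^sub>i \<rightarrow> Y\<^sub>j\<close> of \<open>f\<close> as a cofibration \<open>X\<^sub>i \<rightarrow> Z\<close> followed by an acyclic fibration \<open>Z \<rightarrow> Y\<^sub>j\<close>. The lift
  \<open>Y \<rightarrow> Z\<close> is represented by some \<open>Y\<^sub>t \<rightarrow> Z\<close>, and the composites \<open>Z' \<rightarrow> Y\<^bsub>j'\<^esub> \<rightarrow> Y\<^sub>t \<rightarrow> Z\<close> organize all
  these cofibrations into a cofiltered diagram of arrows isomorphic to \<open>f\<close>. The same argument with
  acyclic cofibrations and fibrations gives the second equivalence.
\<close>

section \<open>Categories and cofiltering\<close>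

text \<open>Factorizations are not functorial, so the objects \<open>Z\<close> come without
  transition maps; the lifts supply them. A map to a constant object is represented at a single
  index, and so is each lift, but only after restriction in \<open>Y\<close>. The squares relating
  the chosen cofibrations commute only after restriction in \<open>X\<close>, so every restriction
  of a representative gets its own factorization. Arrows of the new index category are recorded by
  arrows of the two given index categories, not by maps of the model category: this keeps it small
  and lets parallel arrows be equalized. The diagram of the \<open>Z\<close> is isomorphic to
  \<open>Y\<close> because lifts \<open>Y\<close> to \<open>Z\<close> and second factors
  \<open>Z\<close> to \<open>Y\<close> interleave. A strict acyclic cofibration comes with two
  unrelated level representations, one by cofibrations and one by weak equivalences, so a priori no
  level is known to be an acyclic cofibration; this forces the two-stage lift. The converse yields a
  single representation with both properties.\<close>

lemma mem_hom_set: "f \<in> hom_set C x y \<longleftrightarrow> f \<in> Arr C \<and> Dom C f = x \<and> Cod C f = y"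
  by (simp add: hom_set_def)

context category
begin

lemma comp_seq:
  assumes "f \<in> Arr C" "g \<in> Arr C" "Cod C f = Dom C g"
  shows "g \<cdot> f \<in> Arr C" "Dom C (g \<cdot> f) = Dom C f" "Cod C (g \<cdot> f) = Cod C g"
  using comp_hom[of f "Dom C f" "Cod C f" g "Cod C g"] assms by (auto simp: mem_hom_set)

lemma comp_assoc_seq:
  assumes "f \<in> Arr C" "g \<in> Arr C" "h \<in> Arr C" "Cod C f = Dom C g" "Cod C g = Dom C h"
  shows "(h \<cdot> g) \<cdot> f = h \<cdot> (g \<cdot> f)"
  using comp_assoc[of f "Dom C f" "Cod C f" g "Cod C g" h "Cod C h"] assms
  by (auto simp: mem_hom_set)

lemma ident_seq:
  assumes "x \<in> Obj C"
  shows "Ident C x \<in> Arr C" "Dom C (Ident C x) = x" "Cod C (Ident C x) = x"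
  using ident_hom[OF assms] by (auto simp: mem_hom_set)

lemma comp_ident_seq:
  assumes "f \<in> Arr C"
  shows "Dom C f = x \<Longrightarrow> f \<cdot> Ident C x = f" "Cod C f = y \<Longrightarrow> Ident C y \<cdot> f = f"
  using comp_ident_right[of f "Dom C f" "Cod C f"] comp_ident_left[of f "Dom C f" "Cod C f"] assms
  by (auto simp: mem_hom_set)

lemmas arr_simps = dom_obj cod_obj comp_seq comp_assoc_seq ident_seq comp_ident_seq

end

lemma functor_seq:
  assumes "is_functor K C F" "u \<in> Arr K"
  shows "ArMap F u \<in> Arr C" "Dom C (ArMap F u) = ObMap F (Dom K u)"
    "Cod C (ArMap F u) = ObMap F (Cod K u)"
  using assms by (auto simp: is_functor_def mem_hom_set)

lemma functor_obj: "is_functor K C F \<Longrightarrow> s \<in> Obj K \<Longrightarrow> ObMap F s \<in> Obj C"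
  by (auto simp: is_functor_def)

lemma functor_ident: "is_functor K C F \<Longrightarrow> s \<in> Obj K \<Longrightarrow> ArMap F (Ident K s) = Ident C (ObMap F s)"
  by (auto simp: is_functor_def)

lemma functor_comp:
  "is_functor K C F \<Longrightarrow> u \<in> Arr K \<Longrightarrow> v \<in> Arr K \<Longrightarrow> Cod K u = Dom K v \<Longrightarrow>
     ArMap F (v \<cdot>\<^bsub>K\<^esub> u) = ArMap F v \<cdot>\<^bsub>C\<^esub> ArMap F u"
  by (auto simp: is_functor_def)

lemmas functor_simps = functor_seq functor_obj functor_ident functor_comp

lemma cofiltering_category: "cofiltering U K \<Longrightarrow> category K"
  by (simp add: cofiltering_def small_category_def)

lemma cofiltering_span:
  assumes "cofiltering U K" "s \<in> Obj K" "t \<in> Obj K"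
  obtains u v where "u \<in> Arr K" "v \<in> Arr K" "Dom K u = Dom K v" "Cod K u = s" "Cod K v = t"
proof -
  have "\<exists>r\<in>Obj K. hom_set K r s \<noteq> {} \<and> hom_set K r t \<noteq> {}"
    using assms unfolding cofiltering_def by blast
  then show ?thesis using that by (auto simp: hom_set_def)
qed

lemma cofiltering_equalize:
  assumes "cofiltering U K" "f \<in> Arr K" "g \<in> Arr K" "Dom K f = Dom K g" "Cod K f = Cod K g"
  obtains h where "h \<in> Arr K" "Cod K h = Dom K f" "f \<cdot>\<^bsub>K\<^esub> h = g \<cdot>\<^bsub>K\<^esub> h"
proof -
  have "f \<in> hom_set K (Dom K f) (Cod K f)" "g \<in> hom_set K (Dom K f) (Cod K f)"
    using assms by (auto simp: hom_set_def)
  then have "\<exists>h\<in>Arr K. Cod K h = Dom K f \<and> f \<cdot>\<^bsub>K\<^esub> h = g \<cdot>\<^bsub>K\<^esub> h"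
    using assms(1) unfolding cofiltering_def by blast
  then show ?thesis using that by blast
qed

text \<open>A span over the two sources, followed by an arrow that equalizes the two
  composites.\<close>

lemma cofiltering_square:
  assumes K: "cofiltering U K" and uv: "u \<in> Arr K" "v \<in> Arr K" "Cod K u = Cod K v"
  obtains p q where "p \<in> Arr K" "q \<in> Arr K" "Dom K p = Dom K q" "Cod K p = Dom K u"
    "Cod K q = Dom K v" "u \<cdot>\<^bsub>K\<^esub> p = v \<cdot>\<^bsub>K\<^esub> q"
proof -
  interpret K: category K using K by (rule cofiltering_category)
  obtain p q where pq: "p \<in> Arr K" "q \<in> Arr K" "Dom K p = Dom K q" "Cod K p = Dom K u"
    "Cod K q = Dom K v"
    using cofiltering_span[OF K, of "Dom K u" "Dom K v"] uv K.dom_obj by metis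
  obtain e where e: "e \<in> Arr K" "Cod K e = Dom K p" "(u \<cdot>\<^bsub>K\<^esub> p) \<cdot>\<^bsub>K\<^esub> e = (v \<cdot>\<^bsub>K\<^esub> q) \<cdot>\<^bsub>K\<^esub> e"
    using cofiltering_equalize[OF K, of "u \<cdot>\<^bsub>K\<^esub> p" "v \<cdot>\<^bsub>K\<^esub> q"] pq uv by (auto simp: K.arr_simps)
  show ?thesis
    by (rule that[of "p \<cdot>\<^bsub>K\<^esub> e" "q \<cdot>\<^bsub>K\<^esub> e"]) (use pq e uv in \<open>simp_all add: K.arr_simps\<close>)
qed


section \<open>Representatives of maps of pro-objects\<close>

text \<open>Agreement after restriction to one common index: the usual description of equality in a
  filtered colimit of sets. It replaces the generated equivalence relation of
  \<open>colim_class\<close>; see \<open>mem_colim_class\<close>.\<close>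

definition colim_eq ::
  "('o, 'a, 'z) cat_scheme \<Rightarrow> ('i, 'o, 'a) pro_obj \<Rightarrow> 'i \<times> 'a \<Rightarrow> 'i \<times> 'a \<Rightarrow> bool" where
  "colim_eq C X a b \<longleftrightarrow> (\<exists>u \<in> Arr (Index X). \<exists>v \<in> Arr (Index X).
     Dom (Index X) u = Dom (Index X) v \<and> Cod (Index X) u = fst a \<and> Cod (Index X) v = fst b \<and>
     snd a \<cdot>\<^bsub>C\<^esub> ArMap (Diag X) u = snd b \<cdot>\<^bsub>C\<^esub> ArMap (Diag X) v)"

lemma pro_objsD:
  assumes "X \<in> pro_objs U C"
  shows "cofiltering U (Index X)" "is_functor (Index X) C (Diag X)" "category (Index X)"
  using assms by (auto simp: pro_objs_def cofiltering_category)

lemma mem_colim_elems: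
  "(t, g) \<in> colim_elems C X y \<longleftrightarrow>
     t \<in> Obj (Index X) \<and> g \<in> Arr C \<and> Dom C g = at_index X t \<and> Cod C g = y"
  by (auto simp: colim_elems_def mem_hom_set)

lemma colim_eq_sym: "colim_eq C X a b \<Longrightarrow> colim_eq C X b a"
  unfolding colim_eq_def by metis

section \<open>Colimits of hom-sets computed by common restrictions\<close>

context category
begin

context
  fixes U :: "'i set set" and X :: "('i, 'o, 'a) pro_obj"
  assumes X: "X \<in> pro_objs U C"
begin

interpretation I: category "Index X"
  using pro_objsD(3)[OF X] .

lemmas X_simps = functor_simps[OF pro_objsD(2)[OF X]]

lemma colim_eq_refl: "a \<in> colim_elems C X y \<Longrightarrow> colim_eq C X a a"
  by (cases a) (auto simp: colim_eq_def mem_colim_elems intro!: bexI[of _ "Ident (Index X) (fst a)"] I.arr_simps)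

lemma colim_eq_step:
  assumes "u \<in> Arr (Index X)" "Cod (Index X) u = t" "Dom (Index X) u = t'" "(t, g) \<in> colim_elems C X y"
  shows "colim_eq C X (t, g) (t', g \<cdot> ArMap (Diag X) u)"
  unfolding colim_eq_def fst_conv snd_conv
  by (rule bexI[of _ u], rule bexI[of _ "Ident (Index X) t'"])
    (use assms in \<open>auto simp: mem_colim_elems arr_simps I.arr_simps X_simps\<close>)

text \<open>Equivalent pairs agree somewhere, but later constructions need agreement below a span
  \<open>u\<close>, \<open>v\<close> fixed beforehand by other requirements.\<close>

lemma colim_eq_refine:
  assumes eq: "colim_eq C X (t, g) (t', g')"
    and el: "(t, g) \<in> colim_elems C X y" "(t', g') \<in> colim_elems C X y"
    and u: "u \<in> Arr (Index X)" "Cod (Index X) u = t"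
    and v: "v \<in> Arr (Index X)" "Cod (Index X) v = t'" "Dom (Index X) u = Dom (Index X) v"
  obtains w where "w \<in> Arr (Index X)" "Cod (Index X) w = Dom (Index X) u"
    "g \<cdot> ArMap (Diag X) (u \<cdot>\<^bsub>Index X\<^esub> w) = g' \<cdot> ArMap (Diag X) (v \<cdot>\<^bsub>Index X\<^esub> w)"
proof -
  let ?I = "Index X" and ?X = "ArMap (Diag X)"
  note [simp] = arr_simps I.arr_simps X_simps
  obtain u1 v1 where 1: "u1 \<in> Arr ?I" "v1 \<in> Arr ?I" "Dom ?I u1 = Dom ?I v1" "Cod ?I u1 = t"
    "Cod ?I v1 = t'" "g \<cdot> ?X u1 = g' \<cdot> ?X v1"
    using eq by (auto simp: colim_eq_def)
  obtain p q where 2: "p \<in> Arr ?I" "q \<in> Arr ?I" "Dom ?I p = Dom ?I q" "Cod ?I p = Dom ?I u1"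
    "Cod ?I q = Dom ?I u" "u1 \<cdot>\<^bsub>?I\<^esub> p = u \<cdot>\<^bsub>?I\<^esub> q"
    using cofiltering_square[OF pro_objsD(1)[OF X], of u1 u] 1 u by metis
  \<comment> \<open>The square aligns only the first legs \<open>u1\<close> and \<open>u\<close>;
    the second legs \<open>v1\<close> after \<open>p\<close> and \<open>v\<close> after
    \<open>q\<close> are merely parallel, and \<open>e\<close> makes them equal.\<close>
  obtain e where 3: "e \<in> Arr ?I" "Cod ?I e = Dom ?I p"
    "(v1 \<cdot>\<^bsub>?I\<^esub> p) \<cdot>\<^bsub>?I\<^esub> e = (v \<cdot>\<^bsub>?I\<^esub> q) \<cdot>\<^bsub>?I\<^esub> e"
    using cofiltering_equalize[OF pro_objsD(1)[OF X], of "v1 \<cdot>\<^bsub>?I\<^esub> p" "v \<cdot>\<^bsub>?I\<^esub> q"] 1 2 v by auto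
  have g: "g \<in> Arr C" "Dom C g = at_index X t" "g' \<in> Arr C" "Dom C g' = at_index X t'"
    using el by (auto simp: mem_colim_elems)
  have "g \<cdot> ?X (u \<cdot>\<^bsub>?I\<^esub> (q \<cdot>\<^bsub>?I\<^esub> e)) = g \<cdot> ?X ((u1 \<cdot>\<^bsub>?I\<^esub> p) \<cdot>\<^bsub>?I\<^esub> e)"
    using 1 2 3 u by simp
  also have "\<dots> = (g \<cdot> ?X u1) \<cdot> ?X (p \<cdot>\<^bsub>?I\<^esub> e)"
    using 1(1-5) 2(1-5) 3(1,2) u g by simp
  also have "\<dots> = g' \<cdot> ?X ((v1 \<cdot>\<^bsub>?I\<^esub> p) \<cdot>\<^bsub>?I\<^esub> e)"
    unfolding 1(6) using 1(1-5) 2 3(1,2) v g by simp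
  also have "\<dots> = g' \<cdot> ?X (v \<cdot>\<^bsub>?I\<^esub> (q \<cdot>\<^bsub>?I\<^esub> e))"
    unfolding 3(3) using 1(1-5) 2 3(1,2) v by simp
  finally show ?thesis
    using that[of "q \<cdot>\<^bsub>?I\<^esub> e"] 1 2 3 u v by simp
qed

text \<open>The two agreements use different arrows \<open>v\<close> and \<open>u'\<close> into the
  middle index; completing them to a commuting square gives one index where all three restrictions
  coincide.\<close>

lemma colim_eq_trans:
  assumes ab: "colim_eq C X a b" and bc: "colim_eq C X b c"
    and el: "a \<in> colim_elems C X y" "b \<in> colim_elems C X y" "c \<in> colim_elems C X y"
  shows "colim_eq C X a c"
proof -
  let ?I = "Index X" and ?X = "ArMap (Diag X)"
  note [simp] = arr_simps I.arr_simps X_simps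
  obtain t g t' g' where abc: "a = (t, g)" "c = (t', g')" by (cases a, cases c)
  obtain s h where b: "b = (s, h)" by (cases b)
  have g: "g \<in> Arr C" "Dom C g = at_index X t" "g' \<in> Arr C" "Dom C g' = at_index X t'"
    "h \<in> Arr C" "Dom C h = at_index X s"
    using el by (auto simp: mem_colim_elems abc b)
  obtain u v where 1: "u \<in> Arr ?I" "v \<in> Arr ?I" "Dom ?I u = Dom ?I v" "Cod ?I u = t"
    "Cod ?I v = s" "g \<cdot> ?X u = h \<cdot> ?X v"
    using ab by (auto simp: colim_eq_def abc b)
  obtain u' v' where 2: "u' \<in> Arr ?I" "v' \<in> Arr ?I" "Dom ?I u' = Dom ?I v'" "Cod ?I u' = s"
    "Cod ?I v' = t'" "h \<cdot> ?X u' = g' \<cdot> ?X v'"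
    using bc by (auto simp: colim_eq_def abc b)
  obtain p q where 3: "p \<in> Arr ?I" "q \<in> Arr ?I" "Dom ?I p = Dom ?I q" "Cod ?I p = Dom ?I v"
    "Cod ?I q = Dom ?I u'" "v \<cdot>\<^bsub>?I\<^esub> p = u' \<cdot>\<^bsub>?I\<^esub> q"
    using cofiltering_square[OF pro_objsD(1)[OF X], of v u'] 1 2 by metis
  have "(g \<cdot> ?X u) \<cdot> ?X p = h \<cdot> ?X (v \<cdot>\<^bsub>?I\<^esub> p)"
    unfolding 1(6) using 1(1-5) 3(1-5) g by simp
  also have "\<dots> = (h \<cdot> ?X u') \<cdot> ?X q"
    unfolding 3(6) using 2(1-5) 3(1-5) g by simp
  also have "\<dots> = g' \<cdot> ?X (v' \<cdot>\<^bsub>?I\<^esub> q)"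
    unfolding 2(6) using 2(1-5) 3(1-5) g by simp
  finally have "g \<cdot> ?X (u \<cdot>\<^bsub>?I\<^esub> p) = g' \<cdot> ?X (v' \<cdot>\<^bsub>?I\<^esub> q)"
    using 1(1-5) 3(1-5) g by simp
  then show ?thesis
    unfolding colim_eq_def abc fst_conv snd_conv
    by (intro bexI[of _ "u \<cdot>\<^bsub>?I\<^esub> p"] bexI[of _ "v' \<cdot>\<^bsub>?I\<^esub> q"]) (use 1 2 3 in simp_all)
qed

lemma colim_eq_comp:
  assumes eq: "colim_eq C X (t, g) (t', g')"
    and el: "(t, g) \<in> colim_elems C X y" "(t', g') \<in> colim_elems C X y"
    and h: "h \<in> Arr C" "Dom C h = y"
  shows "colim_eq C X (t, h \<cdot> g) (t', h \<cdot> g')"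
proof -
  obtain u v where uv: "u \<in> Arr (Index X)" "v \<in> Arr (Index X)"
    "Dom (Index X) u = Dom (Index X) v" "Cod (Index X) u = t" "Cod (Index X) v = t'"
    "g \<cdot> ArMap (Diag X) u = g' \<cdot> ArMap (Diag X) v"
    using eq by (auto simp: colim_eq_def)
  then show ?thesis
    unfolding colim_eq_def fst_conv snd_conv
    by (intro bexI[of _ u] bexI[of _ v])
      (use el h in \<open>auto simp: mem_colim_elems arr_simps X_simps\<close>)
qed

text \<open>Zigzags are absorbed by \<open>colim_eq_trans\<close>; conversely a common restriction
  is itself a zigzag of two steps.\<close>

lemma mem_colim_class:
  assumes a: "a \<in> colim_elems C X y"
  shows "b \<in> colim_class C X y a \<longleftrightarrow> b \<in> colim_elems C X y \<and> colim_eq C X a b"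
proof
  note [simp] = arr_simps I.arr_simps X_simps
  assume "b \<in> colim_class C X y a"
  then have "equivclp (colim_step C X y) a b"
    by (simp add: colim_class_def)
  then show "b \<in> colim_elems C X y \<and> colim_eq C X a b"
  proof (induction rule: equivclp_induct)
    case base
    then show ?case using a colim_eq_refl by auto
  next
    case (step b c)
    have "c \<in> colim_elems C X y \<and> colim_eq C X b c"
    proof (cases "colim_step C X y b c")
      case True
      then show ?thesis
        by (auto simp: colim_step_def mem_colim_elems mem_hom_set intro!: colim_eq_step[where y = y])
    next
      case False
      then have "colim_step C X y c b" using step by auto
      then show ?thesis
        by (auto simp: colim_step_def mem_colim_elems mem_hom_set
            intro!: colim_eq_sym[OF colim_eq_step[where y = y]])
    qed
    then show ?case
      using step.IH colim_eq_trans[OF _ _ a] by blast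
  qed
next
  assume b: "b \<in> colim_elems C X y \<and> colim_eq C X a b"
  obtain t g t' g' where ab: "a = (t, g)" "b = (t', g')" by (cases a, cases b)
  obtain u v where uv: "u \<in> Arr (Index X)" "v \<in> Arr (Index X)"
    "Dom (Index X) u = Dom (Index X) v" "Cod (Index X) u = t" "Cod (Index X) v = t'"
    "g \<cdot> ArMap (Diag X) u = g' \<cdot> ArMap (Diag X) v"
    using b by (auto simp: colim_eq_def ab)
  have "colim_step C X y a (Dom (Index X) u, g \<cdot> ArMap (Diag X) u)"
    "colim_step C X y b (Dom (Index X) u, g \<cdot> ArMap (Diag X) u)"
    using a b uv by (auto simp: colim_step_def ab mem_colim_elems mem_hom_set)
  then have "equivclp (colim_step C X y) a b"
    by (meson converse_r_into_equivclp r_into_equivclp equivclp_trans)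
  then show "b \<in> colim_class C X y a"
    by (simp add: colim_class_def)
qed

lemma colim_class_eq:
  assumes "a \<in> colim_elems C X y" "b \<in> colim_class C X y a"
  shows "colim_class C X y b = colim_class C X y a"
  using assms(2) unfolding colim_class_def
  by (auto intro: equivclp_trans equivclp_sym)

end

end

lemma mem_pro_hom:
  "F \<in> hom_set (pro_cat U C) X Y \<longleftrightarrow>
     X \<in> pro_objs U C \<and> Y \<in> pro_objs U C \<and> Src F = X \<and> Tgt F = Y \<and> Family F \<in> pro_hom C X Y"
  by (auto simp: hom_set_def pro_cat_def)

definition pro_map ::
  "('o, 'a, 'z) cat_scheme \<Rightarrow> ('i, 'o, 'a) pro_obj \<Rightarrow> ('i, 'o, 'a) pro_obj
     \<Rightarrow> ('i \<Rightarrow> 'i \<times> 'a) \<Rightarrow> ('i, 'o, 'a) pro_arr" where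
  "pro_map C X Y \<rho> = \<lparr>Src = X, Tgt = Y,
     Family = (\<lambda>s \<in> Obj (Index Y). colim_class C X (at_index Y s) (\<rho> s))\<rparr>"

lemma level_map_eq_pro_map:
  "level_map C K F G \<tau> = pro_map C \<lparr>Index = K, Diag = F\<rparr> \<lparr>Index = K, Diag = G\<rparr> (\<lambda>s. (s, \<tau> s))"
  by (simp add: level_map_def pro_map_def Let_def)

lemma pro_ident_eq_pro_map: "pro_ident C X = pro_map C X X (\<lambda>s. (s, Ident C (at_index X s)))"
  by (simp add: pro_ident_def pro_map_def)

context category
begin

context
  fixes U :: "'i set set" and X Y :: "('i, 'o, 'a) pro_obj" and F
  assumes F: "F \<in> hom_set (pro_cat U C) X Y"
begin

lemma pro_hom_objs: "X \<in> pro_objs U C" "Y \<in> pro_objs U C" "Src F = X" "Tgt F = Y"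
  using F by (auto simp: mem_pro_hom)

text \<open>Each component is a whole equivalence class, so any member determines it. This licenses
  working with arbitrary representatives from here on.\<close>

lemma family_class:
  assumes "s \<in> Obj (Index Y)" "a \<in> Family F s"
  shows "a \<in> colim_elems C X (at_index Y s)" "Family F s = colim_class C X (at_index Y s) a"
proof -
  have "Family F s \<in> colim_hom C X (at_index Y s)"
    using F assms(1) by (auto simp: mem_pro_hom pro_hom_def)
  then obtain b where b: "b \<in> colim_elems C X (at_index Y s)"
    "Family F s = colim_class C X (at_index Y s) b"
    by (auto simp: colim_hom_def)
  with assms(2) show "a \<in> colim_elems C X (at_index Y s)"
    "Family F s = colim_class C X (at_index Y s) a"
    using mem_colim_class[OF pro_hom_objs(1) b(1)] colim_class_eq[OF pro_hom_objs(1) b(1)] by auto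
qed

lemma family_ex:
  assumes "s \<in> Obj (Index Y)"
  obtains t g where "(t, g) \<in> Family F s" "(t, g) \<in> colim_elems C X (at_index Y s)"
proof -
  have "Family F s \<in> colim_hom C X (at_index Y s)"
    using F assms(1) by (auto simp: mem_pro_hom pro_hom_def)
  then obtain b where b: "b \<in> colim_elems C X (at_index Y s)"
    "Family F s = colim_class C X (at_index Y s) b"
    by (auto simp: colim_hom_def)
  then have "b \<in> Family F s"
    by (simp add: mem_colim_class[OF pro_hom_objs(1) b(1)] colim_eq_refl[OF pro_hom_objs(1) b(1)])
  then show ?thesis
    using that[of "fst b" "snd b"] b(1) by simp
qed

lemma family_eq:
  assumes "s \<in> Obj (Index Y)" "a \<in> Family F s" "b \<in> Family F s"
  shows "colim_eq C X a b"
  using family_class[OF assms(1,2)] mem_colim_class[OF pro_hom_objs(1)] assms(3) by blast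

lemma family_mem:
  assumes "s \<in> Obj (Index Y)" "a \<in> Family F s" "b \<in> colim_elems C X (at_index Y s)" "colim_eq C X a b"
  shows "b \<in> Family F s"
  using family_class[OF assms(1,2)] mem_colim_class[OF pro_hom_objs(1)] assms(3,4) by blast

lemma family_compat:
  assumes "v \<in> Arr (Index Y)" "(t, g) \<in> Family F (Dom (Index Y) v)"
  shows "(t, ArMap (Diag Y) v \<cdot> g) \<in> Family F (Cod (Index Y) v)"
proof -
  interpret J: category "Index Y" using pro_objsD(3)[OF pro_hom_objs(2)] .
  have el: "(t, g) \<in> colim_elems C X (at_index Y (Dom (Index Y) v))"
    using family_class assms J.dom_obj by blast
  have *: "Family F (Cod (Index Y) v)
      = colim_class C X (at_index Y (Cod (Index Y) v)) (t, ArMap (Diag Y) v \<cdot> g)"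
    using F assms unfolding mem_pro_hom pro_hom_def by blast
  have el': "(t, ArMap (Diag Y) v \<cdot> g) \<in> colim_elems C X (at_index Y (Cod (Index Y) v))"
    using el assms(1) functor_simps[OF pro_objsD(2)[OF pro_hom_objs(2)]]
    by (auto simp: mem_colim_elems arr_simps)
  show ?thesis
    unfolding * mem_colim_class[OF pro_hom_objs(1) el']
    using el' colim_eq_refl[OF pro_hom_objs(1) el'] by blast
qed

end

text \<open>Two classes with a common member coincide, and outside the index set both families take
  the default value of extensional functions. Equality of maps thus reduces to one shared
  representative per index.\<close>

lemma pro_arr_eqI:
  assumes F: "F \<in> hom_set (pro_cat U C) X Y" and G: "G \<in> hom_set (pro_cat U C) X Y"
    and eq: "\<And>s. s \<in> Obj (Index Y) \<Longrightarrow> \<exists>a. a \<in> Family F s \<and> a \<in> Family G s"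
  shows "F = G"
proof -
  have "Family F s = Family G s" for s
  proof (cases "s \<in> Obj (Index Y)")
    case True
    then obtain a where "a \<in> Family F s" "a \<in> Family G s" using eq by blast
    then show ?thesis using family_class(2)[OF F True] family_class(2)[OF G True] by metis
  next
    case False
    moreover have "Family F \<in> extensional (Obj (Index Y))" "Family G \<in> extensional (Obj (Index Y))"
      using F G by (auto simp: mem_pro_hom pro_hom_def PiE_def)
    ultimately show ?thesis by (metis extensional_arb)
  qed
  then have "Family F = Family G" by blast
  then show ?thesis
    using F G by (cases F; cases G) (simp add: mem_pro_hom)
qed

lemma pro_map_mem:
  assumes "X \<in> pro_objs U C" "s \<in> Obj (Index Y)" "\<rho> s \<in> colim_elems C X (at_index Y s)"
  shows "\<rho> s \<in> Family (pro_map C X Y \<rho>) s"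
  using assms by (simp add: pro_map_def mem_colim_class colim_eq_refl)

text \<open>Compatibility is demanded of the chosen representatives only;
  \<open>colim_eq_comp\<close> and transitivity carry it to all other members of the
  classes.\<close>

lemma pro_map_hom:
  assumes X: "X \<in> pro_objs U C" and Y: "Y \<in> pro_objs U C"
    and el: "\<And>s. s \<in> Obj (Index Y) \<Longrightarrow> \<rho> s \<in> colim_elems C X (at_index Y s)"
    and eq: "\<And>v. v \<in> Arr (Index Y) \<Longrightarrow> colim_eq C X (fst (\<rho> (Dom (Index Y) v)),
        ArMap (Diag Y) v \<cdot> snd (\<rho> (Dom (Index Y) v))) (\<rho> (Cod (Index Y) v))"
  shows "pro_map C X Y \<rho> \<in> hom_set (pro_cat U C) X Y"
proof -
  interpret J: category "Index Y" using pro_objsD(3)[OF Y] .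
  note Y_simps = functor_simps[OF pro_objsD(2)[OF Y]]
  have "Family (pro_map C X Y \<rho>) (Cod (Index Y) v)
      = colim_class C X (at_index Y (Cod (Index Y) v)) (t, ArMap (Diag Y) v \<cdot> g)"
    if v: "v \<in> Arr (Index Y)" and tg: "(t, g) \<in> Family (pro_map C X Y \<rho>) (Dom (Index Y) v)" for v t g
  proof -
    obtain t0 g0 where 0: "\<rho> (Dom (Index Y) v) = (t0, g0)" by fastforce
    have el0: "(t0, g0) \<in> colim_elems C X (at_index Y (Dom (Index Y) v))"
      using el J.dom_obj[OF v] 0 by metis
    then have "(t, g) \<in> colim_elems C X (at_index Y (Dom (Index Y) v))" "colim_eq C X (t0, g0) (t, g)"
      using tg v by (auto simp: pro_map_def 0 J.dom_obj mem_colim_class[OF X])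
    note 1 = this
    have 2: "(t0, ArMap (Diag Y) v \<cdot> g0) \<in> colim_elems C X (at_index Y (Cod (Index Y) v))"
      "(t, ArMap (Diag Y) v \<cdot> g) \<in> colim_elems C X (at_index Y (Cod (Index Y) v))"
      using 1 el0 v by (auto simp: mem_colim_elems arr_simps Y_simps)
    have 3: "colim_eq C X (t0, ArMap (Diag Y) v \<cdot> g0) (t, ArMap (Diag Y) v \<cdot> g)"
      using colim_eq_comp[OF X 1(2) el0 1(1)] v by (simp add: Y_simps)
    have 4: "\<rho> (Cod (Index Y) v) \<in> colim_elems C X (at_index Y (Cod (Index Y) v))"
      using el J.cod_obj[OF v] by blast
    have "colim_eq C X (\<rho> (Cod (Index Y) v)) (t, ArMap (Diag Y) v \<cdot> g)"
      using colim_eq_trans[OF X colim_eq_sym 3 4 2] eq[OF v] 0 by simp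
    then have "(t, ArMap (Diag Y) v \<cdot> g)
        \<in> colim_class C X (at_index Y (Cod (Index Y) v)) (\<rho> (Cod (Index Y) v))"
      using mem_colim_class[OF X 4] 2 by blast
    from colim_class_eq[OF X 4 this] show ?thesis
      using v by (simp add: pro_map_def J.cod_obj)
  qed
  moreover have "Family (pro_map C X Y \<rho>) \<in> (\<Pi>\<^sub>E s \<in> Obj (Index Y). colim_hom C X (at_index Y s))"
    using el by (auto simp: pro_map_def colim_hom_def)
  ultimately have "Family (pro_map C X Y \<rho>) \<in> pro_hom C X Y"
    unfolding pro_hom_def by blast
  then show ?thesis
    using X Y by (simp add: mem_pro_hom) (simp add: pro_map_def)
qed

section \<open>Composition computed on representatives\<close>

context
  fixes U :: "'i set set" and X Y Z :: "('i, 'o, 'a) pro_obj" and F G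
  assumes F: "F \<in> hom_set (pro_cat U C) X Y" and G: "G \<in> hom_set (pro_cat U C) Y Z"
begin

interpretation J: category "Index Y"
  using pro_objsD(3)[OF pro_hom_objs(2)[OF F]] .

lemma pro_comp_elem:
  assumes "r \<in> Obj (Index Z)" "(s, h) \<in> Family G r" "(t, g) \<in> Family F s"
  shows "(t, h \<cdot> g) \<in> colim_elems C X (at_index Z r)"
proof -
  have "(s, h) \<in> colim_elems C Y (at_index Z r)"
    using family_class(1)[OF G] assms by blast
  moreover from this have "(t, g) \<in> colim_elems C X (at_index Y s)"
    using family_class(1)[OF F] assms by (auto simp: mem_colim_elems)
  ultimately show ?thesis
    by (auto simp: mem_colim_elems arr_simps)
qed

text \<open>The two representatives of \<open>G\<close> at \<open>r\<close> agree after restriction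
  to one index of \<open>Y\<close>. A representative of \<open>F\<close> at that index, pushed along
  both arrows, mediates between \<open>g\<close> and \<open>g'\<close>.\<close>

lemma pro_comp_eq:
  assumes r: "r \<in> Obj (Index Z)" and sh: "(s, h) \<in> Family G r" "(s', h') \<in> Family G r"
    and tg: "(t, g) \<in> Family F s" "(t', g') \<in> Family F s'"
  shows "colim_eq C X (t, h \<cdot> g) (t', h' \<cdot> g')"
proof -
  note X = pro_hom_objs(1)[OF F] and Y = pro_hom_objs(2)[OF F]
  note Y_simps = functor_simps[OF pro_objsD(2)[OF Y]]
  have el: "(s, h) \<in> colim_elems C Y (at_index Z r)" "(s', h') \<in> colim_elems C Y (at_index Z r)"
    using family_class(1)[OF G] assms by blast+
  then have s: "s \<in> Obj (Index Y)" "s' \<in> Obj (Index Y)"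
    by (auto simp: mem_colim_elems)
  obtain u v where uv: "u \<in> Arr (Index Y)" "v \<in> Arr (Index Y)"
    "Dom (Index Y) u = Dom (Index Y) v" "Cod (Index Y) u = s" "Cod (Index Y) v = s'"
    "h \<cdot> ArMap (Diag Y) u = h' \<cdot> ArMap (Diag Y) v"
    using family_eq[OF G r sh] by (auto simp: colim_eq_def)
  obtain t2 g2 where 2: "(t2, g2) \<in> Family F (Dom (Index Y) u)"
    "(t2, g2) \<in> colim_elems C X (at_index Y (Dom (Index Y) u))"
    using family_ex[OF F J.dom_obj[OF uv(1)]] by blast
  have u2: "(t2, ArMap (Diag Y) u \<cdot> g2) \<in> Family F s" "(t2, ArMap (Diag Y) v \<cdot> g2) \<in> Family F s'"
    using family_compat[OF F uv(1) 2(1)] family_compat[OF F uv(2)] 2(1) uv by auto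
  have "colim_eq C X (t, h \<cdot> g) (t2, h \<cdot> (ArMap (Diag Y) u \<cdot> g2))"
    using colim_eq_comp[OF X family_eq[OF F s(1) tg(1) u2(1)] family_class(1)[OF F s(1) tg(1)]
        family_class(1)[OF F s(1) u2(1)]] el by (auto simp: mem_colim_elems)
  moreover have "colim_eq C X (t2, h' \<cdot> (ArMap (Diag Y) v \<cdot> g2)) (t', h' \<cdot> g')"
    using colim_eq_comp[OF X family_eq[OF F s(2) u2(2) tg(2)] family_class(1)[OF F s(2) u2(2)]
        family_class(1)[OF F s(2) tg(2)]] el by (auto simp: mem_colim_elems)
  moreover have "h \<cdot> (ArMap (Diag Y) u \<cdot> g2) = (h \<cdot> ArMap (Diag Y) u) \<cdot> g2"
    "h' \<cdot> (ArMap (Diag Y) v \<cdot> g2) = (h' \<cdot> ArMap (Diag Y) v) \<cdot> g2"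
    using el uv(1-5) 2(2) by (auto simp: mem_colim_elems arr_simps Y_simps)
  ultimately show ?thesis
    using colim_eq_trans[OF X _ _ pro_comp_elem[OF r sh(1) tg(1)] pro_comp_elem[OF r sh(1) u2(1)]
        pro_comp_elem[OF r sh(2) tg(2)]] uv(6) by metis
qed

lemma pro_comp_class:
  assumes r: "r \<in> Obj (Index Z)" and sh: "(s, h) \<in> Family G r" and tg: "(t, g) \<in> Family F s"
  shows "Family (pro_comp C G F) r = colim_class C X (at_index Z r) (t, h \<cdot> g)"
proof -
  note X = pro_hom_objs(1)[OF F]
  have const: "colim_class C X (at_index Z r) (t', h' \<cdot> g') = colim_class C X (at_index Z r) (t, h \<cdot> g)"
    if "(s', h') \<in> Family G r" "(t', g') \<in> Family F s'" for s' h' t' g'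
    using colim_class_eq[OF X pro_comp_elem[OF r sh tg]] mem_colim_class[OF X pro_comp_elem[OF r sh tg]]
      pro_comp_elem[OF r that] pro_comp_eq[OF r sh that(1) tg that(2)] by blast
  have fam: "Family (pro_comp C G F) r =
      (\<Union>(s, h) \<in> Family G r. \<Union>(t, g) \<in> Family F s. colim_class C X (at_index Z r) (t, h \<cdot> g))"
    using r by (simp add: pro_comp_def pro_hom_objs(3)[OF F] pro_hom_objs(4)[OF G])
  show ?thesis
  proof (intro equalityI subsetI)
    fix x assume "x \<in> Family (pro_comp C G F) r"
    then obtain s' h' t' g' where "(s', h') \<in> Family G r" "(t', g') \<in> Family F s'"
      "x \<in> colim_class C X (at_index Z r) (t', h' \<cdot> g')"
      unfolding fam by (elim UN_E) (simp add: case_prod_beta, metis UN_E prod.collapse)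
    with const show "x \<in> colim_class C X (at_index Z r) (t, h \<cdot> g)" by blast
  next
    fix x assume "x \<in> colim_class C X (at_index Z r) (t, h \<cdot> g)"
    with sh tg show "x \<in> Family (pro_comp C G F) r" unfolding fam by blast
  qed
qed

lemma pro_comp_mem:
  assumes r: "r \<in> Obj (Index Z)" and sh: "(s, h) \<in> Family G r" and tg: "(t, g) \<in> Family F s"
  shows "(t, h \<cdot> g) \<in> Family (pro_comp C G F) r"
  unfolding pro_comp_class[OF assms]
  using mem_colim_class[OF pro_hom_objs(1)[OF F]] pro_comp_elem[OF assms]
    colim_eq_refl[OF pro_hom_objs(1)[OF F]] by blast

lemma pro_comp_rep:
  assumes r: "r \<in> Obj (Index Z)"
  obtains s h t g where "(s, h) \<in> Family G r" "s \<in> Obj (Index Y)" "(t, g) \<in> Family F s"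
    "(t, h \<cdot> g) \<in> Family (pro_comp C G F) r"
proof -
  obtain s h where 1: "(s, h) \<in> Family G r" "(s, h) \<in> colim_elems C Y (at_index Z r)"
    using family_ex[OF G r] .
  then have s: "s \<in> Obj (Index Y)" by (simp add: mem_colim_elems)
  obtain t g where "(t, g) \<in> Family F s" using family_ex[OF F s] .
  then show ?thesis using that 1 s pro_comp_mem[OF r] by blast
qed

lemma pro_comp_hom: "pro_comp C G F \<in> hom_set (pro_cat U C) X Z"
proof -
  note X = pro_hom_objs(1)[OF F] and Z = pro_hom_objs(2)[OF G]
  interpret K: category "Index Z" using pro_objsD(3)[OF Z] .
  note Z_simps = functor_simps[OF pro_objsD(2)[OF Z]]
  have "\<forall>r\<in>Obj (Index Z). \<exists>s h t g. (s, h) \<in> Family G r \<and> (t, g) \<in> Family F s"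
    using pro_comp_rep by metis
  then obtain s h t g where rep: "\<And>r. r \<in> Obj (Index Z) \<Longrightarrow> (s r, h r) \<in> Family G r"
    "\<And>r. r \<in> Obj (Index Z) \<Longrightarrow> (t r, g r) \<in> Family F (s r)"
    by metis
  let ?\<rho> = "\<lambda>r. (t r, h r \<cdot> g r)"
  \<comment> \<open>The composite is recognized as the \<open>pro_map\<close> of chosen composites,
    so that its compatibility follows from \<open>pro_map_hom\<close>.\<close>
  have "pro_map C X Z ?\<rho> \<in> hom_set (pro_cat U C) X Z"
  proof (rule pro_map_hom[OF X Z])
    show "?\<rho> r \<in> colim_elems C X (at_index Z r)" if "r \<in> Obj (Index Z)" for r
      using pro_comp_elem[OF that rep[OF that]] .
  next
    fix v assume v: "v \<in> Arr (Index Z)"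
    note d = K.dom_obj[OF v] and c = K.cod_obj[OF v]
    have el: "(s (Dom (Index Z) v), h (Dom (Index Z) v)) \<in> colim_elems C Y (at_index Z (Dom (Index Z) v))"
      using family_class(1)[OF G d rep(1)[OF d]] .
    then have "(t (Dom (Index Z) v), g (Dom (Index Z) v)) \<in> colim_elems C X (at_index Y (s (Dom (Index Z) v)))"
      using family_class(1)[OF F _ rep(2)[OF d]] by (simp add: mem_colim_elems)
    then show "colim_eq C X (fst (?\<rho> (Dom (Index Z) v)), ArMap (Diag Z) v \<cdot> snd (?\<rho> (Dom (Index Z) v)))
       (?\<rho> (Cod (Index Z) v))"
      using pro_comp_eq[OF c family_compat[OF G v rep(1)[OF d]] rep(1)[OF c] rep(2)[OF d] rep(2)[OF c]]
        el v by (auto simp: mem_colim_elems arr_simps Z_simps)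
  qed
  moreover have "Family (pro_comp C G F) = Family (pro_map C X Z ?\<rho>)"
  proof (rule extensionalityI)
    show "Family (pro_comp C G F) \<in> extensional (Obj (Index Z))"
      "Family (pro_map C X Z ?\<rho>) \<in> extensional (Obj (Index Z))"
      by (auto simp: pro_comp_def pro_map_def pro_hom_objs[OF G])
    show "Family (pro_comp C G F) r = Family (pro_map C X Z ?\<rho>) r" if "r \<in> Obj (Index Z)" for r
      using pro_comp_class[OF that rep[OF that]] that by (simp add: pro_map_def)
  qed
  ultimately show ?thesis
    by (simp add: mem_pro_hom pro_comp_def pro_map_def pro_hom_objs[OF F] pro_hom_objs[OF G])
qed

end

section \<open>Identities and the category axioms\<close>

lemma pro_ident_hom:
  assumes X: "X \<in> pro_objs U C"
  shows "pro_ident C X \<in> hom_set (pro_cat U C) X X"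
proof -
  interpret I: category "Index X" using pro_objsD(3)[OF X] .
  note X_simps = functor_simps[OF pro_objsD(2)[OF X]]
  show ?thesis
    unfolding pro_ident_eq_pro_map
  proof (rule pro_map_hom[OF X X])
    show "(s, Ident C (at_index X s)) \<in> colim_elems C X (at_index X s)" if "s \<in> Obj (Index X)" for s
      using that by (simp add: mem_colim_elems arr_simps X_simps)
  next
    fix v assume v: "v \<in> Arr (Index X)"
    then have "(Cod (Index X) v, Ident C (at_index X (Cod (Index X) v)))
        \<in> colim_elems C X (at_index X (Cod (Index X) v))"
      by (simp add: mem_colim_elems arr_simps X_simps I.arr_simps)
    from colim_eq_step[OF X v refl refl this]
    show "colim_eq C X (fst (Dom (Index X) v, Ident C (at_index X (Dom (Index X) v))),
        ArMap (Diag X) v \<cdot> snd (Dom (Index X) v, Ident C (at_index X (Dom (Index X) v))))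
       (Cod (Index X) v, Ident C (at_index X (Cod (Index X) v)))"
      using v colim_eq_sym by (fastforce simp: arr_simps X_simps)
  qed
qed

lemma pro_ident_mem:
  assumes "X \<in> pro_objs U C" "s \<in> Obj (Index X)"
  shows "(s, Ident C (at_index X s)) \<in> Family (pro_ident C X) s"
  unfolding pro_ident_eq_pro_map using assms functor_obj[OF pro_objsD(2)[OF assms(1)]]
  by (intro pro_map_mem) (auto simp: mem_colim_elems arr_simps)

lemma pro_cat_simps:
  "Obj (pro_cat U C) = pro_objs U C" "Dom (pro_cat U C) = Src" "Cod (pro_cat U C) = Tgt"
  "Ident (pro_cat U C) = pro_ident C" "Comp (pro_cat U C) = pro_comp C"
  by (simp_all add: pro_cat_def)

lemma pro_cat_category: "category (pro_cat U C)"
proof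
  show "Dom (pro_cat U C) F \<in> Obj (pro_cat U C)" "Cod (pro_cat U C) F \<in> Obj (pro_cat U C)"
    if "F \<in> Arr (pro_cat U C)" for F
    using that by (auto simp: pro_cat_def)
  show "Ident (pro_cat U C) X \<in> hom_set (pro_cat U C) X X" if "X \<in> Obj (pro_cat U C)" for X
    using that pro_ident_hom by (simp add: pro_cat_simps)
  show "G \<cdot>\<^bsub>pro_cat U C\<^esub> F \<in> hom_set (pro_cat U C) X Z"
    if "F \<in> hom_set (pro_cat U C) X Y" "G \<in> hom_set (pro_cat U C) Y Z" for F G X Y Z
    using pro_comp_hom[OF that] by (simp add: pro_cat_simps)
next
  fix F G H W X Y Z
  assume F: "F \<in> hom_set (pro_cat U C) W X" and G: "G \<in> hom_set (pro_cat U C) X Y"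
    and H: "H \<in> hom_set (pro_cat U C) Y Z"
  note GF = pro_comp_hom[OF F G] and HG = pro_comp_hom[OF G H]
  show "H \<cdot>\<^bsub>pro_cat U C\<^esub> (G \<cdot>\<^bsub>pro_cat U C\<^esub> F) = H \<cdot>\<^bsub>pro_cat U C\<^esub> G \<cdot>\<^bsub>pro_cat U C\<^esub> F"
    unfolding pro_cat_simps
  proof (rule pro_arr_eqI[OF pro_comp_hom[OF GF H] pro_comp_hom[OF F HG]])
    fix r assume r: "r \<in> Obj (Index Z)"
    obtain q k s h where 1: "(q, k) \<in> Family H r" "q \<in> Obj (Index Y)" "(s, h) \<in> Family G q"
      "(s, k \<cdot> h) \<in> Family (pro_comp C H G) r"
      using pro_comp_rep[OF G H r] .
    have s: "(s, h) \<in> colim_elems C X (at_index Y q)" "(q, k) \<in> colim_elems C Y (at_index Z r)"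
      using family_class(1)[OF G 1(2,3)] family_class(1)[OF H r 1(1)] .
    then have "s \<in> Obj (Index X)" by (simp add: mem_colim_elems)
    with family_ex[OF F] obtain t g where t: "(t, g) \<in> Family F s"
      "(t, g) \<in> colim_elems C W (at_index X s)" by blast
    have "(t, k \<cdot> (h \<cdot> g)) \<in> Family (pro_comp C H (pro_comp C G F)) r"
      using pro_comp_mem[OF GF H r 1(1)] pro_comp_mem[OF F G 1(2,3) t(1)] .
    moreover have "(t, (k \<cdot> h) \<cdot> g) \<in> Family (pro_comp C (pro_comp C H G) F) r"
      using pro_comp_mem[OF F HG r 1(4) t(1)] .
    moreover have "(k \<cdot> h) \<cdot> g = k \<cdot> (h \<cdot> g)"
      using s t by (auto simp: mem_colim_elems arr_simps)
    ultimately show "\<exists>a. a \<in> Family (pro_comp C H (pro_comp C G F)) r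
        \<and> a \<in> Family (pro_comp C (pro_comp C H G) F) r"
      by metis
  qed
next
  fix F X Y assume F: "F \<in> hom_set (pro_cat U C) X Y"
  note X = pro_hom_objs(1)[OF F] and Y = pro_hom_objs(2)[OF F]
  show "F \<cdot>\<^bsub>pro_cat U C\<^esub> Ident (pro_cat U C) X = F"
    unfolding pro_cat_simps
  proof (rule pro_arr_eqI[OF pro_comp_hom[OF pro_ident_hom[OF X] F] F])
    fix s assume s: "s \<in> Obj (Index Y)"
    obtain t g where t: "(t, g) \<in> Family F s" "(t, g) \<in> colim_elems C X (at_index Y s)"
      using family_ex[OF F s] .
    then have "(t, g \<cdot> Ident C (at_index X t)) \<in> Family (pro_comp C F (pro_ident C X)) s"
      using pro_comp_mem[OF pro_ident_hom[OF X] F s t(1)] pro_ident_mem[OF X]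
      by (auto simp: mem_colim_elems)
    then show "\<exists>a. a \<in> Family (pro_comp C F (pro_ident C X)) s \<and> a \<in> Family F s"
      using t by (auto simp: mem_colim_elems arr_simps)
  qed
  show "Ident (pro_cat U C) Y \<cdot>\<^bsub>pro_cat U C\<^esub> F = F"
    unfolding pro_cat_simps
  proof (rule pro_arr_eqI[OF pro_comp_hom[OF F pro_ident_hom[OF Y]] F])
    fix s assume s: "s \<in> Obj (Index Y)"
    obtain t g where t: "(t, g) \<in> Family F s" "(t, g) \<in> colim_elems C X (at_index Y s)"
      using family_ex[OF F s] .
    have "(t, Ident C (at_index Y s) \<cdot> g) \<in> Family (pro_comp C (pro_ident C Y) F) s"
      using pro_comp_mem[OF F pro_ident_hom[OF Y] s pro_ident_mem[OF Y s] t(1)] .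
    then show "\<exists>a. a \<in> Family (pro_comp C (pro_ident C Y) F) s \<and> a \<in> Family F s"
      using t by (auto simp: mem_colim_elems arr_simps)
  qed
qed

end

section \<open>Maps to constant pro-objects\<close>

lemma smallness_finite:
  assumes U: "smallness U" and A: "finite A"
  shows "A \<in> U"
proof -
  obtain B where "B \<in> U" "infinite B" using U by (auto simp: smallness_def)
  moreover have "A \<lesssim> B"
    using A \<open>infinite B\<close> by (meson finite_lepoll_infinite)
  ultimately show ?thesis using U unfolding smallness_def by blast
qed

lemma one_cat_cofiltering: "smallness U \<Longrightarrow> cofiltering U one_cat"
  by (auto simp: cofiltering_def small_category_def smallness_finite category_def one_cat_def
      mem_hom_set)

context category
begin

lemma pro_comp_assoc:
  assumes "F \<in> hom_set (pro_cat U C) W X" "G \<in> hom_set (pro_cat U C) X Y"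
    "H \<in> hom_set (pro_cat U C) Y Z"
  shows "pro_comp C (pro_comp C H G) F = pro_comp C H (pro_comp C G F)"
  using category.comp_assoc[OF pro_cat_category assms] by (simp add: pro_cat_simps)

lemma pro_comp_ident:
  assumes "F \<in> hom_set (pro_cat U C) X Y"
  shows "pro_comp C F (pro_ident C X) = F" "pro_comp C (pro_ident C Y) F = F"
  using category.comp_ident_right[OF pro_cat_category assms]
    category.comp_ident_left[OF pro_cat_category assms] by (simp_all add: pro_cat_simps)

abbreviation const_obj :: "'o \<Rightarrow> ('i, 'o, 'a) pro_obj" where
  "const_obj \<equiv> ObMap (const_functor C)"

abbreviation const_map :: "'a \<Rightarrow> ('i, 'o, 'a) pro_arr" where
  "const_map \<equiv> ArMap (const_functor C)"

lemma const_obj_simps: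
  "Index (const_obj x) = one_cat" "Diag (const_obj x) = const_diag C x"
  "ObMap (const_diag C x) s = x" "Obj one_cat = {undefined}"
  by (simp_all add: const_functor_def const_diag_def one_cat_def)

lemma const_obj: "smallness U \<Longrightarrow> x \<in> Obj C \<Longrightarrow> const_obj x \<in> pro_objs U C"
  using one_cat_cofiltering[of U]
  by (auto simp: const_functor_def pro_objs_def is_functor_def const_diag_def ident_hom arr_simps)

text \<open>A map to a constant object has one component, at the index \<open>undefined\<close>, and
  so amounts to a single class of pairs; \<open>a\<close> is a representative of it.\<close>

definition to_const :: "('i, 'o, 'a) pro_obj \<Rightarrow> 'o \<Rightarrow> 'i \<times> 'a \<Rightarrow> ('i, 'o, 'a) pro_arr" where
  "to_const X y a = pro_map C X (const_obj y) (\<lambda>_. a)"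

lemma to_const_hom:
  fixes X :: "('i, 'o, 'a) pro_obj"
  assumes U: "smallness U" and X: "X \<in> pro_objs U C" and a: "a \<in> colim_elems C X y"
  shows "to_const X y a \<in> hom_set (pro_cat U C) X (const_obj y)"
    "a \<in> Family (to_const X y a) undefined"
proof -
  obtain t g where tg: "a = (t, g)" by (cases a)
  then have y: "y \<in> Obj C" using a by (auto simp: mem_colim_elems arr_simps)
  show "to_const X y a \<in> hom_set (pro_cat U C) X (const_obj y)"
    unfolding to_const_def
  proof (rule pro_map_hom[OF X const_obj[OF U y]])
    show "a \<in> colim_elems C X (at_index (const_obj y) s)" for s :: 'i
      using a by (simp add: const_obj_simps)
    show "colim_eq C X (fst a, ArMap (Diag (const_obj y)) v \<cdot> snd a) a" for v :: 'i
      using colim_eq_refl[OF X a] a by (auto simp: const_obj_simps const_diag_def tg mem_colim_elems arr_simps)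
  qed
  show "a \<in> Family (to_const X y a) undefined"
    unfolding to_const_def using a X
    by (intro pro_map_mem[where \<rho> = "\<lambda>_. a"]) (auto simp: const_obj_simps)
qed

lemma const_map_eq_to_const: "const_map f = to_const (const_obj (Dom C f)) (Cod C f) (undefined, f)"
  by (auto simp: to_const_def const_functor_def level_map_eq_pro_map pro_map_def one_cat_def
      intro!: restrict_ext)

lemma const_map_hom:
  fixes U :: "'i set set"
  assumes "smallness U" "f \<in> Arr C"
  shows "const_map f \<in> hom_set (pro_cat U C) (const_obj (Dom C f)) (const_obj (Cod C f))"
    "(undefined :: 'i, f) \<in> Family (const_map f) undefined"
proof -
  have "(undefined :: 'i, f) \<in> colim_elems C (const_obj (Dom C f)) (Cod C f)"
    using assms(2) by (simp add: mem_colim_elems const_obj_simps)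
  note to_const_hom[OF assms(1) const_obj[OF assms(1) dom_obj[OF assms(2)]] this]
  then show "const_map f \<in> hom_set (pro_cat U C) (const_obj (Dom C f)) (const_obj (Cod C f))"
    "(undefined :: 'i, f) \<in> Family (const_map f) undefined"
    by (simp_all only: const_map_eq_to_const)
qed

lemma to_const_eqI:
  fixes X :: "('i, 'o, 'a) pro_obj"
  assumes F: "F \<in> hom_set (pro_cat U C) X (const_obj y)" and G: "G \<in> hom_set (pro_cat U C) X (const_obj y)"
    and a: "a \<in> Family F undefined" and b: "b \<in> Family G undefined" and eq: "colim_eq C X a b"
  shows "F = G"
proof (rule pro_arr_eqI[OF F G])
  fix s :: 'i assume "s \<in> Obj (Index (const_obj y))"
  then have s: "s = undefined" "undefined \<in> Obj (Index (const_obj y))" by (auto simp: const_obj_simps)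
  have "b \<in> Family F undefined"
    using family_mem[OF F s(2) a family_class(1)[OF G s(2) b] eq] .
  with b show "\<exists>a. a \<in> Family F s \<and> a \<in> Family G s" using s by blast
qed

lemma to_const_rep:
  assumes F: "F \<in> hom_set (pro_cat U C) X (const_obj y)"
  obtains t g where "(t, g) \<in> Family F undefined" "(t, g) \<in> colim_elems C X y"
  using family_ex[OF F, of undefined] by (auto simp: const_obj_simps)

lemma to_const_family_eq:
  assumes F: "F \<in> hom_set (pro_cat U C) X (const_obj y)"
    and "a \<in> Family F undefined" "b \<in> Family F undefined"
  shows "colim_eq C X a b"
  using family_eq[OF F _ assms(2,3)] by (simp add: const_obj_simps)

lemma to_const_comp_mem:
  assumes "F \<in> hom_set (pro_cat U C) X Y" "G \<in> hom_set (pro_cat U C) Y (const_obj z)"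
    "(s, h) \<in> Family G undefined" "(t, g) \<in> Family F s"
  shows "(t, h \<cdot> g) \<in> Family (pro_comp C G F) undefined"
  using pro_comp_mem[OF assms(1,2) _ assms(3,4)] by (simp add: const_obj_simps)

lemma level_map_hom:
  assumes K: "cofiltering U K" and F: "is_functor K C F" and G: "is_functor K C G"
    and nt: "nat_trans K C F G \<tau>"
  shows "level_map C K F G \<tau> \<in> hom_set (pro_cat U C) \<lparr>Index = K, Diag = F\<rparr> \<lparr>Index = K, Diag = G\<rparr>"
    "s \<in> Obj K \<Longrightarrow> (s, \<tau> s) \<in> Family (level_map C K F G \<tau>) s"
proof -
  interpret K: category K using cofiltering_category[OF K] .
  define X where "X = \<lparr>Index = K, Diag = F\<rparr>"
  define Y where "Y = \<lparr>Index = K, Diag = G\<rparr>"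
  have X: "X \<in> pro_objs U C" and Y: "Y \<in> pro_objs U C"
    using K F G by (auto simp: X_def Y_def pro_objs_def)
  have \<tau>hom: "\<tau> s \<in> Arr C" "Dom C (\<tau> s) = ObMap F s" "Cod C (\<tau> s) = ObMap G s" if "s \<in> Obj K" for s
    using nt that by (auto simp: nat_trans_def mem_hom_set)
  have \<tau>nat: "\<tau> (Cod K k) \<cdot> ArMap F k = ArMap G k \<cdot> \<tau> (Dom K k)" if "k \<in> Arr K" for k
    using nt that by (auto simp: nat_trans_def)
  note [simp] = functor_simps[OF F] functor_simps[OF G] arr_simps K.arr_simps \<tau>hom
  show "level_map C K F G \<tau> \<in> hom_set (pro_cat U C) \<lparr>Index = K, Diag = F\<rparr> \<lparr>Index = K, Diag = G\<rparr>"
    unfolding level_map_eq_pro_map X_def[symmetric] Y_def[symmetric]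
  proof (rule pro_map_hom[OF X Y])
    show "(s, \<tau> s) \<in> colim_elems C X (at_index Y s)" if "s \<in> Obj (Index Y)" for s
      using that by (simp add: X_def Y_def mem_colim_elems)
    fix k assume k: "k \<in> Arr (Index Y)"
    then have "colim_eq C X (Cod K k, \<tau> (Cod K k)) (Dom K k, \<tau> (Cod K k) \<cdot> ArMap F k)"
      using colim_eq_step[OF X, of k "Cod K k" "Dom K k" "\<tau> (Cod K k)" "ObMap G (Cod K k)"]
      by (simp add: X_def Y_def mem_colim_elems)
    then show "colim_eq C X (fst (Dom (Index Y) k, \<tau> (Dom (Index Y) k)),
        ArMap (Diag Y) k \<cdot> snd (Dom (Index Y) k, \<tau> (Dom (Index Y) k))) (Cod (Index Y) k, \<tau> (Cod (Index Y) k))"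
      using \<tau>nat k by (simp add: Y_def colim_eq_sym)
  qed
  show "(s, \<tau> s) \<in> Family (level_map C K F G \<tau>) s" if "s \<in> Obj K"
    unfolding level_map_eq_pro_map X_def[symmetric] Y_def[symmetric]
    using that X pro_map_mem[of X U s Y "\<lambda>s. (s, \<tau> s)"] by (simp add: X_def Y_def mem_colim_elems)
qed

lemma const_map_comp:
  fixes U :: "'i set set"
  assumes U: "smallness U" and f: "f \<in> Arr C" "g \<in> Arr C" "Cod C f = Dom C g"
  shows "pro_comp C (const_map g) (const_map f) = (const_map (g \<cdot> f) :: ('i, 'o, 'a) pro_arr)"
proof -
  have h: "const_map (g \<cdot> f) \<in> hom_set (pro_cat U C) (const_obj (Dom C f)) (const_obj (Cod C g))"
    using const_map_hom(1)[OF U, of "g \<cdot> f"] f by (simp add: arr_simps)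
  have g: "const_map g \<in> hom_set (pro_cat U C) (const_obj (Cod C f)) (const_obj (Cod C g))"
    using const_map_hom(1)[OF U, of g] f by simp
  note fg = pro_comp_hom[OF const_map_hom(1)[OF U f(1)] g]
  have "(undefined :: 'i, g \<cdot> f) \<in> Family (pro_comp C (const_map g) (const_map f)) undefined"
    using to_const_comp_mem[OF const_map_hom(1)[OF U f(1)] g] const_map_hom(2)[OF U] f by blast
  then show ?thesis
    using to_const_eqI[OF fg h] const_map_hom(2)[OF U] f to_const_family_eq[OF fg] comp_seq(1)
    by metis
qed


section \<open>Lifting against constant maps\<close>

text \<open>Both horizontal maps are represented at indices of \<open>K\<close>, and commutativity
  holds at a common refinement \<open>r\<close>. There \<open>w\<close> is the level map, while
  \<open>\<xi>\<close> and \<open>\<eta>\<close> are the isomorphisms to the diagrams followed by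
  the projections to index \<open>r\<close>.\<close>

lemma essentially_levelwise_square:
  fixes f :: "('i, 'o, 'a) pro_arr" and U :: "'i set set"
  assumes U: "smallness U" and f: "essentially_levelwise U C P f" and p: "p \<in> Arr C"
    and u: "u \<in> hom_set (pro_cat U C) (Src f) (const_obj (Dom C p))"
    and v: "v \<in> hom_set (pro_cat U C) (Tgt f) (const_obj (Cod C p))"
    and sq: "pro_comp C (const_map p) u = pro_comp C v f"
  obtains w x y and \<xi> \<eta> :: "('i, 'o, 'a) pro_arr"
  where "w \<in> P" "w \<in> Arr C" "x \<in> hom_set C (Dom C w) (Dom C p)" "y \<in> hom_set C (Cod C w) (Cod C p)"
    "p \<cdot> x = y \<cdot> w" "\<xi> \<in> hom_set (pro_cat U C) (Src f) (const_obj (Dom C w))"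
    "\<eta> \<in> hom_set (pro_cat U C) (Tgt f) (const_obj (Cod C w))"
    "pro_comp C \<eta> f = pro_comp C (const_map w) \<xi>"
    "u = pro_comp C (const_map x) \<xi>" "v = pro_comp C (const_map y) \<eta>"
proof -
  obtain K F G a b \<tau> where rep: "is_level_rep U C f K F G a b \<tau>" and \<tau>: "\<And>s. s \<in> Obj K \<Longrightarrow> \<tau> s \<in> P"
    using f by (auto simp: essentially_levelwise_def)
  define X where "X = \<lparr>Index = K, Diag = F\<rparr>"
  define Y where "Y = \<lparr>Index = K, Diag = G\<rparr>"
  define lm where "lm = level_map C K F G \<tau>"
  have K: "cofiltering U K" and F: "is_functor K C F" and G: "is_functor K C G"
    and nt: "nat_trans K C F G \<tau>"
    and f: "f \<in> hom_set (pro_cat U C) (Src f) (Tgt f)"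
    and a: "a \<in> hom_set (pro_cat U C) (Src f) X" "is_iso (pro_cat U C) a"
    and b: "b \<in> hom_set (pro_cat U C) (Tgt f) Y" "is_iso (pro_cat U C) b"
    and bf: "pro_comp C b f = pro_comp C lm a"
    using rep by (auto simp: is_level_rep_def X_def Y_def lm_def mem_hom_set pro_cat_simps)
  interpret K: category K using cofiltering_category[OF K] .
  have X: "X \<in> pro_objs U C" and Y: "Y \<in> pro_objs U C"
    using K F G by (auto simp: X_def Y_def pro_objs_def)
  have \<tau>hom: "\<tau> s \<in> Arr C" "Dom C (\<tau> s) = ObMap F s" "Cod C (\<tau> s) = ObMap G s" if "s \<in> Obj K" for s
    using nt that by (auto simp: nat_trans_def mem_hom_set)
  have \<tau>nat: "\<tau> (Cod K k) \<cdot> ArMap F k = ArMap G k \<cdot> \<tau> (Dom K k)" if "k \<in> Arr K" for k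
    using nt that by (auto simp: nat_trans_def)
  note [simp] = functor_simps[OF F] functor_simps[OF G] arr_simps K.arr_simps \<tau>hom
  note lm = level_map_hom(1)[OF K F G nt, folded X_def Y_def lm_def]
    and lm_mem = level_map_hom(2)[OF K F G nt, folded lm_def]
  obtain a' where a': "a' \<in> hom_set (pro_cat U C) X (Src f)" "pro_comp C a' a = pro_ident C (Src f)"
      "pro_comp C a a' = pro_ident C X"
    using a by (auto simp: is_iso_def mem_hom_set pro_cat_simps)
  obtain b' where b': "b' \<in> hom_set (pro_cat U C) Y (Tgt f)" "pro_comp C b' b = pro_ident C (Tgt f)"
      "pro_comp C b b' = pro_ident C Y"
    using b by (auto simp: is_iso_def mem_hom_set pro_cat_simps)
  note pU = const_map_hom(1)[OF U p]
  note ua = pro_comp_hom[OF a'(1) u] and vb = pro_comp_hom[OF b'(1) v]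
  \<comment> \<open>Inverting the isomorphisms turns the given square for \<open>f\<close> into a
    square for the level map \<open>lm\<close>.\<close>
  have "pro_comp C f a' = pro_comp C (pro_comp C b' b) (pro_comp C f a')"
    using b'(2) pro_comp_ident(2)[OF pro_comp_hom[OF a'(1) f]] by simp
  also have "\<dots> = pro_comp C b' (pro_comp C (pro_comp C b f) a')"
    by (simp add: pro_comp_assoc[OF pro_comp_hom[OF a'(1) f] b(1) b'(1)] pro_comp_assoc[OF a'(1) f b(1)])
  also have "\<dots> = pro_comp C b' lm"
    unfolding bf by (simp add: pro_comp_assoc[OF a'(1) a(1) lm] a'(3) pro_comp_ident[OF lm])
  finally have fa: "pro_comp C f a' = pro_comp C b' lm" .
  have sq': "pro_comp C (const_map p) (pro_comp C u a') = pro_comp C (pro_comp C v b') lm"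
    by (simp add: pro_comp_assoc[OF a'(1) u pU, symmetric] sq pro_comp_assoc[OF a'(1) f v] fa
        pro_comp_assoc[OF lm b'(1) v])
  obtain s x0 where x0: "(s, x0) \<in> Family (pro_comp C u a') undefined" "(s, x0) \<in> colim_elems C X (Dom C p)"
    using to_const_rep[OF ua] .
  obtain s' y0 where y0: "(s', y0) \<in> Family (pro_comp C v b') undefined" "(s', y0) \<in> colim_elems C Y (Cod C p)"
    using to_const_rep[OF vb] .
  have x0C: "s \<in> Obj K" "x0 \<in> Arr C" "Dom C x0 = ObMap F s" "Cod C x0 = Dom C p"
    and y0C: "s' \<in> Obj K" "y0 \<in> Arr C" "Dom C y0 = ObMap G s'" "Cod C y0 = Cod C p"
    using x0(2) y0(2) by (auto simp: mem_colim_elems X_def Y_def)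
  \<comment> \<open>The pairs in \<open>1\<close> and \<open>2\<close> are read off from the two
    sides of the transported square. They represent one map to a constant object and so agree after
    restriction along some \<open>k\<close> and \<open>l\<close>.\<close>
  have 1: "(s, p \<cdot> x0) \<in> Family (pro_comp C (const_map p) (pro_comp C u a')) undefined"
    using to_const_comp_mem[OF ua pU const_map_hom(2)[OF U p] x0(1)] .
  have 2: "(s', y0 \<cdot> \<tau> s') \<in> Family (pro_comp C (const_map p) (pro_comp C u a')) undefined"
    unfolding sq' using to_const_comp_mem[OF lm vb y0(1) lm_mem[OF y0C(1)]] .
  obtain k l where kl: "k \<in> Arr K" "l \<in> Arr K" "Dom K k = Dom K l" "Cod K k = s" "Cod K l = s'"
    "(p \<cdot> x0) \<cdot> ArMap F k = (y0 \<cdot> \<tau> s') \<cdot> ArMap F l"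
    using to_const_family_eq[OF pro_comp_hom[OF ua pU] 1 2] by (auto simp: colim_eq_def X_def)
  define r where "r = Dom K k"
  define x where "x = x0 \<cdot> ArMap F k"
  define y where "y = y0 \<cdot> ArMap G l"
  have r: "r \<in> Obj K" using kl by (simp add: r_def)
  have xC: "x \<in> Arr C" "Dom C x = ObMap F r" "Cod C x = Dom C p"
    and yC: "y \<in> Arr C" "Dom C y = ObMap G r" "Cod C y = Cod C p"
    using x0C y0C kl(1-5) by (simp_all add: x_def y_def r_def)
  have "p \<cdot> x = y0 \<cdot> (\<tau> (Cod K l) \<cdot> ArMap F l)"
    using kl p x0C y0C by (simp add: x_def)
  also have "\<dots> = y \<cdot> \<tau> r"
    unfolding \<tau>nat[OF kl(2)] using kl(1-5) y0C by (simp add: y_def r_def)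
  finally have px: "p \<cdot> x = y \<cdot> \<tau> r" .
  have elX: "(r, Ident C (ObMap F r)) \<in> colim_elems C X (ObMap F r)"
    and elY: "(r, Ident C (ObMap G r)) \<in> colim_elems C Y (ObMap G r)"
    using r by (simp_all add: mem_colim_elems X_def Y_def)
  \<comment> \<open>Projections of the two diagrams to their values at \<open>r\<close>, given by
    the classes of identities.\<close>
  define \<pi> where "\<pi> = to_const X (ObMap F r) (r, Ident C (ObMap F r))"
  define \<rho> where "\<rho> = to_const Y (ObMap G r) (r, Ident C (ObMap G r))"
  note \<pi> = to_const_hom[OF U X elX, folded \<pi>_def] and \<rho> = to_const_hom[OF U Y elY, folded \<rho>_def]
  have cx: "const_map x \<in> hom_set (pro_cat U C) (const_obj (ObMap F r)) (const_obj (Dom C p))"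
    and cy: "const_map y \<in> hom_set (pro_cat U C) (const_obj (ObMap G r)) (const_obj (Cod C p))"
    and c\<tau>: "const_map (\<tau> r) \<in> hom_set (pro_cat U C) (const_obj (ObMap F r)) (const_obj (ObMap G r))"
    using const_map_hom(1)[OF U xC(1)] const_map_hom(1)[OF U yC(1)] const_map_hom(1)[OF U, of "\<tau> r"] r xC yC
    by simp_all
  have "(r, x) \<in> Family (pro_comp C (const_map x) \<pi>) undefined"
    using to_const_comp_mem[OF \<pi>(1) cx const_map_hom(2)[OF U xC(1)] \<pi>(2)] xC by simp
  then have ux: "pro_comp C u a' = pro_comp C (const_map x) \<pi>"
    using to_const_eqI[OF ua pro_comp_hom[OF \<pi>(1) cx] x0(1)] colim_eq_step[OF X _ _ _ x0(2), of k r]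
      kl by (simp add: X_def x_def r_def)
  have "(r, y) \<in> Family (pro_comp C (const_map y) \<rho>) undefined"
    using to_const_comp_mem[OF \<rho>(1) cy const_map_hom(2)[OF U yC(1)] \<rho>(2)] yC by simp
  then have vy: "pro_comp C v b' = pro_comp C (const_map y) \<rho>"
    using to_const_eqI[OF vb pro_comp_hom[OF \<rho>(1) cy] y0(1)] colim_eq_step[OF Y _ _ _ y0(2), of l r]
      kl by (simp add: Y_def y_def r_def)
  have "(r, \<tau> r) \<in> Family (pro_comp C (const_map (\<tau> r)) \<pi>) undefined"
    using to_const_comp_mem[OF \<pi>(1) c\<tau> const_map_hom(2)[OF U] \<pi>(2)] r by simp
  moreover have "(r, \<tau> r) \<in> Family (pro_comp C \<rho> lm) undefined"
    using to_const_comp_mem[OF lm \<rho>(1,2) lm_mem[OF r]] r by simp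
  ultimately have \<pi>\<rho>: "pro_comp C (const_map (\<tau> r)) \<pi> = pro_comp C \<rho> lm"
    using to_const_eqI[OF pro_comp_hom[OF \<pi>(1) c\<tau>] pro_comp_hom[OF lm \<rho>(1)]] r
      colim_eq_refl[OF X, of "(r, \<tau> r)"] by (simp add: mem_colim_elems X_def)
  show ?thesis
  proof (rule that[of "\<tau> r" x y "pro_comp C \<pi> a" "pro_comp C \<rho> b"])
    show "\<tau> r \<in> P" "\<tau> r \<in> Arr C" "p \<cdot> x = y \<cdot> \<tau> r" using \<tau> r px by simp_all
    show "x \<in> hom_set C (Dom C (\<tau> r)) (Dom C p)" "y \<in> hom_set C (Cod C (\<tau> r)) (Cod C p)"
      using r xC yC by (simp_all add: mem_hom_set)
    show "pro_comp C \<pi> a \<in> hom_set (pro_cat U C) (Src f) (const_obj (Dom C (\<tau> r)))"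
      "pro_comp C \<rho> b \<in> hom_set (pro_cat U C) (Tgt f) (const_obj (Cod C (\<tau> r)))"
      using pro_comp_hom[OF a(1) \<pi>(1)] pro_comp_hom[OF b(1) \<rho>(1)] r by simp_all
    show "pro_comp C (pro_comp C \<rho> b) f = pro_comp C (const_map (\<tau> r)) (pro_comp C \<pi> a)"
      by (simp add: pro_comp_assoc[OF f b(1) \<rho>(1)] bf pro_comp_assoc[OF a(1) lm \<rho>(1), symmetric]
          \<pi>\<rho>[symmetric] pro_comp_assoc[OF a(1) \<pi>(1) c\<tau>])
    show "u = pro_comp C (const_map x) (pro_comp C \<pi> a)"
      by (simp add: pro_comp_assoc[OF a(1) \<pi>(1) cx, symmetric] ux[symmetric]
          pro_comp_assoc[OF a(1) a'(1) u] a'(2) pro_comp_ident[OF u])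
    show "v = pro_comp C (const_map y) (pro_comp C \<rho> b)"
      by (simp add: pro_comp_assoc[OF b(1) \<rho>(1) cy, symmetric] vy[symmetric]
          pro_comp_assoc[OF b(1) b'(1) v] b'(2) pro_comp_ident[OF v])
  qed
qed

lemma has_llp_const_iff:
  assumes U: "smallness U" and p: "p \<in> Arr C"
  shows "has_llp (pro_cat U C) f (const_map p) \<longleftrightarrow>
    (\<forall>u \<in> hom_set (pro_cat U C) (Src f) (const_obj (Dom C p)).
     \<forall>v \<in> hom_set (pro_cat U C) (Tgt f) (const_obj (Cod C p)).
       pro_comp C (const_map p) u = pro_comp C v f \<longrightarrow>
       (\<exists>h \<in> hom_set (pro_cat U C) (Tgt f) (const_obj (Dom C p)).
          pro_comp C h f = u \<and> pro_comp C (const_map p) h = v))"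
  using const_map_hom(1)[OF U p] by (simp add: has_llp_def pro_cat_simps mem_pro_hom)

lemma essentially_levelwise_hom:
  "essentially_levelwise U C P f \<Longrightarrow> f \<in> hom_set (pro_cat U C) (Src f) (Tgt f)"
  by (auto simp: essentially_levelwise_def is_level_rep_def mem_hom_set pro_cat_simps)

lemma essentially_levelwise_llp:
  assumes U: "smallness U" and f: "essentially_levelwise U C P f" and p: "p \<in> Arr C"
    and llp: "\<And>i. i \<in> P \<Longrightarrow> has_llp C i p"
  shows "has_llp (pro_cat U C) f (const_map p)"
  unfolding has_llp_const_iff[OF U p]
proof (intro ballI impI)
  fix u v assume u: "u \<in> hom_set (pro_cat U C) (Src f) (const_obj (Dom C p))"
    and v: "v \<in> hom_set (pro_cat U C) (Tgt f) (const_obj (Cod C p))"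
    and sq: "pro_comp C (const_map p) u = pro_comp C v f"
  from essentially_levelwise_square[OF U f p u v sq] obtain w x y \<xi> \<eta>
    where w: "w \<in> P" "w \<in> Arr C" and x: "x \<in> hom_set C (Dom C w) (Dom C p)"
      and y: "y \<in> hom_set C (Cod C w) (Cod C p)" and xy: "p \<cdot> x = y \<cdot> w"
      and \<xi>: "\<xi> \<in> hom_set (pro_cat U C) (Src f) (const_obj (Dom C w))"
      and \<eta>: "\<eta> \<in> hom_set (pro_cat U C) (Tgt f) (const_obj (Cod C w))"
      and eqs: "pro_comp C \<eta> f = pro_comp C (const_map w) \<xi>"
        "u = pro_comp C (const_map x) \<xi>" "v = pro_comp C (const_map y) \<eta>"
    by metis
  obtain l where l: "l \<in> hom_set C (Cod C w) (Dom C p)" "l \<cdot> w = x" "p \<cdot> l = y"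
    using llp[OF w(1)] x y xy unfolding has_llp_def by blast
  have lC: "l \<in> Arr C" "Dom C l = Cod C w" "Cod C l = Dom C p"
    using l(1) by (auto simp: mem_hom_set)
  have cl: "const_map l \<in> hom_set (pro_cat U C) (const_obj (Cod C w)) (const_obj (Dom C p))"
    using const_map_hom(1)[OF U lC(1)] lC by simp
  \<comment> \<open>The lift \<open>l\<close> found at one index is pulled back to the pro-objects
    along \<open>\<eta>\<close>.\<close>
  have "pro_comp C (pro_comp C (const_map l) \<eta>) f = u"
    using pro_comp_assoc[OF essentially_levelwise_hom[OF f] \<eta> cl]
      pro_comp_assoc[OF \<xi> const_map_hom(1)[OF U w(2)] cl] const_map_comp[OF U w(2) lC(1)] lC eqs l by simp
  moreover have "pro_comp C (const_map p) (pro_comp C (const_map l) \<eta>) = v"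
    using pro_comp_assoc[OF \<eta> cl const_map_hom(1)[OF U p]] const_map_comp[OF U lC(1) p] lC eqs l by simp
  ultimately show "\<exists>h \<in> hom_set (pro_cat U C) (Tgt f) (const_obj (Dom C p)).
      pro_comp C h f = u \<and> pro_comp C (const_map p) h = v"
    using pro_comp_hom[OF \<eta> cl] by blast
qed

end

text \<open>The level map \<open>w\<close> at the relevant index is known only to be a weak
  equivalence. The cofibration half of a strict acyclic cofibration enters as \<open>llp\<close>,
  which handles the acyclic fibration left over when \<open>w\<close> is factored.\<close>

lemma (in model_category) strict_weak_equivalence_llp_fib:
  assumes U: "smallness U'" and f: "strict_weak_equivalence U' M f" and p: "p \<in> Fib M"
    and llp: "\<And>q. q \<in> Fib M \<inter> Weq M \<Longrightarrow> has_llp (pro_cat U' M) f (const_map q)"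
  shows "has_llp (pro_cat U' M) f (const_map p)"
proof -
  have pA: "p \<in> Arr M" using p fib_arr by blast
  note f = f[unfolded strict_weak_equivalence_def]
  show ?thesis
    unfolding has_llp_const_iff[OF U pA]
  proof (intro ballI impI)
    fix u v assume u: "u \<in> hom_set (pro_cat U' M) (Src f) (const_obj (Dom M p))"
      and v: "v \<in> hom_set (pro_cat U' M) (Tgt f) (const_obj (Cod M p))"
      and sq: "pro_comp M (const_map p) u = pro_comp M v f"
    from essentially_levelwise_square[OF U f pA u v sq] obtain w x y \<xi> \<eta>
      where w: "w \<in> Weq M" "w \<in> Arr M" and x: "x \<in> hom_set M (Dom M w) (Dom M p)"
        and y: "y \<in> hom_set M (Cod M w) (Cod M p)" and xy: "p \<cdot> x = y \<cdot> w"
        and \<xi>: "\<xi> \<in> hom_set (pro_cat U' M) (Src f) (const_obj (Dom M w))"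
        and \<eta>: "\<eta> \<in> hom_set (pro_cat U' M) (Tgt f) (const_obj (Cod M w))"
        and eqs: "pro_comp M \<eta> f = pro_comp M (const_map w) \<xi>"
          "u = pro_comp M (const_map x) \<xi>" "v = pro_comp M (const_map y) \<eta>"
      by metis
    obtain i r where i: "i \<in> Cofib M" "r \<in> Fib M \<inter> Weq M" "Cod M i = Dom M r" "w = r \<cdot> i"
      using factor_cofib[OF w(2)] by blast
    have iA: "i \<in> Arr M" and rA: "r \<in> Arr M" using i cofib_arr fib_arr by auto
    have D: "Dom M i = Dom M w" "Cod M r = Cod M w" using i(3,4) iA rA by (auto simp: arr_simps)
    have "i \<in> Weq M"
      using two_of_three[of i "Dom M i" "Dom M r" r "Cod M r"] i w iA rA by (auto simp: mem_hom_set)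
    then have lp: "has_llp M i p" using lift_acyclic_cofib i p by blast
    have yC: "y \<in> Arr M" "Dom M y = Cod M r" "Cod M y = Cod M p" using y D by (auto simp: mem_hom_set)
    have yr: "(y \<cdot> r) \<cdot> i = y \<cdot> w"
      unfolding i(4) using i(3) iA rA yC by (simp add: arr_simps)
    have "x \<in> hom_set M (Dom M i) (Dom M p)" "y \<cdot> r \<in> hom_set M (Cod M i) (Cod M p)"
      "p \<cdot> x = (y \<cdot> r) \<cdot> i"
      using x yC yr D(1) i(3) iA rA xy by (simp_all add: mem_hom_set arr_simps)
    then obtain l where l: "l \<in> hom_set M (Cod M i) (Dom M p)" "l \<cdot> i = x" "p \<cdot> l = y \<cdot> r"
      using lp unfolding has_llp_def by blast
    have lC: "l \<in> Arr M" "Dom M l = Dom M r" "Cod M l = Dom M p"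
      using l(1) i by (auto simp: mem_hom_set)
    have ci: "const_map i \<in> hom_set (pro_cat U' M) (const_obj (Dom M w)) (const_obj (Dom M r))"
      and cr: "const_map r \<in> hom_set (pro_cat U' M) (const_obj (Dom M r)) (const_obj (Cod M w))"
      and cl: "const_map l \<in> hom_set (pro_cat U' M) (const_obj (Dom M r)) (const_obj (Dom M p))"
      and cy: "const_map y \<in> hom_set (pro_cat U' M) (const_obj (Cod M w)) (const_obj (Cod M p))"
      using const_map_hom(1)[OF U iA] const_map_hom(1)[OF U rA] const_map_hom(1)[OF U lC(1)]
        const_map_hom(1)[OF U yC(1)] i D lC yC by simp_all
    have "pro_comp M (const_map r) (pro_comp M (const_map i) \<xi>) = pro_comp M \<eta> f"
      using pro_comp_assoc[OF \<xi> ci cr] const_map_comp[OF U iA rA] i eqs by simp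
    moreover have "\<eta> \<in> hom_set (pro_cat U' M) (Tgt f) (const_obj (Cod M r))"
      using \<eta> D by simp
    \<comment> \<open>\<open>k\<close> lifts \<open>\<eta>\<close> through the acyclic fibration
      \<open>r\<close>, starting from \<open>i\<close> after \<open>\<xi>\<close>; followed by the
      lift \<open>l\<close> from the model category it solves the original square.\<close>
    ultimately obtain k where k: "k \<in> hom_set (pro_cat U' M) (Tgt f) (const_obj (Dom M r))"
      "pro_comp M k f = pro_comp M (const_map i) \<xi>" "pro_comp M (const_map r) k = \<eta>"
      using llp[OF i(2)] pro_comp_hom[OF \<xi> ci] unfolding has_llp_const_iff[OF U rA] by blast
    have "pro_comp M (pro_comp M (const_map l) k) f = u"
      using pro_comp_assoc[OF essentially_levelwise_hom[OF f] k(1) cl]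
        pro_comp_assoc[OF \<xi> ci cl] const_map_comp[OF U iA lC(1)] lC i eqs l k by simp
    moreover have "pro_comp M (const_map p) (pro_comp M (const_map l) k) = v"
      using pro_comp_assoc[OF k(1) cl const_map_hom(1)[OF U pA]] const_map_comp[OF U lC(1) pA] lC eqs l k
        pro_comp_assoc[OF k(1) cr cy] const_map_comp[OF U rA yC(1)] yC by simp
    ultimately show "\<exists>h \<in> hom_set (pro_cat U' M) (Tgt f) (const_obj (Dom M p)).
        pro_comp M h f = u \<and> pro_comp M (const_map p) h = v"
      using pro_comp_hom[OF k(1) cl] by blast
  qed
qed

section \<open>A criterion for isomorphisms of pro-objects\<close>

context category
begin

text \<open>This is the Yoneda lemma made elementary: \<open>\<phi>\<close> is an isomorphism if and only if
  \<open>colim\<^sub>k Hom(Y\<^sub>k, z) \<rightarrow> colim\<^sub>i Hom(X\<^sub>i, z)\<close> is bijective for all \<open>z\<close>.\<close>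

lemma pro_isoI:
  assumes \<phi>: "\<phi> \<in> hom_set (pro_cat U C) X Y"
    and surj: "\<And>i. i \<in> Obj (Index X) \<Longrightarrow> \<exists>k \<psi> t g. (k, \<psi>) \<in> colim_elems C Y (at_index X i) \<and>
      (t, g) \<in> Family \<phi> k \<and> colim_eq C X (t, \<psi> \<cdot> g) (i, Ident C (at_index X i))"
    and inj: "\<And>k z u v t g. \<lbrakk>(k, u) \<in> colim_elems C Y z; (k, v) \<in> colim_elems C Y z;
      (t, g) \<in> Family \<phi> k; u \<cdot> g = v \<cdot> g\<rbrakk> \<Longrightarrow>
      \<exists>\<kappa> \<in> Arr (Index Y). Cod (Index Y) \<kappa> = k \<and> u \<cdot> ArMap (Diag Y) \<kappa> = v \<cdot> ArMap (Diag Y) \<kappa>"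
  shows "is_iso (pro_cat U C) \<phi>"
proof -
  note X = pro_hom_objs(1)[OF \<phi>] and Y = pro_hom_objs(2)[OF \<phi>]
  interpret I: category "Index X" using pro_objsD(3)[OF X] .
  interpret K: category "Index Y" using pro_objsD(3)[OF Y] .
  note X_simps = functor_simps[OF pro_objsD(2)[OF X]]
  note Y_simps = functor_simps[OF pro_objsD(2)[OF Y]]
  note [simp] = arr_simps I.arr_simps K.arr_simps X_simps Y_simps
  \<comment> \<open>Extends \<open>inj\<close> from one index to the whole colimit: both elements
    are moved to a common index \<open>l\<close>, and there the equivalence is made an
    equality.\<close>
  have inj': "colim_eq C Y (k, u) (k', u')"
    if el: "(k, u) \<in> colim_elems C Y z" "(k', u') \<in> colim_elems C Y z"
      and tg: "(t, g) \<in> Family \<phi> k" "(t', g') \<in> Family \<phi> k'"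
      and eq: "colim_eq C X (t, u \<cdot> g) (t', u' \<cdot> g')" for k u k' u' z t g t' g'
  proof -
    have uC: "k \<in> Obj (Index Y)" "u \<in> Arr C" "Dom C u = at_index Y k" "Cod C u = z"
      "k' \<in> Obj (Index Y)" "u' \<in> Arr C" "Dom C u' = at_index Y k'" "Cod C u' = z"
      using el by (auto simp: mem_colim_elems)
    have gC: "(t, g) \<in> colim_elems C X (at_index Y k)" "(t', g') \<in> colim_elems C X (at_index Y k')"
      using family_class(1)[OF \<phi> _ tg(1)] family_class(1)[OF \<phi> _ tg(2)] uC by auto
    obtain a b where ab: "a \<in> Arr (Index Y)" "b \<in> Arr (Index Y)" "Dom (Index Y) a = Dom (Index Y) b"
      "Cod (Index Y) a = k" "Cod (Index Y) b = k'"
      using cofiltering_span[OF pro_objsD(1)[OF Y] uC(1,5)] by metis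
    define l where "l = Dom (Index Y) a"
    have l: "l \<in> Obj (Index Y)" using ab by (simp add: l_def)
    obtain t2 g2 where 2: "(t2, g2) \<in> Family \<phi> l" "(t2, g2) \<in> colim_elems C X (at_index Y l)"
      using family_ex[OF \<phi> l] .
    have g2C: "t2 \<in> Obj (Index X)" "g2 \<in> Arr C" "Dom C g2 = at_index X t2" "Cod C g2 = at_index Y l"
      using 2(2) by (auto simp: mem_colim_elems)
    have 3: "(t2, ArMap (Diag Y) a \<cdot> g2) \<in> Family \<phi> k" "(t2, ArMap (Diag Y) b \<cdot> g2) \<in> Family \<phi> k'"
      using family_compat[OF \<phi> ab(1)] family_compat[OF \<phi> ab(2)] 2(1) ab by (auto simp: l_def)
    have el3: "(t2, ArMap (Diag Y) a \<cdot> g2) \<in> colim_elems C X (at_index Y k)"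
      "(t2, ArMap (Diag Y) b \<cdot> g2) \<in> colim_elems C X (at_index Y k')"
      using family_class(1)[OF \<phi> uC(1) 3(1)] family_class(1)[OF \<phi> uC(5) 3(2)] by auto
    have elz: "(t, u \<cdot> g) \<in> colim_elems C X z" "(t', u' \<cdot> g') \<in> colim_elems C X z"
      "(t2, u \<cdot> (ArMap (Diag Y) a \<cdot> g2)) \<in> colim_elems C X z"
      "(t2, u' \<cdot> (ArMap (Diag Y) b \<cdot> g2)) \<in> colim_elems C X z"
      using gC el3 uC by (auto simp: mem_colim_elems)
    have 4: "colim_eq C X (t2, u \<cdot> (ArMap (Diag Y) a \<cdot> g2)) (t, u \<cdot> g)"
      using colim_eq_comp[OF X family_eq[OF \<phi> uC(1) 3(1) tg(1)] el3(1) gC(1)] uC by simp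
    have 5: "colim_eq C X (t', u' \<cdot> g') (t2, u' \<cdot> (ArMap (Diag Y) b \<cdot> g2))"
      using colim_eq_comp[OF X family_eq[OF \<phi> uC(5) tg(2) 3(2)] gC(2) el3(2)] uC by simp
    have "colim_eq C X (t2, u \<cdot> (ArMap (Diag Y) a \<cdot> g2)) (t2, u' \<cdot> (ArMap (Diag Y) b \<cdot> g2))"
      using colim_eq_trans[OF X colim_eq_trans[OF X 4 eq elz(3,1,2)] 5 elz(3,2,4)] .
    \<comment> \<open>With an identity span the refinement turns equivalence of two representatives
      at the same index into equality after a single restriction.\<close>
    from colim_eq_refine[OF X this elz(3,4), of "Ident (Index X) t2" "Ident (Index X) t2"] g2C
    obtain w where w: "w \<in> Arr (Index X)" "Cod (Index X) w = t2"
      "(u \<cdot> (ArMap (Diag Y) a \<cdot> g2)) \<cdot> ArMap (Diag X) w = (u' \<cdot> (ArMap (Diag Y) b \<cdot> g2)) \<cdot> ArMap (Diag X) w"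
      by (metis I.ident_seq I.comp_ident_seq(2))
    have w': "(u \<cdot> ArMap (Diag Y) a) \<cdot> (g2 \<cdot> ArMap (Diag X) w) = (u' \<cdot> ArMap (Diag Y) b) \<cdot> (g2 \<cdot> ArMap (Diag X) w)"
      using w uC ab g2C by (simp add: l_def)
    have elw: "(Dom (Index X) w, g2 \<cdot> ArMap (Diag X) w) \<in> colim_elems C X (at_index Y l)"
      using w(1,2) g2C by (simp add: mem_colim_elems)
    have "(Dom (Index X) w, g2 \<cdot> ArMap (Diag X) w) \<in> Family \<phi> l"
      using family_mem[OF \<phi> l 2(1) elw colim_eq_step[OF X w(1,2) refl 2(2)]] .
    from inj[OF _ _ this w', of z] obtain \<kappa> where \<kappa>: "\<kappa> \<in> Arr (Index Y)" "Cod (Index Y) \<kappa> = l"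
      "(u \<cdot> ArMap (Diag Y) a) \<cdot> ArMap (Diag Y) \<kappa> = (u' \<cdot> ArMap (Diag Y) b) \<cdot> ArMap (Diag Y) \<kappa>"
      using uC ab l by (auto simp: mem_colim_elems l_def)
    then show ?thesis
      unfolding colim_eq_def fst_conv snd_conv
      by (intro bexI[of _ "a \<cdot>\<^bsub>Index Y\<^esub> \<kappa>"] bexI[of _ "b \<cdot>\<^bsub>Index Y\<^esub> \<kappa>"])
        (use uC ab in \<open>simp_all add: l_def\<close>)
  qed
  obtain k \<psi> t g where rep: "\<And>i. i \<in> Obj (Index X) \<Longrightarrow> (k i, \<psi> i) \<in> colim_elems C Y (at_index X i)"
    "\<And>i. i \<in> Obj (Index X) \<Longrightarrow> (t i, g i) \<in> Family \<phi> (k i)"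
    "\<And>i. i \<in> Obj (Index X) \<Longrightarrow> colim_eq C X (t i, \<psi> i \<cdot> g i) (i, Ident C (at_index X i))"
    using surj by metis
  have rC: "k i \<in> Obj (Index Y)" "\<psi> i \<in> Arr C" "Dom C (\<psi> i) = at_index Y (k i)" "Cod C (\<psi> i) = at_index X i"
    if "i \<in> Obj (Index X)" for i
    using rep(1)[OF that] by (auto simp: mem_colim_elems)
  have gC: "t i \<in> Obj (Index X)" "g i \<in> Arr C" "Dom C (g i) = at_index X (t i)" "Cod C (g i) = at_index Y (k i)"
    if "i \<in> Obj (Index X)" for i
    using family_class(1)[OF \<phi> rC(1)[OF that] rep(2)[OF that]] by (auto simp: mem_colim_elems)
  \<comment> \<open>The candidate inverse: its component at \<open>i\<close> is a preimage, supplied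
    by \<open>surj\<close>, of the class of the identity at \<open>i\<close>.\<close>
  let ?\<Psi> = "pro_map C Y X (\<lambda>i. (k i, \<psi> i))"
  have \<Psi>: "?\<Psi> \<in> hom_set (pro_cat U C) Y X"
  proof (rule pro_map_hom[OF Y X])
    show "(k i, \<psi> i) \<in> colim_elems C Y (at_index X i)" if "i \<in> Obj (Index X)" for i
      using rep(1)[OF that] .
    fix v assume v: "v \<in> Arr (Index X)"
    define i j where "i = Dom (Index X) v" and "j = Cod (Index X) v"
    have ij: "i \<in> Obj (Index X)" "j \<in> Obj (Index X)" using v by (simp_all add: i_def j_def)
    have vC: "ArMap (Diag X) v \<in> Arr C" "Dom C (ArMap (Diag X) v) = at_index X i" "Cod C (ArMap (Diag X) v) = at_index X j"
      using v by (simp_all add: i_def j_def)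
    note [simp] = rC[OF ij(1)] rC[OF ij(2)] gC[OF ij(1)] gC[OF ij(2)] vC ij
    \<comment> \<open>Both sides of the compatibility condition are composed with
      \<open>\<phi>\<close>, where they become restrictions of identities; \<open>inj'\<close> then
      cancels \<open>\<phi>\<close>.\<close>
    have "colim_eq C X (t i, ArMap (Diag X) v \<cdot> (\<psi> i \<cdot> g i)) (i, ArMap (Diag X) v \<cdot> Ident C (at_index X i))"
      using colim_eq_comp[OF X rep(3)[OF ij(1)]] by (simp add: mem_colim_elems del: comp_ident_seq)
    moreover have "colim_eq C X (i, ArMap (Diag X) v) (j, Ident C (at_index X j))"
      using colim_eq_sym[OF colim_eq_step[OF X v j_def[symmetric] i_def[symmetric],
            of "Ident C (at_index X j)" "at_index X j"]] by (simp add: mem_colim_elems)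
    ultimately have "colim_eq C X (t i, (ArMap (Diag X) v \<cdot> \<psi> i) \<cdot> g i) (t j, \<psi> j \<cdot> g j)"
      using colim_eq_trans[OF X colim_eq_trans[OF X] colim_eq_sym[OF rep(3)[OF ij(2)]], of _ "(i, ArMap (Diag X) v)" "at_index X j"]
      by (simp add: mem_colim_elems)
    then show "colim_eq C Y (fst (k (Dom (Index X) v), \<psi> (Dom (Index X) v)),
        ArMap (Diag X) v \<cdot> snd (k (Dom (Index X) v), \<psi> (Dom (Index X) v))) (k (Cod (Index X) v), \<psi> (Cod (Index X) v))"
      using inj'[OF _ _ rep(2)[OF ij(1)] rep(2)[OF ij(2)], of "ArMap (Diag X) v \<cdot> \<psi> i" "at_index X j" "\<psi> j"]
      unfolding i_def[symmetric] j_def[symmetric] by (simp add: mem_colim_elems)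
  qed
  have \<Psi>_mem: "(k i, \<psi> i) \<in> Family ?\<Psi> i" if "i \<in> Obj (Index X)" for i
    using pro_map_mem[OF Y that, of "\<lambda>i. (k i, \<psi> i)"] rep(1)[OF that] by simp
  have "pro_comp C ?\<Psi> \<phi> = pro_ident C X"
  proof (rule pro_arr_eqI[OF pro_comp_hom[OF \<phi> \<Psi>] pro_ident_hom[OF X]])
    fix i assume i: "i \<in> Obj (Index X)"
    have "(t i, \<psi> i \<cdot> g i) \<in> Family (pro_comp C ?\<Psi> \<phi>) i"
      using pro_comp_mem[OF \<phi> \<Psi> i \<Psi>_mem[OF i] rep(2)[OF i]] .
    from family_mem[OF pro_comp_hom[OF \<phi> \<Psi>] i this _ rep(3)[OF i]]
    show "\<exists>a. a \<in> Family (pro_comp C ?\<Psi> \<phi>) i \<and> a \<in> Family (pro_ident C X) i"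
      using pro_ident_mem[OF X i] i by (auto simp: mem_colim_elems)
  qed
  moreover have "pro_comp C \<phi> ?\<Psi> = pro_ident C Y"
  proof (rule pro_arr_eqI[OF pro_comp_hom[OF \<Psi> \<phi>] pro_ident_hom[OF Y]])
    fix l assume l: "l \<in> Obj (Index Y)"
    obtain i g0 where ig: "(i, g0) \<in> Family \<phi> l" "(i, g0) \<in> colim_elems C X (at_index Y l)"
      using family_ex[OF \<phi> l] .
    then have i: "i \<in> Obj (Index X)" and g0: "g0 \<in> Arr C" "Dom C g0 = at_index X i" "Cod C g0 = at_index Y l"
      by (auto simp: mem_colim_elems)
    note [simp] = i g0 rC[OF i] gC[OF i] l
    have mem: "(k i, g0 \<cdot> \<psi> i) \<in> Family (pro_comp C \<phi> ?\<Psi>) l"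
      using pro_comp_mem[OF \<Psi> \<phi> l ig(1) \<Psi>_mem[OF i]] .
    \<comment> \<open>The same cancellation for the other composite: after \<open>\<phi>\<close>
      both candidates become the class of \<open>g0\<close>.\<close>
    have "colim_eq C X (t i, g0 \<cdot> (\<psi> i \<cdot> g i)) (i, g0 \<cdot> Ident C (at_index X i))"
      using colim_eq_comp[OF X rep(3)[OF i]] by (simp add: mem_colim_elems del: comp_ident_seq)
    then have "colim_eq C X (t i, (g0 \<cdot> \<psi> i) \<cdot> g i) (i, Ident C (at_index Y l) \<cdot> g0)"
      by simp
    then have "colim_eq C Y (k i, g0 \<cdot> \<psi> i) (l, Ident C (at_index Y l))"
      using inj'[OF _ _ rep(2)[OF i] ig(1)] by (simp add: mem_colim_elems del: comp_ident_seq comp_assoc_seq)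
    from family_mem[OF pro_comp_hom[OF \<Psi> \<phi>] l mem _ this]
    show "\<exists>a. a \<in> Family (pro_comp C \<phi> ?\<Psi>) l \<and> a \<in> Family (pro_ident C Y) l"
      using pro_ident_mem[OF Y l] by (auto simp: mem_colim_elems)
  qed
  ultimately show ?thesis
    using \<phi> \<Psi> unfolding is_iso_def by (auto simp: pro_cat_simps mem_hom_set)
qed

end

section \<open>Small categories on other types\<close>

text \<open>The index categories of pro-objects live on the type \<open>'i\<close>; \<open>small U A\<close> says that the set \<open>A\<close>
  of an arbitrary type can be moved there.\<close>

definition small :: "'i set set \<Rightarrow> 'x set \<Rightarrow> bool" where
  "small U A \<longleftrightarrow> (\<exists>B\<in>U. A \<lesssim> B)"

lemma small_mono: "small U B \<Longrightarrow> A \<subseteq> B \<Longrightarrow> small U A"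
  unfolding small_def by (meson lepoll_trans subset_imp_lepoll)

context
  fixes U :: "'i set set"
  assumes U: "smallness U"
begin

lemma smallness_Union: "A \<in> U \<Longrightarrow> (\<And>a. a \<in> A \<Longrightarrow> F a \<in> U) \<Longrightarrow> (\<Union>a\<in>A. F a) \<in> U"
  using U unfolding smallness_def by blast

lemma smallness_lepoll: "B \<in> U \<Longrightarrow> A \<lesssim> B \<Longrightarrow> A \<in> U"
  using U unfolding smallness_def by blast

lemma infinite_index: "infinite (UNIV :: 'i set)"
proof -
  obtain B :: "'i set" where "infinite B" using U by (auto simp: smallness_def)
  then show ?thesis using infinite_super[OF subset_UNIV] by blast
qed

text \<open>\<open>smallness\<close> concerns subsets of \<open>'i\<close> only, so pairs are coded
  by an injection of \<open>'i \<times> 'i\<close> into the infinite type \<open>'i\<close>; the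
  coded product is a small union of copies of \<open>B'\<close>.\<close>

lemma small_times:
  assumes "small U A" "small U B"
  shows "small U (A \<times> B)"
proof -
  obtain A' B' where AB: "A' \<in> U" "A \<lesssim> A'" "B' \<in> U" "B \<lesssim> B'"
    using assms by (auto simp: small_def)
  obtain pr :: "'i \<times> 'i \<Rightarrow> 'i" where pr: "inj pr"
    using card_of_Times_same_infinite[OF infinite_index]
    by (auto simp: card_of_ordIso[symmetric] bij_betw_def)
  have "(\<Union>a\<in>A'. pr ` ({a} \<times> B')) \<in> U"
  proof (rule smallness_Union[OF AB(1)])
    show "pr ` ({a} \<times> B') \<in> U" for a
      by (rule smallness_lepoll[OF AB(3)])
        (auto simp: lepoll_iff intro!: exI[of _ "\<lambda>b. pr (a, b)"])
  qed
  moreover have "A' \<times> B' \<lesssim> (\<Union>a\<in>A'. pr ` ({a} \<times> B'))"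
    unfolding lepoll_def
    by (intro exI[of _ pr] conjI inj_on_subset[OF pr]) auto
  moreover have "A \<times> B \<lesssim> A' \<times> B'"
    using AB by (simp add: times_lepoll_mono)
  ultimately show ?thesis
    unfolding small_def using lepoll_trans by blast
qed

lemma small_insert:
  assumes "small U A"
  shows "small U (insert x A)"
proof (cases "finite A")
  case True
  obtain B where "B \<in> U" "infinite B" using U by (auto simp: smallness_def)
  with True show ?thesis
    unfolding small_def using finite_lepoll_infinite by blast
next
  case False
  then have "insert x A \<lesssim> A"
    by (simp add: infinite_insert_eqpoll eqpoll_imp_lepoll)
  moreover obtain B where "B \<in> U" "A \<lesssim> B" using assms by (auto simp: small_def)
  ultimately show ?thesis
    unfolding small_def by (metis lepoll_trans)
qed

lemma small_inj:
  assumes "small U A"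
  obtains e where "inj_on e A" "e ` A \<in> U"
proof -
  obtain B e where B: "B \<in> U" "inj_on e A" "e ` A \<subseteq> B"
    using assms by (auto simp: small_def lepoll_def)
  then show ?thesis
    using that smallness_lepoll[OF B(1) subset_imp_lepoll] by metis
qed

text \<open>Transport of structure along injections into \<open>'i\<close>, with \<open>D\<close>
  the decoding functor. Pro-objects must be indexed by categories on \<open>'i\<close>, whereas the
  index category built below consists of pairs and tuples.\<close>

lemma small_category_encode:
  assumes K: "category K" and small: "small U (Obj K)" "small U (Arr K)"
  obtains K' D where "small_category U K'" "is_functor K' K D"
    "bij_betw (ObMap D) (Obj K') (Obj K)" "bij_betw (ArMap D) (Arr K') (Arr K)"
proof -
  interpret category K by (rule K)
  obtain eo where eo: "inj_on eo (Obj K)" "eo ` Obj K \<in> U"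
    using small_inj[OF small(1)] .
  obtain ea where ea: "inj_on ea (Arr K)" "ea ` Arr K \<in> U"
    using small_inj[OF small(2)] .
  define d where "d = the_inv_into (Obj K) eo"
  define da where "da = the_inv_into (Arr K) ea"
  have d: "d (eo x) = x" if "x \<in> Obj K" for x
    using that eo by (simp add: d_def the_inv_into_f_f)
  have da: "da (ea x) = x" if "x \<in> Arr K" for x
    using that ea by (simp add: da_def the_inv_into_f_f)
  define K' where "K' = \<lparr>Obj = eo ` Obj K, Arr = ea ` Arr K, Dom = (\<lambda>f. eo (Dom K (da f))),
    Cod = (\<lambda>f. eo (Cod K (da f))), Ident = (\<lambda>x. ea (Ident K (d x))),
    Comp = (\<lambda>g f. ea (Comp K (da g) (da f)))\<rparr>"
  define D where "D = \<lparr>ObMap = d, ArMap = da\<rparr>"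
  have eq: "eo x = eo y \<longleftrightarrow> x = y" if "x \<in> Obj K" "y \<in> Obj K" for x y
    using that eo by (auto simp: inj_on_def)
  note [simp] = d da eq arr_simps
  have "category K'"
    by unfold_locales (auto simp: K'_def mem_hom_set)
  then have "small_category U K'"
    using eo ea by (simp add: small_category_def K'_def)
  moreover have "is_functor K' K D"
    by (auto simp: is_functor_def K'_def D_def mem_hom_set)
  moreover have "bij_betw (ObMap D) (Obj K') (Obj K)" "bij_betw (ArMap D) (Arr K') (Arr K)"
    by (auto simp: K'_def D_def bij_betw_def inj_on_def image_image)
  ultimately show ?thesis using that by blast
qed

end

text \<open>An isomorphism of categories preserves cofilteredness, so the conditions may be verified
  on the original types.\<close>

lemma cofiltering_encode:
  assumes K': "small_category U K'" and K: "category K" and D: "is_functor K' K D"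
    and bij: "bij_betw (ObMap D) (Obj K') (Obj K)" "bij_betw (ArMap D) (Arr K') (Arr K)"
    and ne: "Obj K \<noteq> {}"
    and span: "\<And>s t. s \<in> Obj K \<Longrightarrow> t \<in> Obj K \<Longrightarrow>
      \<exists>u \<in> Arr K. \<exists>v \<in> Arr K. Dom K u = Dom K v \<and> Cod K u = s \<and> Cod K v = t"
    and equal: "\<And>f g. f \<in> Arr K \<Longrightarrow> g \<in> Arr K \<Longrightarrow> Dom K f = Dom K g \<Longrightarrow> Cod K f = Cod K g \<Longrightarrow>
      \<exists>h \<in> Arr K. Cod K h = Dom K f \<and> f \<cdot>\<^bsub>K\<^esub> h = g \<cdot>\<^bsub>K\<^esub> h"
  shows "cofiltering U K'"
  unfolding cofiltering_def
proof (intro conjI ballI allI)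
  interpret K': category K' using K' by (simp add: small_category_def)
  note D_simps = functor_simps[OF D]
  have ob: "x = y" if "ObMap D x = ObMap D y" "x \<in> Obj K'" "y \<in> Obj K'" for x y
    using bij(1) that by (auto simp: bij_betw_def inj_on_def)
  have ar: "x = y" if "ArMap D x = ArMap D y" "x \<in> Arr K'" "y \<in> Arr K'" for x y
    using bij(2) that by (auto simp: bij_betw_def inj_on_def)
  have ar_ex: "\<exists>u' \<in> Arr K'. ArMap D u' = u" if "u \<in> Arr K" for u
    using bij(2) that by (metis bij_betw_imp_surj_on imageE)
  show "small_category U K'" by (rule K')
  show "Obj K' \<noteq> {}" using ne bij(1) by (auto simp: bij_betw_def)
  show "\<exists>u\<in>Obj K'. hom_set K' u s \<noteq> {} \<and> hom_set K' u t \<noteq> {}" if s: "s \<in> Obj K'" and t: "t \<in> Obj K'" for s t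
  proof -
    obtain u v where uv: "u \<in> Arr K" "v \<in> Arr K" "Dom K u = Dom K v" "Cod K u = ObMap D s" "Cod K v = ObMap D t"
      using span[of "ObMap D s" "ObMap D t"] s t D_simps(4) by blast
    obtain u' v' where uv': "u' \<in> Arr K'" "v' \<in> Arr K'" "ArMap D u' = u" "ArMap D v' = v"
      using ar_ex uv by metis
    have "Cod K' u' = s" "Cod K' v' = t" "Dom K' v' = Dom K' u'"
      using uv uv' s t D_simps(1-3)[of u'] D_simps(1-3)[of v'] by (auto intro!: ob K'.arr_simps)
    then have "u' \<in> hom_set K' (Dom K' u') s" "v' \<in> hom_set K' (Dom K' u') t"
      using uv' by (auto simp: mem_hom_set)
    then show ?thesis using uv' K'.dom_obj by blast
  qed
  show "\<exists>h\<in>Arr K'. Cod K' h = s \<and> f \<cdot>\<^bsub>K'\<^esub> h = g \<cdot>\<^bsub>K'\<^esub> h"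
    if "f \<in> hom_set K' s t" "g \<in> hom_set K' s t" for s t f g
  proof -
    have fg: "f \<in> Arr K'" "g \<in> Arr K'" "Dom K' f = s" "Dom K' g = s" "Cod K' f = t" "Cod K' g = t"
      using that by (auto simp: mem_hom_set)
    obtain h where h: "h \<in> Arr K" "Cod K h = ObMap D s" "ArMap D f \<cdot>\<^bsub>K\<^esub> h = ArMap D g \<cdot>\<^bsub>K\<^esub> h"
      using equal[of "ArMap D f" "ArMap D g"] fg by (auto simp: D_simps)
    obtain h' where h': "h' \<in> Arr K'" "ArMap D h' = h"
      using ar_ex h by metis
    have "Cod K' h' = s"
      using h h' fg D_simps(3)[OF h'(1)] by (auto intro!: ob K'.arr_simps)
    moreover from this have "f \<cdot>\<^bsub>K'\<^esub> h' = g \<cdot>\<^bsub>K'\<^esub> h'"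
      using h h' fg by (intro ar) (simp_all add: D_simps K'.arr_simps)
    ultimately show ?thesis using h' by blast
  qed
qed

lemma functor_comp_functor:
  assumes "category K'" "is_functor K' K D" "is_functor K C F"
  shows "is_functor K' C \<lparr>ObMap = ObMap F \<circ> ObMap D, ArMap = ArMap F \<circ> ArMap D\<rparr>"
  using functor_simps[OF assms(2)] functor_simps[OF assms(3)] category.arr_simps[OF assms(1)]
  by (simp add: is_functor_def mem_hom_set)

section \<open>Level representations from the lifting property\<close>

text \<open>The map \<open>f : X \<rightarrow> Y\<close> is represented at \<open>j\<close> by \<open>g0 j : X\<^bsub>i0 j\<^esub> \<rightarrow> Y\<^sub>j\<close>. A pair
  \<open>k = (j, \<alpha>)\<close> with \<open>\<alpha> : i \<rightarrow> i0 j\<close> stands for the representative \<open>X\<^sub>i \<rightarrow> Y\<^sub>j\<close> obtained by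
  restriction along \<open>\<alpha>\<close>, which is factored as \<open>p k \<cdot> c k\<close> through an object \<open>Z\<^sub>k\<close>. A lift
  \<open>Y \<rightarrow> Z\<^sub>k\<close> is represented by \<open>h k\<close> at the source of an arrow \<open>e k\<close> with target \<open>j\<close>.\<close>

locale factored_map = category C
  for C :: "('o, 'a, 'z) cat_scheme" (structure) +
  fixes U :: "'i set set" and X Y :: "('i, 'o, 'a) pro_obj" and f :: "('i, 'o, 'a) pro_arr"
    and i0 :: "'i \<Rightarrow> 'i" and g0 :: "'i \<Rightarrow> 'a"
    and c p h :: "'i \<times> 'i \<Rightarrow> 'a" and e :: "'i \<times> 'i \<Rightarrow> 'i"
  assumes U: "smallness U"
    and f: "f \<in> hom_set (pro_cat U C) X Y"
    and g0: "j \<in> Obj (Index Y) \<Longrightarrow> (i0 j, g0 j) \<in> Family f j"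
    and c_arr: "\<lbrakk>j \<in> Obj (Index Y); \<alpha> \<in> Arr (Index X); Cod (Index X) \<alpha> = i0 j\<rbrakk> \<Longrightarrow> c (j, \<alpha>) \<in> Arr C"
    and p_arr: "\<lbrakk>j \<in> Obj (Index Y); \<alpha> \<in> Arr (Index X); Cod (Index X) \<alpha> = i0 j\<rbrakk> \<Longrightarrow>
      p (j, \<alpha>) \<in> Arr C \<and> Dom C (p (j, \<alpha>)) = Cod C (c (j, \<alpha>))"
    and factored: "\<lbrakk>j \<in> Obj (Index Y); \<alpha> \<in> Arr (Index X); Cod (Index X) \<alpha> = i0 j\<rbrakk> \<Longrightarrow>
      p (j, \<alpha>) \<cdot> c (j, \<alpha>) = g0 j \<cdot> ArMap (Diag X) \<alpha>"
    and e_arr: "\<lbrakk>j \<in> Obj (Index Y); \<alpha> \<in> Arr (Index X); Cod (Index X) \<alpha> = i0 j\<rbrakk> \<Longrightarrow>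
      e (j, \<alpha>) \<in> Arr (Index Y) \<and> Cod (Index Y) (e (j, \<alpha>)) = j"
    and h_arr: "\<lbrakk>j \<in> Obj (Index Y); \<alpha> \<in> Arr (Index X); Cod (Index X) \<alpha> = i0 j\<rbrakk> \<Longrightarrow>
      h (j, \<alpha>) \<in> hom_set C (at_index Y (Dom (Index Y) (e (j, \<alpha>)))) (Cod C (c (j, \<alpha>)))"
    and lift_lower: "\<lbrakk>j \<in> Obj (Index Y); \<alpha> \<in> Arr (Index X); Cod (Index X) \<alpha> = i0 j\<rbrakk> \<Longrightarrow>
      p (j, \<alpha>) \<cdot> h (j, \<alpha>) = ArMap (Diag Y) (e (j, \<alpha>))"
    and lift_upper: "\<lbrakk>j \<in> Obj (Index Y); \<alpha> \<in> Arr (Index X); Cod (Index X) \<alpha> = i0 j\<rbrakk> \<Longrightarrow>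
      \<exists>t g. (t, g) \<in> Family f (Dom (Index Y) (e (j, \<alpha>))) \<and>
        colim_eq C X (t, h (j, \<alpha>) \<cdot> g) (Dom (Index X) \<alpha>, c (j, \<alpha>))"
begin

lemma X: "X \<in> pro_objs U C" and Y: "Y \<in> pro_objs U C"
  using pro_hom_objs[OF f] by auto

sublocale I: category "Index X" using pro_objsD(3)[OF X] .
sublocale J: category "Index Y" using pro_objsD(3)[OF Y] .

lemmas XY_simps = functor_simps[OF pro_objsD(2)[OF X]] functor_simps[OF pro_objsD(2)[OF Y]]
lemmas all_simps = arr_simps I.arr_simps J.arr_simps XY_simps

abbreviation src_index :: "'i \<times> 'i \<Rightarrow> 'i" where
  "src_index k \<equiv> Dom (Index X) (snd k)"

abbreviation lift_index :: "'i \<times> 'i \<Rightarrow> 'i" where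
  "lift_index k \<equiv> Dom (Index Y) (e k)"

abbreviation mid :: "'i \<times> 'i \<Rightarrow> 'o" where
  "mid k \<equiv> Cod C (c k)"

definition Ob :: "('i \<times> 'i) set" where
  "Ob = {(j, \<alpha>). j \<in> Obj (Index Y) \<and> \<alpha> \<in> Arr (Index X) \<and> Cod (Index X) \<alpha> = i0 j}"

lemma g0_arr:
  assumes "j \<in> Obj (Index Y)"
  shows "i0 j \<in> Obj (Index X)" "g0 j \<in> Arr C" "Dom C (g0 j) = at_index X (i0 j)" "Cod C (g0 j) = at_index Y j"
  using family_class(1)[OF f assms g0[OF assms]] by (auto simp: mem_colim_elems)

context
  fixes k assumes k: "k \<in> Ob"
begin

lemma Ob_simps:
  "fst k \<in> Obj (Index Y)" "snd k \<in> Arr (Index X)" "Cod (Index X) (snd k) = i0 (fst k)"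
  "c k \<in> Arr C" "p k \<in> Arr C" "Dom C (p k) = mid k" "p k \<cdot> c k = g0 (fst k) \<cdot> ArMap (Diag X) (snd k)"
  "e k \<in> Arr (Index Y)" "Cod (Index Y) (e k) = fst k" "h k \<in> Arr C" "Dom C (h k) = at_index Y (lift_index k)"
  "Cod C (h k) = mid k" "p k \<cdot> h k = ArMap (Diag Y) (e k)"
  "src_index k \<in> Obj (Index X)" "lift_index k \<in> Obj (Index Y)"
  using k c_arr[of "fst k" "snd k"] p_arr[of "fst k" "snd k"] factored[of "fst k" "snd k"]
    e_arr[of "fst k" "snd k"] h_arr[of "fst k" "snd k"] lift_lower[of "fst k" "snd k"]
  by (auto simp: Ob_def mem_hom_set all_simps)

lemma c_dom: "Dom C (c k) = at_index X (src_index k)"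
proof -
  have "Dom C (c k) = Dom C (p k \<cdot> c k)"
    using Ob_simps(4-6) by (simp add: arr_simps)
  then show ?thesis
    unfolding Ob_simps(7) using Ob_simps(1-3) g0_arr by (simp add: all_simps)
qed

lemma p_cod: "Cod C (p k) = at_index Y (fst k)"
proof -
  have "Cod C (p k) = Cod C (p k \<cdot> c k)"
    using Ob_simps(4-6) by (simp add: arr_simps)
  then show ?thesis
    unfolding Ob_simps(7) using Ob_simps(1-3) g0_arr by (simp add: all_simps)
qed

lemma lift_upper':
  "\<exists>t g. (t, g) \<in> Family f (lift_index k) \<and> colim_eq C X (t, h k \<cdot> g) (src_index k, c k)"
  using lift_upper[of "fst k" "snd k"] k by (auto simp: Ob_def)

end

lemmas k_facts = Ob_simps(1-6,8-12,14,15) c_dom p_cod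
lemmas k_simps = k_facts g0_arr

text \<open>An arrow \<open>k' \<rightarrow> k\<close> lowers the \<open>X\<close>-index by \<open>a\<close>; on the middle objects it is either the
  identity (\<open>None\<close>) or the composite \<open>Z\<^bsub>k'\<^esub> \<rightarrow> Y\<^bsub>j'\<^esub> \<rightarrow> Z\<^sub>k\<close> through the lift \<open>h k\<close> (\<open>Some b\<close>).
  The arrow of \<open>Index Y\<close> that describes it between the indices of the lifts is \<open>lift_arr\<close>.\<close>

definition valid :: "'i \<times> 'i \<Rightarrow> 'i \<times> 'i \<Rightarrow> 'i option \<Rightarrow> bool" where
  "valid k' k q \<longleftrightarrow> k' \<in> Ob \<and> k \<in> Ob \<and> (case q of None \<Rightarrow> k' = k
     | Some b \<Rightarrow> b \<in> Arr (Index Y) \<and> Dom (Index Y) b = fst k' \<and> Cod (Index Y) b = lift_index k)"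

definition mid_map :: "'i \<times> 'i \<Rightarrow> 'i \<times> 'i \<Rightarrow> 'i option \<Rightarrow> 'a" where
  "mid_map k' k q = (case q of None \<Rightarrow> Ident C (mid k) | Some b \<Rightarrow> h k \<cdot> (ArMap (Diag Y) b \<cdot> p k'))"

definition lift_arr :: "'i \<times> 'i \<Rightarrow> 'i \<times> 'i \<Rightarrow> 'i option \<Rightarrow> 'i" where
  "lift_arr k' k q = (case q of None \<Rightarrow> Ident (Index Y) (lift_index k) | Some b \<Rightarrow> b \<cdot>\<^bsub>Index Y\<^esub> e k')"

text \<open>Here \<open>q'\<close> is the arrow applied first. If it passes through a lift via
  \<open>b\<close>, then so does the composite: by \<open>mid_map_h\<close> the later middle map
  slides past that lift and becomes \<open>lift_arr\<close>, which is composed with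
  \<open>b\<close>.\<close>

definition comp_opt :: "'i \<times> 'i \<Rightarrow> 'i \<times> 'i \<Rightarrow> 'i option \<Rightarrow> 'i option \<Rightarrow> 'i option" where
  "comp_opt k' k q q' = (case q' of None \<Rightarrow> q | Some b \<Rightarrow> Some (lift_arr k' k q \<cdot>\<^bsub>Index Y\<^esub> b))"

lemma lift_arr_seq:
  assumes "valid k' k q"
  shows "lift_arr k' k q \<in> Arr (Index Y)" "Dom (Index Y) (lift_arr k' k q) = lift_index k'"
    "Cod (Index Y) (lift_arr k' k q) = lift_index k"
  using assms by (auto simp: valid_def lift_arr_def k_simps all_simps split: option.splits)

lemma mid_map_seq:
  assumes "valid k' k q"
  shows "mid_map k' k q \<in> Arr C" "Dom C (mid_map k' k q) = mid k'" "Cod C (mid_map k' k q) = mid k"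
  using assms by (auto simp: valid_def mid_map_def k_simps all_simps split: option.splits)

text \<open>In the case \<open>Some b\<close> the inner \<open>p k' \<cdot> h k'\<close> collapses
  to the restriction along \<open>e k'\<close>. The equation both makes the lifts a map from
  \<open>Y\<close> to the diagram of middle objects and lets composites be rewritten in the form
  \<open>Some\<close>.\<close>

lemma mid_map_h:
  assumes "valid k' k q"
  shows "mid_map k' k q \<cdot> h k' = h k \<cdot> ArMap (Diag Y) (lift_arr k' k q)"
  using assms Ob_simps(13)[of k']
  by (auto simp: valid_def mid_map_def lift_arr_def k_simps all_simps split: option.splits)

context
  fixes k1 k2 k3 q1 q2
  assumes q: "valid k1 k2 q1" "valid k2 k3 q2"
begin

lemma valid_comp: "valid k1 k3 (comp_opt k2 k3 q2 q1)"
  using q lift_arr_seq[OF q(2)]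
  by (cases q1) (auto simp: valid_def comp_opt_def k_simps all_simps)

lemma lift_arr_comp:
  "lift_arr k1 k3 (comp_opt k2 k3 q2 q1) = lift_arr k2 k3 q2 \<cdot>\<^bsub>Index Y\<^esub> lift_arr k1 k2 q1"
proof (cases q1)
  case None
  with q have "k2 = k1" by (simp add: valid_def)
  moreover have "lift_arr k1 k3 q2 \<cdot>\<^bsub>Index Y\<^esub> Ident (Index Y) (lift_index k1) = lift_arr k1 k3 q2"
    using lift_arr_seq[OF q(2)] calculation by (simp add: all_simps)
  ultimately show ?thesis using None by (simp add: comp_opt_def lift_arr_def)
next
  case (Some b)
  with q have "b \<in> Arr (Index Y)" "Dom (Index Y) b = fst k1" "Cod (Index Y) b = lift_index k2" "k1 \<in> Ob"
    by (auto simp: valid_def)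
  moreover have "lift_arr k1 k3 (comp_opt k2 k3 q2 q1) = (lift_arr k2 k3 q2 \<cdot>\<^bsub>Index Y\<^esub> b) \<cdot>\<^bsub>Index Y\<^esub> e k1"
    using Some by (simp add: comp_opt_def lift_arr_def[of k1 k3])
  moreover have "lift_arr k1 k2 q1 = b \<cdot>\<^bsub>Index Y\<^esub> e k1"
    using Some by (simp add: lift_arr_def)
  ultimately show ?thesis
    using lift_arr_seq[OF q(2)] by (simp add: k_simps all_simps)
qed

lemma mid_map_comp: "mid_map k1 k3 (comp_opt k2 k3 q2 q1) = mid_map k2 k3 q2 \<cdot> mid_map k1 k2 q1"
proof (cases q1)
  case None
  with q have "k2 = k1" by (simp add: valid_def)
  moreover have "mid_map k1 k3 q2 \<cdot> Ident C (mid k1) = mid_map k1 k3 q2"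
    using mid_map_seq[OF q(2)] calculation by (simp add: all_simps)
  ultimately show ?thesis using None by (simp add: comp_opt_def mid_map_def)
next
  case (Some b)
  then have b: "b \<in> Arr (Index Y)" "Dom (Index Y) b = fst k1" "Cod (Index Y) b = lift_index k2"
    and Ob: "k1 \<in> Ob" "k2 \<in> Ob" "k3 \<in> Ob"
    using q by (auto simp: valid_def)
  have "mid_map k2 k3 q2 \<cdot> mid_map k1 k2 q1 = (mid_map k2 k3 q2 \<cdot> h k2) \<cdot> (ArMap (Diag Y) b \<cdot> p k1)"
    using Some mid_map_seq[OF q(2)] b Ob by (simp add: mid_map_def[of k1] k_simps all_simps)
  also have "\<dots> = h k3 \<cdot> (ArMap (Diag Y) (lift_arr k2 k3 q2 \<cdot>\<^bsub>Index Y\<^esub> b) \<cdot> p k1)"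
    unfolding mid_map_h[OF q(2)] using lift_arr_seq[OF q(2)] b Ob by (simp add: k_simps all_simps)
  also have "\<dots> = mid_map k1 k3 (comp_opt k2 k3 q2 q1)"
    using Some by (simp add: comp_opt_def mid_map_def[of k1])
  finally show ?thesis by simp
qed

end

lemma comp_opt_assoc:
  assumes "valid k1 k2 q1" "valid k2 k3 q2" "valid k3 k4 q3"
  shows "comp_opt k3 k4 q3 (comp_opt k2 k3 q2 q1) = comp_opt k2 k4 (comp_opt k3 k4 q3 q2) q1"
proof (cases q1)
  case None
  then show ?thesis by (simp add: comp_opt_def)
next
  case (Some b)
  then have "b \<in> Arr (Index Y)" "Cod (Index Y) b = lift_index k2"
    using assms by (auto simp: valid_def)
  then have "lift_arr k3 k4 q3 \<cdot>\<^bsub>Index Y\<^esub> (lift_arr k2 k3 q2 \<cdot>\<^bsub>Index Y\<^esub> b)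
      = lift_arr k2 k4 (comp_opt k3 k4 q3 q2) \<cdot>\<^bsub>Index Y\<^esub> b"
    using lift_arr_seq[OF assms(2)] lift_arr_seq[OF assms(3)] lift_arr_comp[OF assms(2,3)]
    by (simp add: all_simps)
  with Some show ?thesis by (simp add: comp_opt_def[of k2] comp_opt_def[of k3 k4 q3 "Some _"])
qed

lemma comp_opt_None:
  assumes "valid k' k q"
  shows "comp_opt k k None q = q"
  using assms by (auto simp: valid_def comp_opt_def lift_arr_def k_simps all_simps split: option.splits)

text \<open>Arrows store \<open>a\<close> and \<open>q\<close>, from which the maps of
  \<open>C\<close> are computed. Hence \<open>K\<close> is small whatever the size of the hom-sets
  of \<open>C\<close>, and parallel arrows can be equalized inside \<open>Index X\<close> and
  \<open>Index Y\<close>. The commuting square imposed on arrows is the naturality of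
  \<open>c\<close>.\<close>

definition K :: "('i \<times> 'i, ('i \<times> 'i) \<times> ('i \<times> 'i) \<times> 'i \<times> 'i option) cat" where
  "K = \<lparr>Obj = Ob,
     Arr = {(k', k, a, q). valid k' k q \<and> a \<in> hom_set (Index X) (src_index k') (src_index k) \<and>
       mid_map k' k q \<cdot> c k' = c k \<cdot> ArMap (Diag X) a},
     Dom = fst, Cod = fst \<circ> snd, Ident = (\<lambda>k. (k, k, Ident (Index X) (src_index k), None)),
     Comp = (\<lambda>(k2, k3, a2, q2) (k1, _, a1, q1). (k1, k3, a2 \<cdot>\<^bsub>Index X\<^esub> a1, comp_opt k2 k3 q2 q1))\<rparr>"

lemma K_simps:
  "Obj K = Ob" "Dom K (k', k, a, q) = k'" "Cod K (k', k, a, q) = k"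
  "(k', k, a, q) \<in> Arr K \<longleftrightarrow> valid k' k q \<and> a \<in> Arr (Index X) \<and> Dom (Index X) a = src_index k' \<and>
     Cod (Index X) a = src_index k \<and> mid_map k' k q \<cdot> c k' = c k \<cdot> ArMap (Diag X) a"
  "Ident K k = (k, k, Ident (Index X) (src_index k), None)"
  "(k, k2, a2, q2) \<cdot>\<^bsub>K\<^esub> (k', k, a, q) = (k', k2, a2 \<cdot>\<^bsub>Index X\<^esub> a, comp_opt k k2 q2 q)"
  by (auto simp: K_def mem_hom_set)

lemma K_comp_arr:
  assumes "(k1, k2, a1, q1) \<in> Arr K" "(k2, k3, a2, q2) \<in> Arr K"
  shows "(k1, k3, a2 \<cdot>\<^bsub>Index X\<^esub> a1, comp_opt k2 k3 q2 q1) \<in> Arr K"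
proof -
  have q: "valid k1 k2 q1" "valid k2 k3 q2" using assms by (auto simp: K_simps)
  have Ob: "k1 \<in> Ob" "k2 \<in> Ob" "k3 \<in> Ob" using q by (auto simp: valid_def)
  have a: "a1 \<in> Arr (Index X)" "Dom (Index X) a1 = src_index k1" "Cod (Index X) a1 = src_index k2"
    "a2 \<in> Arr (Index X)" "Dom (Index X) a2 = src_index k2" "Cod (Index X) a2 = src_index k3"
    using assms by (auto simp: K_simps)
  have n: "mid_map k1 k2 q1 \<cdot> c k1 = c k2 \<cdot> ArMap (Diag X) a1"
    "mid_map k2 k3 q2 \<cdot> c k2 = c k3 \<cdot> ArMap (Diag X) a2"
    using assms by (auto simp: K_simps)
  have "mid_map k1 k3 (comp_opt k2 k3 q2 q1) \<cdot> c k1 = mid_map k2 k3 q2 \<cdot> (mid_map k1 k2 q1 \<cdot> c k1)"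
    unfolding mid_map_comp[OF q] using mid_map_seq[OF q(1)] mid_map_seq[OF q(2)] Ob
    by (simp add: k_simps all_simps)
  also have "\<dots> = (mid_map k2 k3 q2 \<cdot> c k2) \<cdot> ArMap (Diag X) a1"
    unfolding n(1) using mid_map_seq[OF q(2)] Ob a by (simp add: k_simps all_simps)
  also have "\<dots> = c k3 \<cdot> ArMap (Diag X) (a2 \<cdot>\<^bsub>Index X\<^esub> a1)"
    unfolding n(2) using Ob a by (simp add: k_simps all_simps)
  finally show ?thesis
    using valid_comp[OF q] a by (simp add: K_simps all_simps)
qed

lemma K_ident_arr: "k \<in> Ob \<Longrightarrow> (k, k, Ident (Index X) (src_index k), None) \<in> Arr K"
  by (simp add: K_simps valid_def mid_map_def k_simps all_simps)

lemma K_category: "category K"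
proof
  fix F assume F: "F \<in> Arr K"
  obtain k' k a q where "F = (k', k, a, q)" by (cases F)
  with F show "Dom K F \<in> Obj K" "Cod K F \<in> Obj K" by (auto simp: K_simps valid_def)
next
  show "Ident K k \<in> hom_set K k k" if "k \<in> Obj K" for k
    using K_ident_arr that by (simp add: K_simps(1-3,5) mem_hom_set)
next
  fix F G k1 k2 k3 assume "F \<in> hom_set K k1 k2" "G \<in> hom_set K k2 k3"
  moreover obtain l1 l2 a q l1' l2' a' q' where "F = (l1, l2, a, q)" "G = (l1', l2', a', q')"
    by (cases F, cases G)
  ultimately show "G \<cdot>\<^bsub>K\<^esub> F \<in> hom_set K k1 k3"
    by (auto simp: K_simps(2,3,6) mem_hom_set intro: K_comp_arr)
next
  fix F G H k1 k2 k3 k4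
  assume "F \<in> hom_set K k1 k2" "G \<in> hom_set K k2 k3" "H \<in> hom_set K k3 k4"
  moreover obtain a q a' q' a'' q'' where "F = (k1, k2, a, q)" "G = (k2, k3, a', q')" "H = (k3, k4, a'', q'')"
    using calculation by (cases F, cases G, cases H) (auto simp: K_simps(2,3) mem_hom_set)
  ultimately show "H \<cdot>\<^bsub>K\<^esub> (G \<cdot>\<^bsub>K\<^esub> F) = (H \<cdot>\<^bsub>K\<^esub> G) \<cdot>\<^bsub>K\<^esub> F"
    using comp_opt_assoc[of k1 k2 q k3 q' k4 q''] by (simp add: K_simps mem_hom_set I.arr_simps)
next
  fix F k1 k2 assume "F \<in> hom_set K k1 k2"
  moreover obtain a q where "F = (k1, k2, a, q)"
    using calculation by (cases F) (auto simp: K_simps(2,3) mem_hom_set)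
  ultimately show "F \<cdot>\<^bsub>K\<^esub> Ident K k1 = F" "Ident K k2 \<cdot>\<^bsub>K\<^esub> F = F"
    using comp_opt_None[of k1 k2 q]
    by (auto simp: K_simps mem_hom_set I.arr_simps comp_opt_def[of _ _ _ None])
qed

text \<open>The new source has its own, unrelated factorization. This does no harm: an arrow of the
  form \<open>Some b\<close> sees \<open>c\<close> and \<open>p\<close> of its source only through
  their composite, which is a restriction of \<open>g0 j\<close>.\<close>

lemma K_arr_restrict:
  assumes k: "((j, \<alpha>), k, a, Some b) \<in> Arr K" and w: "w \<in> Arr (Index X)" "Cod (Index X) w = Dom (Index X) \<alpha>"
  shows "((j, \<alpha> \<cdot>\<^bsub>Index X\<^esub> w), k, a \<cdot>\<^bsub>Index X\<^esub> w, Some b) \<in> Arr K"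
proof -
  let ?k = "(j, \<alpha>)" and ?k' = "(j, \<alpha> \<cdot>\<^bsub>Index X\<^esub> w)"
  have v: "valid ?k k (Some b)" and a: "a \<in> Arr (Index X)" "Dom (Index X) a = Dom (Index X) \<alpha>"
    "Cod (Index X) a = src_index k" and n: "mid_map ?k k (Some b) \<cdot> c ?k = c k \<cdot> ArMap (Diag X) a"
    using k by (auto simp: K_simps)
  have Ob: "?k \<in> Ob" "k \<in> Ob" "?k' \<in> Ob" "j \<in> Obj (Index Y)" "\<alpha> \<in> Arr (Index X)" "Cod (Index X) \<alpha> = i0 j"
    using v w by (auto simp: valid_def Ob_def I.arr_simps)
  have b: "b \<in> Arr (Index Y)" "Dom (Index Y) b = j" "Cod (Index Y) b = lift_index k"
    using v by (auto simp: valid_def)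
  have v': "valid ?k' k (Some b)" using Ob b by (simp add: valid_def)
  note [simp] = k_facts[OF Ob(1), simplified] k_facts[OF Ob(3), simplified] k_facts[OF Ob(2)] g0_arr[OF Ob(4)]
  have "mid_map ?k' k (Some b) \<cdot> c ?k' = h k \<cdot> (ArMap (Diag Y) b \<cdot> (p ?k' \<cdot> c ?k'))"
    using b by (simp add: mid_map_def all_simps)
  also have "\<dots> = (h k \<cdot> (ArMap (Diag Y) b \<cdot> (g0 j \<cdot> ArMap (Diag X) \<alpha>))) \<cdot> ArMap (Diag X) w"
    unfolding Ob_simps(7)[OF Ob(3)] using b w Ob by (simp add: all_simps)
  also have "h k \<cdot> (ArMap (Diag Y) b \<cdot> (g0 j \<cdot> ArMap (Diag X) \<alpha>)) = mid_map ?k k (Some b) \<cdot> c ?k"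
    using b Ob_simps(7)[OF Ob(1)] by (simp add: mid_map_def all_simps)
  also have "\<dots> \<cdot> ArMap (Diag X) w = c k \<cdot> ArMap (Diag X) (a \<cdot>\<^bsub>Index X\<^esub> w)"
    unfolding n using a w by (simp add: all_simps)
  finally show ?thesis
    using v' a w Ob by (simp add: K_simps I.arr_simps)
qed

text \<open>Since the lift \<open>h k\<close> restricts to \<open>c k\<close> along \<open>f\<close>, every \<open>b\<close> into its index extends to an arrow
  of \<open>K\<close> after passing far enough down in \<open>X\<close>.\<close>

lemma K_arr_ex:
  assumes k: "k \<in> Ob" and b: "b \<in> Arr (Index Y)" "Cod (Index Y) b = lift_index k"
    and u: "u \<in> Arr (Index X)" "Cod (Index X) u = i0 (Dom (Index Y) b)"
    and v: "v \<in> Arr (Index X)" "Cod (Index X) v = src_index k" "Dom (Index X) u = Dom (Index X) v"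
  obtains w where "w \<in> Arr (Index X)" "Cod (Index X) w = Dom (Index X) u"
    "((Dom (Index Y) b, u \<cdot>\<^bsub>Index X\<^esub> w), k, v \<cdot>\<^bsub>Index X\<^esub> w, Some b) \<in> Arr K"
proof -
  define j where "j = Dom (Index Y) b"
  have j: "j \<in> Obj (Index Y)" using b by (simp add: j_def J.arr_simps)
  note [simp] = k_facts[OF k] g0_arr[OF j]
  obtain t g where tg: "(t, g) \<in> Family f (lift_index k)" "colim_eq C X (t, h k \<cdot> g) (src_index k, c k)"
    using lift_upper'[OF k] by blast
  \<comment> \<open>At \<open>lift_index k\<close> the map \<open>f\<close> now has two
    representatives: this one, moved there along \<open>b\<close>, and \<open>(t, g)\<close>, for
    which the lift is known to give back \<open>c k\<close>.\<close>
  have "(i0 j, ArMap (Diag Y) b \<cdot> g0 j) \<in> Family f (lift_index k)"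
    using family_compat[OF f b(1)] g0[OF j] b j_def by simp
  note 1 = this
  have el: "(i0 j, ArMap (Diag Y) b \<cdot> g0 j) \<in> colim_elems C X (at_index Y (lift_index k))"
    "(t, g) \<in> colim_elems C X (at_index Y (lift_index k))"
    using family_class(1)[OF f _ 1] family_class(1)[OF f _ tg(1)] by auto
  have el': "(i0 j, h k \<cdot> (ArMap (Diag Y) b \<cdot> g0 j)) \<in> colim_elems C X (mid k)"
    "(t, h k \<cdot> g) \<in> colim_elems C X (mid k)" "(src_index k, c k) \<in> colim_elems C X (mid k)"
    using el by (auto simp: mem_colim_elems arr_simps)
  have "colim_eq C X (i0 j, h k \<cdot> (ArMap (Diag Y) b \<cdot> g0 j)) (t, h k \<cdot> g)"
    using colim_eq_comp[OF X family_eq[OF f _ 1 tg(1)] el] by simp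
  from colim_eq_trans[OF X this tg(2) el']
  have "colim_eq C X (i0 j, h k \<cdot> (ArMap (Diag Y) b \<cdot> g0 j)) (src_index k, c k)" .
  from colim_eq_refine[OF X this el'(1,3) u(1) _ v(1,2,3)] u(2) obtain w
    where w: "w \<in> Arr (Index X)" "Cod (Index X) w = Dom (Index X) u"
      "(h k \<cdot> (ArMap (Diag Y) b \<cdot> g0 j)) \<cdot> ArMap (Diag X) (u \<cdot>\<^bsub>Index X\<^esub> w) = c k \<cdot> ArMap (Diag X) (v \<cdot>\<^bsub>Index X\<^esub> w)"
    unfolding j_def by metis
  let ?k' = "(j, u \<cdot>\<^bsub>Index X\<^esub> w)"
  have k': "?k' \<in> Ob" using j u w by (simp add: Ob_def j_def I.arr_simps)
  note [simp] = k_facts[OF k', simplified]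
  have uw: "u \<cdot>\<^bsub>Index X\<^esub> w \<in> Arr (Index X)" "Cod (Index X) (u \<cdot>\<^bsub>Index X\<^esub> w) = i0 j"
    using u w by (simp_all add: I.arr_simps j_def)
  have bY: "ArMap (Diag Y) b \<in> Arr C" "Dom C (ArMap (Diag Y) b) = at_index Y j"
    "Cod C (ArMap (Diag Y) b) = at_index Y (lift_index k)"
    using b by (simp_all add: XY_simps j_def)
  have uwX: "ArMap (Diag X) (u \<cdot>\<^bsub>Index X\<^esub> w) \<in> Arr C" "Cod C (ArMap (Diag X) (u \<cdot>\<^bsub>Index X\<^esub> w)) = at_index X (i0 j)"
    using functor_seq[OF pro_objsD(2)[OF X] uw(1)] uw(2) by simp_all
  have "mid_map ?k' k (Some b) \<cdot> c ?k' = h k \<cdot> (ArMap (Diag Y) b \<cdot> (p ?k' \<cdot> c ?k'))"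
    using bY by (simp add: mid_map_def arr_simps)
  also have "\<dots> = (h k \<cdot> (ArMap (Diag Y) b \<cdot> g0 j)) \<cdot> ArMap (Diag X) (u \<cdot>\<^bsub>Index X\<^esub> w)"
    unfolding Ob_simps(7)[OF k'] using bY uwX by (simp add: arr_simps)
  finally have "mid_map ?k' k (Some b) \<cdot> c ?k' = c k \<cdot> ArMap (Diag X) (v \<cdot>\<^bsub>Index X\<^esub> w)"
    unfolding w(3) .
  then have "(?k', k, v \<cdot>\<^bsub>Index X\<^esub> w, Some b) \<in> Arr K"
    using k k' b u v w by (simp add: K_simps valid_def j_def I.arr_simps)
  then show ?thesis
    using that w by (simp add: j_def)
qed

section \<open>The category \<open>K\<close> is cofiltered and small\<close>

lemma K_nonempty: "Ob \<noteq> {}"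
proof -
  obtain j where "j \<in> Obj (Index Y)"
    using pro_objsD(1)[OF Y] by (auto simp: cofiltering_def)
  then have "(j, Ident (Index X) (i0 j)) \<in> Ob"
    by (simp add: Ob_def g0_arr I.arr_simps)
  then show ?thesis by blast
qed

lemma index_span3:
  assumes "r \<in> Obj (Index X)" "s \<in> Obj (Index X)" "t \<in> Obj (Index X)"
  obtains u v w where "u \<in> Arr (Index X)" "v \<in> Arr (Index X)" "w \<in> Arr (Index X)"
    "Dom (Index X) u = Dom (Index X) w" "Dom (Index X) v = Dom (Index X) w"
    "Cod (Index X) u = r" "Cod (Index X) v = s" "Cod (Index X) w = t"
proof -
  obtain u v where uv: "u \<in> Arr (Index X)" "v \<in> Arr (Index X)" "Dom (Index X) u = Dom (Index X) v"
    "Cod (Index X) u = r" "Cod (Index X) v = s"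
    using cofiltering_span[OF pro_objsD(1)[OF X] assms(1,2)] .
  obtain a b where ab: "a \<in> Arr (Index X)" "b \<in> Arr (Index X)" "Dom (Index X) a = Dom (Index X) b"
    "Cod (Index X) a = Dom (Index X) u" "Cod (Index X) b = t"
    using cofiltering_span[OF pro_objsD(1)[OF X] I.dom_obj[OF uv(1)] assms(3)] .
  show ?thesis
    by (rule that[of "u \<cdot>\<^bsub>Index X\<^esub> a" "v \<cdot>\<^bsub>Index X\<^esub> a" b]) (use uv ab in \<open>simp_all add: I.arr_simps\<close>)
qed

text \<open>Both arrows must start at the same object, yet each exists only after its own
  restriction in \<open>X\<close>. The arrow to \<open>k1\<close> is built first, the arrow to
  \<open>k2\<close> below its source, and then the first is restricted by
  \<open>K_arr_restrict\<close>.\<close>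

lemma K_span:
  assumes k1: "k1 \<in> Ob" and k2: "k2 \<in> Ob"
  obtains k a1 q1 a2 q2 where "(k, k1, a1, q1) \<in> Arr K" "(k, k2, a2, q2) \<in> Arr K"
proof -
  obtain b1 b2 where b: "b1 \<in> Arr (Index Y)" "b2 \<in> Arr (Index Y)" "Dom (Index Y) b1 = Dom (Index Y) b2"
    "Cod (Index Y) b1 = lift_index k1" "Cod (Index Y) b2 = lift_index k2"
    using cofiltering_span[OF pro_objsD(1)[OF Y], of "lift_index k1" "lift_index k2"] k_facts[OF k1] k_facts[OF k2]
    by metis
  define j where "j = Dom (Index Y) b1"
  have j: "j \<in> Obj (Index Y)" using b by (simp add: j_def J.arr_simps)
  obtain u v1 v2 where uv: "u \<in> Arr (Index X)" "v1 \<in> Arr (Index X)" "v2 \<in> Arr (Index X)"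
    "Dom (Index X) u = Dom (Index X) v2" "Dom (Index X) v1 = Dom (Index X) v2"
    "Cod (Index X) u = i0 j" "Cod (Index X) v1 = src_index k1" "Cod (Index X) v2 = src_index k2"
    using index_span3[of "i0 j" "src_index k1" "src_index k2"] g0_arr(1)[OF j] k_facts[OF k1] k_facts[OF k2]
    by metis
  obtain w1 where w1: "w1 \<in> Arr (Index X)" "Cod (Index X) w1 = Dom (Index X) u"
    "((j, u \<cdot>\<^bsub>Index X\<^esub> w1), k1, v1 \<cdot>\<^bsub>Index X\<^esub> w1, Some b1) \<in> Arr K"
    using K_arr_ex[OF k1 b(1,4) uv(1), of v1] uv by (metis j_def)
  let ?u = "u \<cdot>\<^bsub>Index X\<^esub> w1" and ?v = "v2 \<cdot>\<^bsub>Index X\<^esub> w1"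
  have u: "?u \<in> Arr (Index X)" "Cod (Index X) ?u = i0 (Dom (Index Y) b2)" "Dom (Index X) ?u = Dom (Index X) w1"
    "?v \<in> Arr (Index X)" "Cod (Index X) ?v = src_index k2" "Dom (Index X) ?u = Dom (Index X) ?v"
    using uv w1(1,2) b j_def by (simp_all add: I.arr_simps)
  obtain w2 where w2: "w2 \<in> Arr (Index X)" "Cod (Index X) w2 = Dom (Index X) ?u"
    "((j, ?u \<cdot>\<^bsub>Index X\<^esub> w2), k2, ?v \<cdot>\<^bsub>Index X\<^esub> w2, Some b2) \<in> Arr K"
    using K_arr_ex[OF k2 b(2,5) u(1,2,4,5,6)] b(3) j_def by metis
  show ?thesis
    using that[OF K_arr_restrict[OF w1(3) w2(1,2)] w2(3)] .
qed

text \<open>After an arrow of the form \<open>Some b\<close>, the composite depends on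
  \<open>q1\<close> and \<open>q2\<close> only through \<open>lift_arr\<close>. So \<open>b\<close>
  equalizes the two \<open>lift_arr\<close> in \<open>Index Y\<close>, \<open>z\<close> equalizes
  \<open>a1\<close> and \<open>a2\<close> in \<open>Index X\<close>, and \<open>K_arr_ex\<close>
  joins both choices into one arrow.\<close>

lemma K_equalize:
  assumes 1: "(k', k, a1, q1) \<in> Arr K" and 2: "(k', k, a2, q2) \<in> Arr K"
  obtains k'' a q where "(k'', k', a, q) \<in> Arr K"
    "(k', k, a1, q1) \<cdot>\<^bsub>K\<^esub> (k'', k', a, q) = (k', k, a2, q2) \<cdot>\<^bsub>K\<^esub> (k'', k', a, q)"
proof -
  have q: "valid k' k q1" "valid k' k q2" and a: "a1 \<in> Arr (Index X)" "a2 \<in> Arr (Index X)"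
    "Dom (Index X) a1 = src_index k'" "Dom (Index X) a2 = src_index k'"
    "Cod (Index X) a1 = src_index k" "Cod (Index X) a2 = src_index k"
    using 1 2 by (auto simp: K_simps)
  have Ob: "k' \<in> Ob" using q by (simp add: valid_def)
  obtain b where b: "b \<in> Arr (Index Y)" "Cod (Index Y) b = lift_index k'"
    "lift_arr k' k q1 \<cdot>\<^bsub>Index Y\<^esub> b = lift_arr k' k q2 \<cdot>\<^bsub>Index Y\<^esub> b"
    using cofiltering_equalize[OF pro_objsD(1)[OF Y], of "lift_arr k' k q1" "lift_arr k' k q2"]
      lift_arr_seq[OF q(1)] lift_arr_seq[OF q(2)] by metis
  obtain z where z: "z \<in> Arr (Index X)" "Cod (Index X) z = src_index k'" "a1 \<cdot>\<^bsub>Index X\<^esub> z = a2 \<cdot>\<^bsub>Index X\<^esub> z"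
    using cofiltering_equalize[OF pro_objsD(1)[OF X], of a1 a2] a by metis
  obtain u v where uv: "u \<in> Arr (Index X)" "v \<in> Arr (Index X)" "Dom (Index X) u = Dom (Index X) v"
    "Cod (Index X) u = i0 (Dom (Index Y) b)" "Cod (Index X) v = Dom (Index X) z"
    using cofiltering_span[OF pro_objsD(1)[OF X] g0_arr(1)[OF J.dom_obj[OF b(1)]] I.dom_obj[OF z(1)]] .
  have zv: "z \<cdot>\<^bsub>Index X\<^esub> v \<in> Arr (Index X)" "Cod (Index X) (z \<cdot>\<^bsub>Index X\<^esub> v) = src_index k'"
    "Dom (Index X) u = Dom (Index X) (z \<cdot>\<^bsub>Index X\<^esub> v)"
    using z(1,2) uv by (simp_all add: I.arr_simps)
  obtain w where w: "w \<in> Arr (Index X)" "Cod (Index X) w = Dom (Index X) u"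
    "((Dom (Index Y) b, u \<cdot>\<^bsub>Index X\<^esub> w), k', (z \<cdot>\<^bsub>Index X\<^esub> v) \<cdot>\<^bsub>Index X\<^esub> w, Some b) \<in> Arr K"
    using K_arr_ex[OF Ob b(1,2) uv(1,4) zv] .
  have "a1 \<cdot>\<^bsub>Index X\<^esub> ((z \<cdot>\<^bsub>Index X\<^esub> v) \<cdot>\<^bsub>Index X\<^esub> w) = (a1 \<cdot>\<^bsub>Index X\<^esub> z) \<cdot>\<^bsub>Index X\<^esub> (v \<cdot>\<^bsub>Index X\<^esub> w)"
    using a z(1,2) uv w(1,2) by (simp add: I.arr_simps)
  also have "\<dots> = a2 \<cdot>\<^bsub>Index X\<^esub> ((z \<cdot>\<^bsub>Index X\<^esub> v) \<cdot>\<^bsub>Index X\<^esub> w)"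
    unfolding z(3) using a z(1,2) uv w(1,2) by (simp add: I.arr_simps)
  finally show ?thesis
    using that[OF w(3)] b(3) by (simp add: K_simps(6) comp_opt_def)
qed

lemma K_small: "small U (Obj K)" "small U (Arr K)"
proof -
  have *: "small U (Obj (Index X))" "small U (Arr (Index X))" "small U (Obj (Index Y))" "small U (Arr (Index Y))"
    using pro_objsD(1)[OF X] pro_objsD(1)[OF Y] unfolding small_def cofiltering_def small_category_def
    by (auto intro: lepoll_refl)
  show O: "small U (Obj K)"
    by (rule small_mono[OF small_times[OF U *(3,2)]]) (auto simp: K_simps Ob_def)
  have "small U (insert None (Some ` Arr (Index Y)))"
    using * by (intro small_insert[OF U]) (auto simp: small_def intro: lepoll_trans[OF image_lepoll])
  note S = small_times[OF U O small_times[OF U O small_times[OF U *(2) this]]]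
  show "small U (Arr K)"
  proof (rule small_mono[OF S], rule subsetI)
    fix F assume "F \<in> Arr K"
    moreover obtain k' k a q where "F = (k', k, a, q)" by (cases F)
    ultimately show "F \<in> Obj K \<times> Obj K \<times> Arr (Index X) \<times> insert None (Some ` Arr (Index Y))"
      by (cases q) (auto simp: K_simps valid_def)
  qed
qed

end

section \<open>The level representation indexed by \<open>K\<close>\<close>

context factored_map
begin

text \<open>The levels are the maps \<open>c k\<close>. Their sources form \<open>X\<close>
  reindexed along \<open>src_index\<close>, so identities give the isomorphism \<open>a\<close>; the
  lifts \<open>h k\<close> give \<open>b\<close>. In both cases \<open>pro_isoI\<close> asks for
  arrows into a given object, and \<open>K_arr_ex\<close> provides them.\<close>

lemma essentially_levelwise:
  assumes L: "\<And>k. k \<in> Ob \<Longrightarrow> c k \<in> L"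
  shows "essentially_levelwise U C L f"
proof -
  define FX where "FX = \<lparr>ObMap = (\<lambda>k. at_index X (src_index k)),
    ArMap = (\<lambda>(k', k, a, q). ArMap (Diag X) a) :: ('i \<times> 'i) \<times> ('i \<times> 'i) \<times> 'i \<times> 'i option \<Rightarrow> 'a\<rparr>"
  define FZ where "FZ = \<lparr>ObMap = mid, ArMap = (\<lambda>(k', k, a :: 'i, q). mid_map k' k q)\<rparr>"
  have FX: "is_functor K C FX"
    by (auto simp: is_functor_def FX_def K_simps mem_hom_set valid_def k_simps all_simps)
  have FZ: "is_functor K C FZ"
    using mid_map_seq mid_map_comp
    by (auto simp: is_functor_def FZ_def K_simps mem_hom_set k_simps all_simps)
      (simp_all add: mid_map_def)
  obtain K' D where K': "small_category U K'" and D: "is_functor K' K D"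
    and bij: "bij_betw (ObMap D) (Obj K') (Obj K)" "bij_betw (ArMap D) (Arr K') (Arr K)"
    using small_category_encode[OF U K_category K_small] .
  have cK': "category K'" using K' by (simp add: small_category_def)
  have cof: "cofiltering U K'"
  proof (rule cofiltering_encode[OF K' K_category D bij])
    show "Obj K \<noteq> {}" using K_nonempty by (simp add: K_simps)
    fix k1 k2 assume "k1 \<in> Obj K" "k2 \<in> Obj K"
    then have "k1 \<in> Ob" "k2 \<in> Ob" by (simp_all add: K_simps(1))
    from K_span[OF this] obtain k a1 q1 a2 q2 where "(k, k1, a1, q1) \<in> Arr K" "(k, k2, a2, q2) \<in> Arr K" .
    then show "\<exists>u\<in>Arr K. \<exists>v\<in>Arr K. Dom K u = Dom K v \<and> Cod K u = k1 \<and> Cod K v = k2"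
      using K_simps(2,3) by metis
  next
    fix F G assume FG: "F \<in> Arr K" "G \<in> Arr K" "Dom K F = Dom K G" "Cod K F = Cod K G"
    obtain k' k a1 q1 where F: "F = (k', k, a1, q1)" by (cases F)
    with FG obtain a2 q2 where G: "G = (k', k, a2, q2)" by (cases G) (simp add: K_simps(2,3))
    from K_equalize[OF FG(1,2)[unfolded F G]] obtain k'' a q where "(k'', k', a, q) \<in> Arr K"
      "F \<cdot>\<^bsub>K\<^esub> (k'', k', a, q) = G \<cdot>\<^bsub>K\<^esub> (k'', k', a, q)"
      unfolding F G by metis
    then show "\<exists>H\<in>Arr K. Cod K H = Dom K F \<and> F \<cdot>\<^bsub>K\<^esub> H = G \<cdot>\<^bsub>K\<^esub> H"
      using F K_simps(2,3) by metis
  qed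
  define F where "F = \<lparr>ObMap = ObMap FX \<circ> ObMap D, ArMap = ArMap FX \<circ> ArMap D\<rparr>"
  define G where "G = \<lparr>ObMap = ObMap FZ \<circ> ObMap D, ArMap = ArMap FZ \<circ> ArMap D\<rparr>"
  define \<tau> where "\<tau> = c \<circ> ObMap D"
  have F: "is_functor K' C F" and G: "is_functor K' C G"
    unfolding F_def G_def using functor_comp_functor[OF cK' D] FX FZ by auto
  have Dob: "ObMap D s \<in> Ob" if "s \<in> Obj K'" for s
    using functor_obj[OF D that] by (simp add: K_simps)
  have Darr: "ArMap D u \<in> Arr K" "Dom K (ArMap D u) = ObMap D (Dom K' u)" "Cod K (ArMap D u) = ObMap D (Cod K' u)"
    if "u \<in> Arr K'" for u
    using functor_seq[OF D that] .
  have ob_ex: "\<exists>s\<in>Obj K'. ObMap D s = k" if "k \<in> Ob" for k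
    using bij(1) that by (metis K_simps(1) bij_betw_imp_surj_on imageE)
  have arr_ex: "\<exists>u\<in>Arr K'. Cod K' u = s \<and> ArMap D u = (k', ObMap D s, a, q)"
    if s: "s \<in> Obj K'" and arr: "(k', ObMap D s, a, q) \<in> Arr K" for s k' a q
  proof -
    have "(k', ObMap D s, a, q) \<in> ArMap D ` Arr K'"
      using bij(2) arr by (simp add: bij_betw_def)
    then obtain u where u: "(k', ObMap D s, a, q) = ArMap D u" "u \<in> Arr K'"
      by (rule imageE)
    then have "ObMap D (Cod K' u) = ObMap D s"
      using Darr(3)[OF u(2)] by (simp add: K_simps(3) flip: u(1))
    then have "Cod K' u = s"
      using inj_onD[OF bij_betw_imp_inj_on[OF bij(1)]] s category.cod_obj[OF cK' u(2)] by blast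
    with u show ?thesis by metis
  qed
  have Gob: "ObMap G s = mid (ObMap D s)" and Fob: "ObMap F s = at_index X (src_index (ObMap D s))" for s
    by (simp_all add: F_def G_def FX_def FZ_def)
  have nt: "nat_trans K' C F G \<tau>"
    unfolding nat_trans_def
  proof (intro conjI ballI)
    show "\<tau> s \<in> hom_set C (ObMap F s) (ObMap G s)" if "s \<in> Obj K'" for s
      using k_facts[OF Dob[OF that]] by (simp add: \<tau>_def Fob Gob mem_hom_set)
    fix u assume u: "u \<in> Arr K'"
    obtain k' k a q where Du: "ArMap D u = (k', k, a, q)" by (cases "ArMap D u")
    then show "\<tau> (Cod K' u) \<cdot> ArMap F u = ArMap G u \<cdot> \<tau> (Dom K' u)"
      using Darr[OF u] by (simp add: K_simps \<tau>_def F_def G_def FX_def FZ_def)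
  qed
  define X' where "X' = \<lparr>Index = K', Diag = F\<rparr>"
  define Y' where "Y' = \<lparr>Index = K', Diag = G\<rparr>"
  have X': "X' \<in> pro_objs U C" and Y': "Y' \<in> pro_objs U C"
    using cof F G by (auto simp: X'_def Y'_def pro_objs_def)
  define lm where "lm = level_map C K' F G \<tau>"
  note lm = level_map_hom(1)[OF cof F G nt, folded X'_def Y'_def lm_def]
    and lm_mem = level_map_hom(2)[OF cof F G nt, folded lm_def]

  define \<rho>a where "\<rho>a = (\<lambda>s. (src_index (ObMap D s), Ident C (at_index X (src_index (ObMap D s)))))"
  define \<rho>b where "\<rho>b = (\<lambda>s. (lift_index (ObMap D s), h (ObMap D s)))"
  define a where "a = pro_map C X X' \<rho>a"
  define b where "b = pro_map C Y Y' \<rho>b"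
  have a_el: "\<rho>a s \<in> colim_elems C X (at_index X' s)" if "s \<in> Obj (Index X')" for s
    using k_facts[OF Dob, of s] that by (simp add: \<rho>a_def X'_def Fob mem_colim_elems all_simps)
  have b_el: "\<rho>b s \<in> colim_elems C Y (at_index Y' s)" if "s \<in> Obj (Index Y')" for s
    using k_facts[OF Dob, of s] that by (simp add: \<rho>b_def Y'_def Gob mem_colim_elems)
  have a: "a \<in> hom_set (pro_cat U C) X X'"
    unfolding a_def
  proof (rule pro_map_hom[OF X X' a_el])
    fix v assume "v \<in> Arr (Index X')"
    then have v: "v \<in> Arr K'" by (simp add: X'_def)
    obtain k' k \<alpha> q where Dv: "ArMap D v = (k', k, \<alpha>, q)" by (cases "ArMap D v")
    have k: "ObMap D (Dom K' v) = k'" "ObMap D (Cod K' v) = k" and arr: "(k', k, \<alpha>, q) \<in> Arr K"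
      using Darr[OF v] by (simp_all add: Dv K_simps(2,3))
    then have \<alpha>: "\<alpha> \<in> Arr (Index X)" "Dom (Index X) \<alpha> = src_index k'" "Cod (Index X) \<alpha> = src_index k"
      "k' \<in> Ob" "k \<in> Ob"
      by (auto simp: K_simps valid_def)
    have "(src_index k, Ident C (at_index X (src_index k))) \<in> colim_elems C X (at_index X (src_index k))"
      using \<alpha> by (simp add: mem_colim_elems k_simps all_simps)
    from colim_eq_sym[OF colim_eq_step[OF X \<alpha>(1,3,2) this]]
    show "colim_eq C X (fst (\<rho>a (Dom (Index X') v)), ArMap (Diag X') v \<cdot> snd (\<rho>a (Dom (Index X') v)))
       (\<rho>a (Cod (Index X') v))"
      using \<alpha> by (simp add: \<rho>a_def X'_def F_def FX_def k Dv k_simps all_simps)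
  qed
  have b: "b \<in> hom_set (pro_cat U C) Y Y'"
    unfolding b_def
  proof (rule pro_map_hom[OF Y Y' b_el])
    fix v assume "v \<in> Arr (Index Y')"
    then have v: "v \<in> Arr K'" by (simp add: Y'_def)
    obtain k' k \<alpha> q where Dv: "ArMap D v = (k', k, \<alpha>, q)" by (cases "ArMap D v")
    have k: "ObMap D (Dom K' v) = k'" "ObMap D (Cod K' v) = k" and arr: "(k', k, \<alpha>, q) \<in> Arr K"
      using Darr[OF v] by (simp_all add: Dv K_simps(2,3))
    then have q: "valid k' k q" and Ob: "k' \<in> Ob" "k \<in> Ob"
      by (auto simp: K_simps valid_def)
    have "(lift_index k, h k) \<in> colim_elems C Y (mid k)"
      using k_facts[OF Ob(2)] by (simp add: mem_colim_elems)
    from colim_eq_sym[OF colim_eq_step[OF Y lift_arr_seq(1,3,2)[OF q] this]]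
    show "colim_eq C Y (fst (\<rho>b (Dom (Index Y') v)), ArMap (Diag Y') v \<cdot> snd (\<rho>b (Dom (Index Y') v)))
       (\<rho>b (Cod (Index Y') v))"
      by (simp add: \<rho>b_def Y'_def G_def FZ_def k Dv mid_map_h[OF q])
  qed
  have a_mem: "\<rho>a s \<in> Family a s" and b_mem: "\<rho>b s \<in> Family b s" if "s \<in> Obj K'" for s
    unfolding a_def b_def
    using that pro_map_mem[OF X, of s X' \<rho>a] pro_map_mem[OF Y, of s Y' \<rho>b] a_el[of s] b_el[of s]
    by (simp_all add: X'_def Y'_def)

  have "is_iso (pro_cat U C) a"
  proof (rule pro_isoI[OF a])
    fix i assume i: "i \<in> Obj (Index X)"
    \<comment> \<open>Any \<open>j\<close> serves: its representative, restricted far enough, is an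
      object of \<open>K\<close> whose \<open>X\<close>-index maps to \<open>i\<close>.\<close>
    obtain j where j: "j \<in> Obj (Index Y)"
      using pro_objsD(1)[OF Y] by (auto simp: cofiltering_def)
    obtain u v where uv: "u \<in> Arr (Index X)" "v \<in> Arr (Index X)" "Dom (Index X) u = Dom (Index X) v"
      "Cod (Index X) u = i0 j" "Cod (Index X) v = i"
      using cofiltering_span[OF pro_objsD(1)[OF X] g0_arr(1)[OF j] i] .
    have "(j, u) \<in> Ob" using j uv by (simp add: Ob_def)
    then obtain s where s: "s \<in> Obj K'" "ObMap D s = (j, u)" using ob_ex by blast
    have 1: "(i, Ident C (at_index X i)) \<in> colim_elems C X (at_index X i)"
      using i by (simp add: mem_colim_elems all_simps)
    have "colim_eq C X (Dom (Index X) u, ArMap (Diag X) v \<cdot> Ident C (at_index X (Dom (Index X) u)))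
        (i, Ident C (at_index X i))"
      using colim_eq_sym[OF colim_eq_step[OF X uv(2,5) refl 1]] uv by (simp add: all_simps)
    moreover have "(s, ArMap (Diag X) v) \<in> colim_elems C X' (at_index X i)"
      using s uv by (simp add: mem_colim_elems X'_def Fob all_simps)
    ultimately show "\<exists>k \<psi> t g. (k, \<psi>) \<in> colim_elems C X' (at_index X i) \<and>
        (t, g) \<in> Family a k \<and> colim_eq C X (t, \<psi> \<cdot> g) (i, Ident C (at_index X i))"
      using a_mem[OF s(1)] s(2) by (fastforce simp: \<rho>a_def)
  next
    fix s z u v t g
    assume el: "(s, u) \<in> colim_elems C X' z" "(s, v) \<in> colim_elems C X' z" and tg: "(t, g) \<in> Family a s"
      and eq: "u \<cdot> g = v \<cdot> g"
    define k where "k = ObMap D s"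
    have s: "s \<in> Obj K'" and uv: "u \<in> Arr C" "v \<in> Arr C" "Dom C u = at_index X (src_index k)"
      "Dom C v = at_index X (src_index k)"
      using el by (auto simp: mem_colim_elems X'_def Fob k_def)
    have k: "k \<in> Ob" using Dob[OF s] by (simp add: k_def)
    have s': "s \<in> Obj (Index X')" using s by (simp add: X'_def)
    have g: "t \<in> Obj (Index X)" "g \<in> Arr C" "Dom C g = at_index X t" "Cod C g = at_index X (src_index k)"
      using family_class(1)[OF a s' tg] by (auto simp: mem_colim_elems X'_def Fob k_def)
    obtain n m where nm: "n \<in> Arr (Index X)" "m \<in> Arr (Index X)" "Dom (Index X) n = Dom (Index X) m"
      "Cod (Index X) n = t" "Cod (Index X) m = src_index k"
      "g \<cdot> ArMap (Diag X) n = Ident C (at_index X (src_index k)) \<cdot> ArMap (Diag X) m"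
      using family_eq[OF a s' tg a_mem[OF s]] unfolding colim_eq_def \<rho>a_def k_def[symmetric] fst_conv snd_conv
      by blast
    then have gn: "g \<cdot> ArMap (Diag X) n = ArMap (Diag X) m"
      by (simp add: all_simps)
    have "(u \<cdot> g) \<cdot> ArMap (Diag X) n = (v \<cdot> g) \<cdot> ArMap (Diag X) n" using eq by simp
    then have um: "u \<cdot> ArMap (Diag X) m = v \<cdot> ArMap (Diag X) m"
      using uv g nm(1-5) by (simp add: all_simps gn)
    \<comment> \<open>Taking \<open>b\<close> to be the identity of \<open>lift_index k\<close> in
      \<open>K_arr_ex\<close> yields an arrow into \<open>k\<close> whose \<open>X\<close>-part
      factors through \<open>m\<close>, where \<open>u\<close> and \<open>v\<close> already
      agree.\<close>
    have idl: "Ident (Index Y) (lift_index k) \<in> Arr (Index Y)"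
      "Cod (Index Y) (Ident (Index Y) (lift_index k)) = lift_index k"
      "Dom (Index Y) (Ident (Index Y) (lift_index k)) = lift_index k"
      using k_facts[OF k] by (simp_all add: J.arr_simps)
    obtain x y where xy: "x \<in> Arr (Index X)" "y \<in> Arr (Index X)" "Dom (Index X) x = Dom (Index X) y"
      "Cod (Index X) x = i0 (lift_index k)" "Cod (Index X) y = Dom (Index X) m"
      using cofiltering_span[OF pro_objsD(1)[OF X] g0_arr(1)[of "lift_index k"] I.dom_obj[OF nm(2)]] k_facts[OF k]
      by metis
    have my: "m \<cdot>\<^bsub>Index X\<^esub> y \<in> Arr (Index X)" "Cod (Index X) (m \<cdot>\<^bsub>Index X\<^esub> y) = src_index k"
      "Dom (Index X) x = Dom (Index X) (m \<cdot>\<^bsub>Index X\<^esub> y)"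
      using nm xy by (simp_all add: I.arr_simps)
    obtain w where w: "w \<in> Arr (Index X)" "Cod (Index X) w = Dom (Index X) x"
      "((lift_index k, x \<cdot>\<^bsub>Index X\<^esub> w), k, (m \<cdot>\<^bsub>Index X\<^esub> y) \<cdot>\<^bsub>Index X\<^esub> w, Some (Ident (Index Y) (lift_index k))) \<in> Arr K"
      using K_arr_ex[OF k idl(1,2) xy(1) _ my] idl xy by metis
    obtain \<kappa> where \<kappa>: "\<kappa> \<in> Arr K'" "Cod K' \<kappa> = s" "ArMap D \<kappa> = ((lift_index k, x \<cdot>\<^bsub>Index X\<^esub> w), k,
        (m \<cdot>\<^bsub>Index X\<^esub> y) \<cdot>\<^bsub>Index X\<^esub> w, Some (Ident (Index Y) (lift_index k)))"
      using arr_ex[OF s] w(3) unfolding k_def by metis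
    have F\<kappa>: "ArMap F \<kappa> = ArMap (Diag X) m \<cdot> ArMap (Diag X) (y \<cdot>\<^bsub>Index X\<^esub> w)"
      using \<kappa>(3) nm xy w(1,2) by (simp add: F_def FX_def all_simps)
    have "u \<cdot> ArMap F \<kappa> = (u \<cdot> ArMap (Diag X) m) \<cdot> ArMap (Diag X) (y \<cdot>\<^bsub>Index X\<^esub> w)"
      unfolding F\<kappa> using uv nm(1-5) xy w(1,2) by (simp add: all_simps)
    also have "\<dots> = v \<cdot> ArMap F \<kappa>"
      unfolding F\<kappa> um using uv nm(1-5) xy w(1,2) by (simp add: all_simps)
    finally show "\<exists>\<kappa>\<in>Arr (Index X'). Cod (Index X') \<kappa> = s \<and> u \<cdot> ArMap (Diag X') \<kappa> = v \<cdot> ArMap (Diag X') \<kappa>"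
      using \<kappa>(1,2) by (auto simp: X'_def)
  qed
  moreover have "is_iso (pro_cat U C) b"
  proof (rule pro_isoI[OF b])
    fix j assume j: "j \<in> Obj (Index Y)"
    \<comment> \<open>The way back to index \<open>j\<close> is \<open>p k\<close>: composed with
      the lift it is a restriction map of \<open>Y\<close>, hence equivalent to the
      identity.\<close>
    define k where "k = (j, Ident (Index X) (i0 j))"
    have k: "k \<in> Ob" using j by (simp add: k_def Ob_def g0_arr I.arr_simps)
    note kf = k_facts[OF k] Ob_simps(13)[OF k]
    have fk: "fst k = j" by (simp add: k_def)
    obtain s where s: "s \<in> Obj K'" "ObMap D s = k" using ob_ex[OF k] by blast
    have 1: "(j, Ident C (at_index Y j)) \<in> colim_elems C Y (at_index Y j)"
      using j by (simp add: mem_colim_elems all_simps)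
    have "e k \<in> Arr (Index Y)" "Cod (Index Y) (e k) = j" using kf fk by simp_all
    from colim_eq_sym[OF colim_eq_step[OF Y this refl 1]] this
    have "colim_eq C Y (lift_index k, p k \<cdot> h k) (j, Ident C (at_index Y j))"
      using kf by (simp add: all_simps)
    moreover have "(s, p k) \<in> colim_elems C Y' (at_index Y j)"
      using s kf fk by (simp add: mem_colim_elems Y'_def Gob)
    ultimately show "\<exists>k \<psi> t g. (k, \<psi>) \<in> colim_elems C Y' (at_index Y j) \<and>
        (t, g) \<in> Family b k \<and> colim_eq C Y (t, \<psi> \<cdot> g) (j, Ident C (at_index Y j))"
      using b_mem[OF s(1)] s(2) by (fastforce simp: \<rho>b_def)
  next
    fix s z u v t g
    assume el: "(s, u) \<in> colim_elems C Y' z" "(s, v) \<in> colim_elems C Y' z" and tg: "(t, g) \<in> Family b s"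
      and eq: "u \<cdot> g = v \<cdot> g"
    define k where "k = ObMap D s"
    have s: "s \<in> Obj K'" and uv: "u \<in> Arr C" "v \<in> Arr C" "Dom C u = mid k" "Dom C v = mid k"
      using el by (auto simp: mem_colim_elems Y'_def Gob k_def)
    have k: "k \<in> Ob" using Dob[OF s] by (simp add: k_def)
    note kf = k_facts[OF k]
    have s': "s \<in> Obj (Index Y')" using s by (simp add: Y'_def)
    have g: "t \<in> Obj (Index Y)" "g \<in> Arr C" "Dom C g = at_index Y t" "Cod C g = mid k"
      using family_class(1)[OF b s' tg] by (auto simp: mem_colim_elems Y'_def Gob k_def)
    obtain n m where nm: "n \<in> Arr (Index Y)" "m \<in> Arr (Index Y)" "Dom (Index Y) n = Dom (Index Y) m"
      "Cod (Index Y) n = t" "Cod (Index Y) m = lift_index k" "g \<cdot> ArMap (Diag Y) n = h k \<cdot> ArMap (Diag Y) m"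
      using family_eq[OF b s' tg b_mem[OF s]] unfolding colim_eq_def \<rho>b_def k_def[symmetric] fst_conv snd_conv
      by blast
    have "(u \<cdot> g) \<cdot> ArMap (Diag Y) n = (v \<cdot> g) \<cdot> ArMap (Diag Y) n" using eq by simp
    then have um: "u \<cdot> (h k \<cdot> ArMap (Diag Y) m) = v \<cdot> (h k \<cdot> ArMap (Diag Y) m)"
      using uv g nm(1-5) by (simp add: all_simps nm(6))
    obtain x y where xy: "x \<in> Arr (Index X)" "y \<in> Arr (Index X)" "Dom (Index X) x = Dom (Index X) y"
      "Cod (Index X) x = i0 (Dom (Index Y) m)" "Cod (Index X) y = src_index k"
      using cofiltering_span[OF pro_objsD(1)[OF X] g0_arr(1)[OF J.dom_obj[OF nm(2)]], of "src_index k"] kf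
      by metis
    obtain w where w: "w \<in> Arr (Index X)" "Cod (Index X) w = Dom (Index X) x"
      "((Dom (Index Y) m, x \<cdot>\<^bsub>Index X\<^esub> w), k, y \<cdot>\<^bsub>Index X\<^esub> w, Some m) \<in> Arr K"
      using K_arr_ex[OF k nm(2,5) xy(1,4,2,5,3)] .
    let ?k' = "(Dom (Index Y) m, x \<cdot>\<^bsub>Index X\<^esub> w)"
    have "?k' \<in> Ob" using w(3) by (auto simp: K_simps valid_def)
    note kf' = k_facts[OF this]
    obtain \<kappa> where \<kappa>: "\<kappa> \<in> Arr K'" "Cod K' \<kappa> = s" "ArMap D \<kappa> = (?k', k, y \<cdot>\<^bsub>Index X\<^esub> w, Some m)"
      using arr_ex[OF s] w(3) unfolding k_def by metis
    \<comment> \<open>The middle map of this arrow begins with \<open>p ?k'\<close> and then passes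
      through \<open>h k\<close> restricted along \<open>m\<close>, after which \<open>u\<close> and
      \<open>v\<close> agree.\<close>
    have G\<kappa>: "ArMap G \<kappa> = h k \<cdot> (ArMap (Diag Y) m \<cdot> p ?k')"
      using \<kappa>(3) by (simp add: G_def FZ_def mid_map_def)
    have "u \<cdot> ArMap G \<kappa> = (u \<cdot> (h k \<cdot> ArMap (Diag Y) m)) \<cdot> p ?k'"
      unfolding G\<kappa> using uv nm(1-5) kf kf' by (simp add: arr_simps XY_simps)
    also have "\<dots> = v \<cdot> ArMap G \<kappa>"
      unfolding G\<kappa> um using uv nm(1-5) kf kf' by (simp add: arr_simps XY_simps)
    finally show "\<exists>\<kappa>\<in>Arr (Index Y'). Cod (Index Y') \<kappa> = s \<and> u \<cdot> ArMap (Diag Y') \<kappa> = v \<cdot> ArMap (Diag Y') \<kappa>"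
      using \<kappa>(1,2) by (auto simp: Y'_def)
  qed
  \<comment> \<open>This is the upper triangle of the lifts: at each index \<open>h k\<close>
    composed with \<open>f\<close> is the class of \<open>c k\<close>.\<close>
  moreover have "pro_comp C b f = pro_comp C lm a"
  proof (rule pro_arr_eqI[OF pro_comp_hom[OF f b] pro_comp_hom[OF a lm]])
    fix s assume s': "s \<in> Obj (Index Y')"
    then have s: "s \<in> Obj K'" by (simp add: Y'_def)
    define k where "k = ObMap D s"
    have k: "k \<in> Ob" using Dob[OF s] by (simp add: k_def)
    note kf = k_facts[OF k]
    obtain t g where tg: "(t, g) \<in> Family f (lift_index k)" "colim_eq C X (t, h k \<cdot> g) (src_index k, c k)"
      using lift_upper'[OF k] by blast
    have "(t, h k \<cdot> g) \<in> Family (pro_comp C b f) s"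
      using pro_comp_mem[OF f b s' _ tg(1)] b_mem[OF s] by (simp add: \<rho>b_def k_def)
    from family_mem[OF pro_comp_hom[OF f b] s' this _ tg(2)]
    have "(src_index k, c k) \<in> Family (pro_comp C b f) s"
      using kf by (simp add: mem_colim_elems Y'_def Gob k_def)
    moreover have "(src_index k, c k) \<in> Family (pro_comp C lm a) s"
      using pro_comp_mem[OF a lm s' lm_mem[OF s] a_mem[OF s, unfolded \<rho>a_def]] kf
      by (simp add: \<tau>_def k_def[symmetric] arr_simps)
    ultimately show "\<exists>x. x \<in> Family (pro_comp C b f) s \<and> x \<in> Family (pro_comp C lm a) s" by blast
  qed
  ultimately have "is_level_rep U C f K' F G a b \<tau>"
    unfolding is_level_rep_def using f a b cof F G nt pro_hom_objs(3,4)[OF f]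
    by (simp add: pro_cat_simps lm_def X'_def Y'_def) (simp add: mem_hom_set)
  moreover have "\<tau> s \<in> L" if "s \<in> Obj K'" for s
    using L Dob[OF that] by (simp add: \<tau>_def)
  ultimately show ?thesis
    unfolding essentially_levelwise_def by blast
qed

end

text \<open>Stated for general classes \<open>L\<close> and \<open>R\<close> so that it applies to
  both factorizations of the model category.\<close>

lemma (in category) llp_essentially_levelwise:
  fixes f :: "('i, 'o, 'a) pro_arr" and U :: "'i set set"
  assumes U: "smallness U" and f: "f \<in> Arr (pro_cat U C)" and R: "R \<subseteq> Arr C" "L \<subseteq> Arr C"
    and factor: "\<And>g. g \<in> Arr C \<Longrightarrow> \<exists>l\<in>L. \<exists>r\<in>R. Cod C l = Dom C r \<and> g = r \<cdot> l"
    and llp: "\<And>r. r \<in> R \<Longrightarrow> has_llp (pro_cat U C) f (const_map r)"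
  shows "essentially_levelwise U C L f"
proof -
  define X where "X = Src f"
  define Y where "Y = Tgt f"
  have f: "f \<in> hom_set (pro_cat U C) X Y"
    using f by (simp add: X_def Y_def mem_hom_set pro_cat_simps)
  note X = pro_hom_objs(1)[OF f] and Y = pro_hom_objs(2)[OF f]
  interpret I: category "Index X" using pro_objsD(3)[OF X] .
  interpret J: category "Index Y" using pro_objsD(3)[OF Y] .
  note all_simps = arr_simps I.arr_simps J.arr_simps functor_simps[OF pro_objsD(2)[OF X]]
    functor_simps[OF pro_objsD(2)[OF Y]]
  have "\<forall>j\<in>Obj (Index Y). \<exists>i g. (i, g) \<in> Family f j"
    using family_ex[OF f] by metis
  then obtain i0 g0 where g0: "\<And>j. j \<in> Obj (Index Y) \<Longrightarrow> (i0 j, g0 j) \<in> Family f j"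
    by metis
  have ex: "\<exists>c p h e. c \<in> L \<and> c \<in> Arr C \<and> p \<in> Arr C \<and> Dom C p = Cod C c \<and>
      p \<cdot> c = g0 j \<cdot> ArMap (Diag X) \<alpha> \<and> e \<in> Arr (Index Y) \<and> Cod (Index Y) e = j \<and>
      h \<in> hom_set C (at_index Y (Dom (Index Y) e)) (Cod C c) \<and> p \<cdot> h = ArMap (Diag Y) e \<and>
      (\<exists>t g. (t, g) \<in> Family f (Dom (Index Y) e) \<and> colim_eq C X (t, h \<cdot> g) (Dom (Index X) \<alpha>, c))"
    if j: "j \<in> Obj (Index Y)" and \<alpha>: "\<alpha> \<in> Arr (Index X)" "Cod (Index X) \<alpha> = i0 j" for j \<alpha>
  proof -
    have el0: "(i0 j, g0 j) \<in> colim_elems C X (at_index Y j)"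
      using family_class(1)[OF f j g0[OF j]] .
    then have g0C: "g0 j \<in> Arr C" "Dom C (g0 j) = at_index X (i0 j)" "Cod C (g0 j) = at_index Y j"
      by (auto simp: mem_colim_elems)
    define g1 where "g1 = g0 j \<cdot> ArMap (Diag X) \<alpha>"
    define i where "i = Dom (Index X) \<alpha>"
    have i: "i \<in> Obj (Index X)" using \<alpha> by (simp add: i_def I.arr_simps)
    have g1C: "g1 \<in> Arr C" "Dom C g1 = at_index X i" "Cod C g1 = at_index Y j"
      using g0C \<alpha> by (simp_all add: g1_def i_def all_simps)
    have g1f: "(i, g1) \<in> Family f j"
      using family_mem[OF f j g0[OF j] _ colim_eq_step[OF X \<alpha> refl el0]] g1C i
      by (simp add: mem_colim_elems g1_def i_def)
    obtain c p where cp: "c \<in> L" "p \<in> R" "Cod C c = Dom C p" "g1 = p \<cdot> c"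
      using factor[OF g1C(1)] by blast
    have cpC: "c \<in> Arr C" "p \<in> Arr C" using cp R by auto
    have "Dom C (p \<cdot> c) = Dom C c" "Cod C (p \<cdot> c) = Cod C p" using cpC cp(3) by (simp_all add: arr_simps)
    then have D: "Dom C c = at_index X i" "Cod C p = at_index Y j"
      using g1C cp(4) by simp_all
    have elu: "(i, c) \<in> colim_elems C X (Dom C p)"
      using i cpC D cp(3) by (simp add: mem_colim_elems)
    have elv: "(j, Ident C (at_index Y j)) \<in> colim_elems C Y (Cod C p)"
      using j D by (simp add: mem_colim_elems all_simps)
    \<comment> \<open>The test square: \<open>u\<close> is the class of \<open>c\<close>, and
      \<open>v\<close> is the projection of \<open>Y\<close> to index \<open>j\<close>. It commutes
      because both composites have the representative \<open>(i, g1)\<close>.\<close>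
    note u = to_const_hom[OF U X elu] and v = to_const_hom[OF U Y elv]
    note cpm = const_map_hom[OF U cpC(2)]
    have pu: "(i, g1) \<in> Family (pro_comp C (const_map p) (to_const X (Dom C p) (i, c))) undefined"
      using to_const_comp_mem[OF u(1) cpm(1,2) u(2)] cp(4) by simp
    have "(i, Ident C (at_index Y j) \<cdot> g1) \<in> Family (pro_comp C (to_const Y (Cod C p) (j, Ident C (at_index Y j))) f) undefined"
      using to_const_comp_mem[OF f v g1f] .
    then have vf: "(i, g1) \<in> Family (pro_comp C (to_const Y (Cod C p) (j, Ident C (at_index Y j))) f) undefined"
      using g1C by (simp add: arr_simps)
    have "pro_comp C (const_map p) (to_const X (Dom C p) (i, c))
        = pro_comp C (to_const Y (Cod C p) (j, Ident C (at_index Y j))) f"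
      using to_const_eqI[OF pro_comp_hom[OF u(1) cpm(1)] pro_comp_hom[OF f v(1)] pu vf]
        to_const_family_eq[OF pro_comp_hom[OF f v(1)] vf vf] by blast
    then obtain l where l: "l \<in> hom_set (pro_cat U C) Y (const_obj (Dom C p))"
      "pro_comp C l f = to_const X (Dom C p) (i, c)"
      "pro_comp C (const_map p) l = to_const Y (Cod C p) (j, Ident C (at_index Y j))"
      using llp[OF cp(2)] u(1) v(1) unfolding has_llp_const_iff[OF U cpC(2)] X_def[symmetric] Y_def[symmetric]
      by blast
    obtain t0 h0 where h0: "(t0, h0) \<in> Family l undefined" "(t0, h0) \<in> colim_elems C Y (Dom C p)"
      using to_const_rep[OF l(1)] .
    have h0C: "t0 \<in> Obj (Index Y)" "h0 \<in> Arr C" "Dom C h0 = at_index Y t0" "Cod C h0 = Dom C p"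
      using h0(2) by (auto simp: mem_colim_elems)
    have "(t0, p \<cdot> h0) \<in> Family (pro_comp C (const_map p) l) undefined"
      using to_const_comp_mem[OF l(1) cpm(1,2) h0(1)] .
    then have "colim_eq C Y (t0, p \<cdot> h0) (j, Ident C (at_index Y j))"
      unfolding l(3) using to_const_family_eq[OF v(1) _ v(2)] by blast
    \<comment> \<open>The lower triangle holds only between classes. It becomes an equality of maps
      at the source of \<open>e\<close>, to which the lift is therefore restricted.\<close>
    then obtain b e where be: "b \<in> Arr (Index Y)" "e \<in> Arr (Index Y)" "Dom (Index Y) b = Dom (Index Y) e"
      "Cod (Index Y) b = t0" "Cod (Index Y) e = j"
      "(p \<cdot> h0) \<cdot> ArMap (Diag Y) b = Ident C (at_index Y j) \<cdot> ArMap (Diag Y) e"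
      by (auto simp: colim_eq_def)
    define h where "h = h0 \<cdot> ArMap (Diag Y) b"
    have hC: "h \<in> hom_set C (at_index Y (Dom (Index Y) e)) (Cod C c)"
      using h0C be cp(3) by (simp add: h_def mem_hom_set all_simps)
    have "p \<cdot> h = (p \<cdot> h0) \<cdot> ArMap (Diag Y) b"
      using h0C be(1-5) cpC by (simp add: h_def all_simps)
    also have "\<dots> = ArMap (Diag Y) e"
      unfolding be(6) using be(1-5) by (simp add: all_simps)
    finally have ph: "p \<cdot> h = ArMap (Diag Y) e" .
    have "colim_eq C Y (t0, h0) (Dom (Index Y) e, h)"
      using colim_eq_step[OF Y be(1,4,3) h0(2)] by (simp add: h_def)
    then have hl: "(Dom (Index Y) e, h) \<in> Family l undefined"
      using family_mem[OF l(1) _ h0(1)] hC cp(3) be(2) J.dom_obj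
      by (simp add: const_obj_simps mem_colim_elems mem_hom_set)
    obtain t g where tg: "(t, g) \<in> Family f (Dom (Index Y) e)"
      using family_ex[OF f J.dom_obj[OF be(2)]] .
    \<comment> \<open>The upper triangle, read on representatives, gives the condition
      \<open>lift_upper\<close>.\<close>
    have "(t, h \<cdot> g) \<in> Family (to_const X (Dom C p) (i, c)) undefined"
      using to_const_comp_mem[OF f l(1) hl tg] l(2) by simp
    then have "colim_eq C X (t, h \<cdot> g) (i, c)"
      using to_const_family_eq[OF u(1) _ u(2)] by blast
    then show ?thesis
      using cp cpC be(2,5) hC ph tg unfolding g1_def i_def by metis
  qed
  \<comment> \<open>All conditions are bundled over pairs so that one choice yields the four
    functions that the locale expects.\<close>
  define good where "good = (\<lambda>k c p h e. c \<in> L \<and> c \<in> Arr C \<and> p \<in> Arr C \<and> Dom C p = Cod C c \<and>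
      p \<cdot> c = g0 (fst k) \<cdot> ArMap (Diag X) (snd k) \<and> e \<in> Arr (Index Y) \<and> Cod (Index Y) e = fst k \<and>
      h \<in> hom_set C (at_index Y (Dom (Index Y) e)) (Cod C c) \<and> p \<cdot> h = ArMap (Diag Y) e \<and>
      (\<exists>t g. (t, g) \<in> Family f (Dom (Index Y) e) \<and> colim_eq C X (t, h \<cdot> g) (Dom (Index X) (snd k), c)))"
  define Ks where "Ks = {(j, \<alpha>). j \<in> Obj (Index Y) \<and> \<alpha> \<in> Arr (Index X) \<and> Cod (Index X) \<alpha> = i0 j}"
  have "\<forall>k\<in>Ks. \<exists>c p h e. good k c p h e"
    unfolding good_def Ks_def using ex by auto
  then obtain c p h e where good: "\<And>k. k \<in> Ks \<Longrightarrow> good k (c k) (p k) (h k) (e k)"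
    by metis
  interpret factored_map C U X Y f i0 g0 c p h e
    by unfold_locales (use U f g0 good in \<open>auto simp: good_def Ks_def\<close>)
  show ?thesis
    by (rule essentially_levelwise) (use good in \<open>auto simp: good_def Ob_def Ks_def\<close>)
qed

theorem proposition5p5:
  fixes U :: "'i set set"
    and M :: "('o, 'a) model_cat"
    and I J :: "'a set"
    and cI cJ :: "('i, 'o, 'a) pro_arr set"
  assumes "smallness U"
    and "proper_model_category U M"
    and "I = Fib M"
    and "J = Fib M \<inter> Weq M"
    and "cI = ArMap (const_functor M) ` I"
    and "cJ = ArMap (const_functor M) ` J"
  shows "\<forall>f \<in> Arr (pro_cat U M).
           (strict_cofibration U M f \<longleftrightarrow> (\<forall>p \<in> cJ. has_llp (pro_cat U M) f p)) \<and>
           (strict_acyclic_cofibration U M f \<longleftrightarrow> (\<forall>p \<in> cI. has_llp (pro_cat U M) f p))"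
proof (intro ballI conjI)
  interpret proper_model_category U M by fact
  note U = assms(1)
  fix f :: "('i, 'o, 'a) pro_arr" assume f: "f \<in> Arr (pro_cat U M)"
  show cof: "strict_cofibration U M f \<longleftrightarrow> (\<forall>p \<in> cJ. has_llp (pro_cat U M) f p)"
  proof
    assume "strict_cofibration U M f"
    then show "\<forall>p \<in> cJ. has_llp (pro_cat U M) f p"
      using essentially_levelwise_llp[OF U] lift_cofib fib_arr
      by (auto simp: strict_cofibration_def assms)
  next
    assume "\<forall>p \<in> cJ. has_llp (pro_cat U M) f p"
    then show "strict_cofibration U M f"
      unfolding strict_cofibration_def
      by (intro llp_essentially_levelwise[OF U f, of "Fib M \<inter> Weq M"])
        (use fib_arr cofib_arr factor_cofib in \<open>auto simp: assms\<close>)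
  qed
  show "strict_acyclic_cofibration U M f \<longleftrightarrow> (\<forall>p \<in> cI. has_llp (pro_cat U M) f p)"
  proof
    assume "strict_acyclic_cofibration U M f"
    \<comment> \<open>The cofibration half is converted by \<open>cof\<close> into lifting against
      \<open>cJ\<close>, as the two-stage lift requires.\<close>
    then show "\<forall>p \<in> cI. has_llp (pro_cat U M) f p"
      using strict_weak_equivalence_llp_fib[OF U] cof
      by (auto simp: strict_acyclic_cofibration_def assms)
  next
    assume "\<forall>p \<in> cI. has_llp (pro_cat U M) f p"
    \<comment> \<open>A single representation by acyclic cofibrations then witnesses both halves of
      the definition.\<close>
    then have "essentially_levelwise U M (Cofib M \<inter> Weq M) f"
      by (intro llp_essentially_levelwise[OF U f, of "Fib M"])
        (use fib_arr cofib_arr factor_acyclic_cofib in \<open>auto simp: assms\<close>)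
    then show "strict_acyclic_cofibration U M f"
      unfolding strict_acyclic_cofibration_def strict_cofibration_def strict_weak_equivalence_def
        essentially_levelwise_def by blast
  qed
qed

end
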